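(* Let $\mu$ be any non-trivial probability measure on $\partial\mathbb{D}$ with absolutely continuous density $w$ and Verblunsky coefficients $\{\alpha_k\}$, and let $Q(z)=\sum_{m=0}^Nq_mz^m$ be any polynomial with complex coefficients. Let $p_m$ be defined by $|Q(z)|^2=\sum_{m=-N}^Np_mz^m$ for $|z|=1$, and let $$Z_Q(\mu)=\int_0^{2\pi}|Q(e^{i\theta})|^2\log w(\theta)\,\frac{d\theta}{4\pi}\in[-\infty,\infty).$$ Then $$Z_Q(\mu)=\sum_{k=0}^\infty\operatorname{Re}\bigg(p_0\log\rho_k+\sum_{m=1}^N\bar p_m\sum_{P\in M_m^0}N(P)\,\beta(P+k)\bigg),$$ where the infinite sum is the limit of its partial sums (both sides may equal $-\infty$).
   Context: Measures: $\mathbb{D}=\{|z|<1\}$; a probability measure on $\partial\mathbb{D}$ is non-trivial if its support is infinite; $\partial\mathbb{D}$ is identified with $[0,2\pi)$ via $\theta\mapsto e^{i\theta}$, and $d\mu=w(\theta)\frac{d\theta}{2\pi}+d\mu_{\rm sing}$ with $\mu_{\rm sing}$ singular. $\Phi_n$ are the monic orthogonal polynomials of $\mu$, $\Phi_n^*(z)=z^n\overline{\Phi_n(1/\bar z)}$, and the Verblunsky coefficients $\alpha_n\in\mathbb{D}$ ($n\ge0$) are defined by $\Phi_{n+1}(z)=z\Phi_n(z)-\bar\alpha_n\Phi_n^*(z)$; by convention $\alpha_{-1}=-1$ and $\alpha_n=0$ for $n\le -2$; $\rho_k=\sqrt{1-|\alpha_k|^2}$. Conventions $\log 0=-\infty$,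 $0\cdot(-\infty)=0$; $Z_Q(\mu)$ is always defined in $[-\infty,\infty)$ since the positive part of the integrand is integrable. Combinatorics: a collection is a finite multiset (unordered, repetitions allowed, identical elements indistinguishable) of couples $(k,a)$ with $k\in\mathbb{Z}$, $a\in\mathbb{N}=\{1,2,\dots\}$; the union of collections is the multiset sum, and $|P|$ is the number of elements counted with multiplicity. $M_m$ is the set of all collections $P=\{(k_1,a_1),\dots,(k_i,a_i)\}$ with $i\ge1$, $k_l\in\mathbb{Z}$, $a_l\ge 1$, $\sum_{l=1}^i a_l=m$. Put $\beta(P)=\alpha_{k_1}\bar\alpha_{k_1-a_1}\cdots\alpha_{k_i}\bar\alpha_{k_i-a_i}$. A collection is linear if $k_u<k_v-a_v$ or $k_v<k_u-a_u$ whenever $u\ne v$. For $j\ge1$, $N_j(P)$ is the number of distinct (ordered) $j$-tuples $[P_1,\dots,P_j]$ of non-empty linear collections with $\bigcup_{\ell=1}^jP_\ell=P$ (as union of collections), and $N(P)=\sum_{j=1}^{|P|}\frac{(-1)^j}{j}N_j(P)$. An integer $K$ is a cut of $P$ if $k_l\ne K$ for all $l$, $\min_l k_l<K<\max_l k_l$, and $k_u<k_v-a_v$ for all $u,v$ with $k_u<K<k_v$. $M_m^0$ is the (finite) set of $P\in M_m$ that have no cuts and satisfy $\max_l k_l=0$. Finally $P+k=\{(k_l+k,a_l)\mid (k_l,a_l)\in P\}$. *)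

theory Defs
  imports "HOL-Probability.Probability" "HOL-Computational_Algebra.Polynomial"
begin

section \<open>Measures on the unit circle\<close>

abbreviation circle_borel :: "complex measure" where
  "circle_borel \<equiv> restrict_space borel (sphere 0 1)"

abbreviation angle_lebesgue :: "real measure" where
  "angle_lebesgue \<equiv> restrict_space lborel {0..<2 * pi}"

text \<open>The measure \<open>d\<theta>/2\<pi>\<close> on \<open>[0, 2\<pi>)\<close>.\<close>

definition angle_measure :: "real measure" where
  "angle_measure = density angle_lebesgue (\<lambda>_. ennreal (1 / (2 * pi)))"

definition circle_support :: "complex measure \<Rightarrow> complex set" where
  "circle_support \<mu> =
     {z \<in> sphere 0 1. \<forall>U. open U \<and> z \<in> U \<longrightarrow> emeasure \<mu> (U \<inter> sphere 0 1) > 0}"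

definition nontrivial_circle_prob :: "complex measure \<Rightarrow> bool" where
  "nontrivial_circle_prob \<mu> \<longleftrightarrow>
     prob_space \<mu> \<and> sets \<mu> = sets circle_borel \<and> infinite (circle_support \<mu>)"

text \<open>\<open>w\<close> is (a version of) the density in the Lebesgue decomposition
  \<open>d\<mu> = w(\<theta>) d\<theta>/2\<pi> + d\<mu>\<^sub>s\<close>, the circle being identified with \<open>[0, 2\<pi>)\<close> via \<open>cis\<close>.\<close>

definition ac_density :: "complex measure \<Rightarrow> (real \<Rightarrow> real) \<Rightarrow> bool" where
  "ac_density \<mu> w \<longleftrightarrow>
     w \<in> borel_measurable (restrict_space borel {0..<2 * pi}) \<and>
     (\<forall>\<theta>\<in>{0..<2 * pi}. 0 \<le> w \<theta>) \<and>
     (\<exists>\<mu>\<^sub>s S. sets \<mu>\<^sub>s = sets circle_borel \<and> S \<in> sets circle_borel \<and>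
        emeasure (distr angle_measure circle_borel cis) S = 0 \<and>
        emeasure \<mu>\<^sub>s (sphere 0 1 - S) = 0 \<and>
        (\<forall>A\<in>sets circle_borel.
           emeasure \<mu> A =
             emeasure (distr (density angle_measure (\<lambda>\<theta>. ennreal (w \<theta>))) circle_borel cis) A
             + emeasure \<mu>\<^sub>s A))"


section \<open>Orthogonal polynomials and Verblunsky coefficients\<close>

definition monic_OP :: "complex measure \<Rightarrow> nat \<Rightarrow> complex poly" where
  "monic_OP \<mu> n = (THE p. degree p = n \<and> lead_coeff p = 1 \<and>
     (\<forall>j<n. (\<integral>z. cnj (z ^ j) * poly p z \<partial>\<mu>) = 0))"

text \<open>The values of \<open>\<Phi>\<^sub>n\<^sup>*\<close>, meaningful for \<open>z \<noteq> 0\<close> only, since \<open>1 / 0 = 0\<close>; this is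
  why the recursion below is imposed at nonzero \<open>z\<close>.\<close>

definition reversed_OP :: "complex measure \<Rightarrow> nat \<Rightarrow> complex \<Rightarrow> complex" where
  "reversed_OP \<mu> n z = z ^ n * cnj (poly (monic_OP \<mu> n) (1 / cnj z))"

definition verblunsky_nat :: "complex measure \<Rightarrow> nat \<Rightarrow> complex" where
  "verblunsky_nat \<mu> n = (THE a. \<forall>z. z \<noteq> 0 \<longrightarrow>
     poly (monic_OP \<mu> (Suc n)) z = z * poly (monic_OP \<mu> n) z - cnj a * reversed_OP \<mu> n z)"

definition verblunsky :: "complex measure \<Rightarrow> int \<Rightarrow> complex" where
  "verblunsky \<mu> k =
     (if k \<ge> 0 then verblunsky_nat \<mu> (nat k) else if k = -1 then -1 else 0)"

definition rho :: "complex measure \<Rightarrow> int \<Rightarrow> real" where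
  "rho \<mu> k = sqrt (1 - (cmod (verblunsky \<mu> k))\<^sup>2)"


section \<open>The functional \<open>Z\<^sub>Q\<close>\<close>

definition log_ext :: "real \<Rightarrow> ereal" where
  "log_ext x = (if x = 0 then -\<infinity> else ereal (ln x))"

text \<open>Integral of an extended real function as integral of the positive part minus integral of
  the negative part (\<open>e2ennreal\<close> truncates at \<open>0\<close>); only meant for the case that one of
  them is finite.\<close>

definition ereal_integral :: "'a measure \<Rightarrow> ('a \<Rightarrow> ereal) \<Rightarrow> ereal" where
  "ereal_integral M f =
     enn2ereal (\<integral>\<^sup>+x. e2ennreal (f x) \<partial>M) - enn2ereal (\<integral>\<^sup>+x. e2ennreal (- f x) \<partial>M)"

text \<open>Multiplication on \<open>ereal\<close> satisfies \<open>0 * (-\<infinity>) = 0\<close>.\<close>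

definition Z_functional :: "(complex \<Rightarrow> complex) \<Rightarrow> (real \<Rightarrow> real) \<Rightarrow> ereal" where
  "Z_functional Q w =
     ereal_integral (density angle_lebesgue (\<lambda>_. ennreal (1 / (4 * pi))))
       (\<lambda>\<theta>. ereal ((cmod (Q (cis \<theta>)))\<^sup>2) * log_ext (w \<theta>))"


section \<open>Collections\<close>

type_synonym collection = "(int \<times> nat) multiset"

definition M_set :: "nat \<Rightarrow> collection set" where
  "M_set m = {P. P \<noteq> {#} \<and> (\<forall>(k, a)\<in>#P. a \<ge> 1) \<and> (\<Sum>(k, a)\<in>#P. a) = m}"

definition beta :: "(int \<Rightarrow> complex) \<Rightarrow> collection \<Rightarrow> complex" where
  "beta \<alpha> P = (\<Prod>(k, a)\<in>#P. \<alpha> k * cnj (\<alpha> (k - int a)))"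

text \<open>The submultisets \<open>{#x, y#}\<close> of \<open>P\<close> are the pairs of elements at two different
  positions of \<open>P\<close>; \<open>x = y\<close> is possible if that element is repeated.\<close>

definition linear_collection :: "collection \<Rightarrow> bool" where
  "linear_collection P \<longleftrightarrow>
     (\<forall>k a l b. {#(k, a), (l, b)#} \<subseteq># P \<longrightarrow> k < l - int b \<or> l < k - int a)"

definition N_tuples :: "nat \<Rightarrow> collection \<Rightarrow> nat" where
  "N_tuples j P = card {Ps :: collection list. length Ps = j \<and>
     (\<forall>R\<in>set Ps. R \<noteq> {#} \<and> linear_collection R) \<and> sum_list Ps = P}"

definition N_coeff :: "collection \<Rightarrow> real" where
  "N_coeff P = (\<Sum>j = 1..size P. (-1) ^ j / real j * real (N_tuples j P))"

definition is_cut :: "collection \<Rightarrow> int \<Rightarrow> bool" where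
  "is_cut P K \<longleftrightarrow>
     (\<forall>(k, a)\<in>#P. k \<noteq> K) \<and>
     Min (fst ` set_mset P) < K \<and> K < Max (fst ` set_mset P) \<and>
     (\<forall>(k, a)\<in>#P. \<forall>(l, b)\<in>#P. k < K \<and> K < l \<longrightarrow> k < l - int b)"

definition M0_set :: "nat \<Rightarrow> collection set" where
  "M0_set m = {P \<in> M_set m. (\<nexists>K. is_cut P K) \<and> Max (fst ` set_mset P) = 0}"

definition shift_collection :: "collection \<Rightarrow> int \<Rightarrow> collection" where
  "shift_collection P n = image_mset (\<lambda>(k, a). (k + n, a)) P"

end

theory Submission
  imports Defs "HOL-Complex_Analysis.Complex_Analysis"
begin

text \<open>
  By the Szego recursion the coefficient of \<open>z\<^sup>m\<close> in the reversed polynomial \<open>\<Phi>\<^sub>n\<^sup>*\<close> is the sum of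
  \<open>\<beta>(P)\<close> over the linear collections \<open>P \<in> M\<^sub>m\<close> with all indices below \<open>n\<close>
  (\<open>fps_szego_rev\<close>), so that the coefficient of \<open>z\<^sup>m\<close> in \<open>log \<Phi>\<^sub>n\<^sup>*\<close> is \<open>- \<Sum>\<^sub>P N(P) \<beta>(P)\<close>
  (\<open>nth_log_szego_rev\<close>).  The number of \<open>j\<close>-tuples of possibly empty linear collections
  with union \<open>P\<close> is a polynomial in \<open>j\<close> whose derivative at \<open>0\<close> is \<open>- N(P)\<close>.  If \<open>P\<close> has a
  cut, then this polynomial is the product of two polynomials vanishing at \<open>0\<close>; hence
  \<open>N(P) = 0\<close> (\<open>N_coeff_cut\<close>).  What remains are the translates of the members of \<open>M\<^sub>m\<^sup>0\<close>
  (\<open>sum_window_eq_sum_translates\<close>).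

  Let \<open>v\<^sub>n = \<parallel>\<Phi>\<^sub>n\<parallel>\<^sup>2 / |\<Phi>\<^sub>n|\<^sup>2\<close> be the Bernstein--Szego density.  As \<open>\<Phi>\<^sub>n\<^sup>*\<close> has no zeros in the closed
  disc and \<open>|\<Phi>\<^sub>n| = |\<Phi>\<^sub>n\<^sup>*|\<close> on the circle, integrating \<open>log v\<^sub>n\<close> against \<open>|Q|\<^sup>2\<close> picks out
  the first Taylor coefficients of \<open>log \<Phi>\<^sub>n\<^sup>*\<close>: the \<open>n\<close>-th partial sum of the series
  equals \<open>\<integral> |Q|\<^sup>2 log v\<^sub>n d\<theta>/4\<pi>\<close> (\<open>half_entropy_eq_partial_sum\<close>).  It has to be shown that these
  integrals converge to \<open>\<integral> |Q|\<^sup>2 log w d\<theta>/4\<pi>\<close>.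

  The measures \<open>v\<^sub>n d\<theta>/2\<pi>\<close> converge weakly to \<open>\<mu>\<close>, having the same moments as \<open>\<mu>\<close> up to order
  \<open>n\<close>, and entropy is upper semicontinuous: the upper limit of \<open>\<integral> g log v\<^sub>n\<close> is at most
  \<open>\<integral> g log w\<close> for continuous \<open>g \<ge> 0\<close> (\<open>entropy_limsup_max\<close>, \<open>entropy_limsup\<close>).  This settles
  the case that \<open>\<integral> |Q|\<^sup>2 log w = -\<infinity>\<close>.  In the other case \<open>w > 0\<close> almost everywhere, and upper
  semicontinuity for the weights \<open>|Q|\<^sup>2 / (|Q|\<^sup>2 + \<delta>)\<close>, which increase to \<open>1\<close> as \<open>\<delta> \<rightarrow> 0\<close>, forces
  \<open>x\<^sub>n = w / v\<^sub>n\<close> to be close to \<open>1\<close> in the mean, because \<open>\<integral> x\<^sub>n d\<theta>/2\<pi> \<le> 1\<close> and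
  \<open>x - 1 - log x \<ge> 0\<close>.  Since \<open>log x\<^sub>n \<le> x\<^sub>n - 1\<close>, this gives the lower bound for
  \<open>\<integral> |Q|\<^sup>2 log v\<^sub>n\<close> (\<open>entropy_liminf\<close>).  No decay of the Verblunsky coefficients is presupposed.
\<close>

section \<open>Counting decompositions into linear collections\<close>

lemma finite_submultisets: "finite {R. R \<subseteq># (P :: 'a multiset)}"
proof (rule finite_subset)
  show "{R. R \<subseteq># P} \<subseteq> (\<Union>n\<in>{..size P}. multisets_of_size (set_mset P) n)"
    by (auto simp: multisets_of_size_def size_mset_mono dest: mset_subset_eqD)
  show "finite (\<Union>n\<in>{..size P}. multisets_of_size (set_mset P) n)"
    by auto
qed

text \<open>The \<open>j\<close>-tuples of multisets satisfying \<open>A\<close> whose multiset sum is \<open>P\<close>.\<close>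

definition mset_tuples :: "('a multiset \<Rightarrow> bool) \<Rightarrow> nat \<Rightarrow> 'a multiset \<Rightarrow> 'a multiset list set" where
  "mset_tuples A j P = {Ps. length Ps = j \<and> (\<forall>R\<in>set Ps. A R) \<and> sum_list Ps = P}"

lemma mset_tuples_0: "mset_tuples A 0 P = (if P = {#} then {[]} else {})"
  by (auto simp: mset_tuples_def)

lemma mset_tuples_Suc:
  "mset_tuples A (Suc j) P = (\<Union>R\<in>{R. R \<subseteq># P \<and> A R}. (#) R ` mset_tuples A j (P - R))"
proof (intro set_eqI iffI)
  fix Ps assume "Ps \<in> mset_tuples A (Suc j) P"
  then show "Ps \<in> (\<Union>R\<in>{R. R \<subseteq># P \<and> A R}. (#) R ` mset_tuples A j (P - R))"
    by (cases Ps) (auto simp: mset_tuples_def image_iff intro!: exI)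
qed (auto simp: mset_tuples_def)

lemma finite_mset_tuples [simp, intro]: "finite (mset_tuples A j P)"
proof (induction j arbitrary: P)
  case 0 then show ?case by (simp add: mset_tuples_0)
next
  case (Suc j)
  have "finite {R. R \<subseteq># P \<and> A R}"
    by (rule finite_subset[OF _ finite_submultisets[of P]]) auto
  then show ?case using Suc by (auto simp: mset_tuples_Suc)
qed

lemma card_mset_tuples_Suc:
  "card (mset_tuples A (Suc j) P) = (\<Sum>R\<in>{R. R \<subseteq># P \<and> A R}. card (mset_tuples A j (P - R)))"
proof -
  have fin: "finite {R. R \<subseteq># P \<and> A R}"
    by (rule finite_subset[OF _ finite_submultisets[of P]]) auto
  have "card (mset_tuples A (Suc j) P)
      = (\<Sum>R\<in>{R. R \<subseteq># P \<and> A R}. card ((#) R ` mset_tuples A j (P - R)))"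
    unfolding mset_tuples_Suc by (rule card_UN_disjoint[OF fin]) auto
  also have "\<dots> = (\<Sum>R\<in>{R. R \<subseteq># P \<and> A R}. card (mset_tuples A j (P - R)))"
    by (intro sum.cong refl card_image) auto
  finally show ?thesis .
qed

lemma N_tuples_eq: "N_tuples j P = card (mset_tuples (\<lambda>R. R \<noteq> {#} \<and> linear_collection R) j P)"
  by (simp add: N_tuples_def mset_tuples_def)

lemma linear_collection_empty [simp]: "linear_collection {#}"
  by (simp add: linear_collection_def)

lemma linear_collection_subset: "linear_collection P \<Longrightarrow> R \<subseteq># P \<Longrightarrow> linear_collection R"
  unfolding linear_collection_def by (meson subset_mset.trans)

lemma N_tuples_eq_0:
  assumes "size P < j" shows "N_tuples j P = 0"
proof -
  have "length Ps \<le> size (sum_list Ps)" if "\<forall>R\<in>set Ps. R \<noteq> {#}" for Ps :: "collection list"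
    using that
  proof (induction Ps)
    case (Cons R Ps)
    then have "size R \<ge> 1" by (metis One_nat_def Suc_leI nonempty_has_size list.set_intros(1))
    with Cons show ?case by auto
  qed auto
  then have "mset_tuples (\<lambda>R. R \<noteq> {#} \<and> linear_collection R) j P = {}"
    using assms by (force simp: mset_tuples_def)
  then show ?thesis by (simp add: N_tuples_eq)
qed

text \<open>Discarding the empty members of a tuple: the number of tuples with possibly empty members
  is the binomial transform of the number of tuples with non-empty members.\<close>

lemma card_linear_tuples_binomial:
  "card (mset_tuples linear_collection j P) = (\<Sum>i\<le>j. (j choose i) * N_tuples i P)"
proof (induction j arbitrary: P)
  case 0 then show ?case by (simp add: mset_tuples_0 N_tuples_eq)
next
  case (Suc j)
  let ?N = "\<lambda>i P. N_tuples i P"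
  let ?A = "{R. R \<subseteq># P \<and> linear_collection R}"
  let ?B = "{R. R \<subseteq># P \<and> R \<noteq> {#} \<and> linear_collection R}"
  have finB: "finite ?B" by (rule finite_subset[OF _ finite_submultisets[of P]]) auto
  have AB: "?A = insert {#} ?B" by auto
  have "card (mset_tuples linear_collection (Suc j) P) =
      (\<Sum>R\<in>?A. card (mset_tuples linear_collection j (P - R)))"
    by (rule card_mset_tuples_Suc)
  also have "\<dots> = card (mset_tuples linear_collection j P)
      + (\<Sum>R\<in>?B. card (mset_tuples linear_collection j (P - R)))"
    unfolding AB by (subst sum.insert) (use finB in auto)
  also have "(\<Sum>R\<in>?B. card (mset_tuples linear_collection j (P - R)))
      = (\<Sum>i\<le>j. (j choose i) * (\<Sum>R\<in>?B. ?N i (P - R)))"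
    unfolding Suc.IH sum_distrib_left by (rule sum.swap)
  also have "\<dots> = (\<Sum>i\<le>j. (j choose i) * ?N (Suc i) P)"
    unfolding N_tuples_eq card_mset_tuples_Suc by (simp add: conj_ac)
  also have "card (mset_tuples linear_collection j P) = ?N 0 P + (\<Sum>i\<le>j. (j choose Suc i) * ?N (Suc i) P)"
  proof -
    have "card (mset_tuples linear_collection j P) = (\<Sum>i\<le>Suc j. (j choose i) * ?N i P)"
      by (simp add: Suc.IH)
    then show ?thesis by (subst (asm) sum.atMost_Suc_shift) simp
  qed
  also have "?N 0 P + (\<Sum>i\<le>j. (j choose Suc i) * ?N (Suc i) P) + (\<Sum>i\<le>j. (j choose i) * ?N (Suc i) P)
      = (\<Sum>i\<le>Suc j. (Suc j choose i) * ?N i P)"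
    by (subst sum.atMost_Suc_shift) (simp add: sum.distrib[symmetric] algebra_simps)
  finally show ?case .
qed

text \<open>The polynomial \<open>t choose i\<close>.\<close>

definition binomial_poly :: "nat \<Rightarrow> real poly" where
  "binomial_poly i = smult (1 / fact i) (\<Prod>l<i. [:- real l, 1:])"

lemma poly_binomial_poly: "poly (binomial_poly i) (real j) = real (j choose i)"
proof -
  have "real (j choose i) = (real j gchoose i)" by (simp add: binomial_gbinomial)
  also have "\<dots> = (\<Prod>l<i. real j - real l) / fact i"
    by (simp add: gbinomial_prod_rev lessThan_atLeast0)
  finally show ?thesis by (simp add: binomial_poly_def poly_prod)
qed

lemma coeff_binomial_poly:
  "coeff (binomial_poly i) 0 = (if i = 0 then 1 else 0)"
  "coeff (binomial_poly i) 1 = (if i = 0 then 0 else - ((-1) ^ i / real i))"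
proof -
  show "coeff (binomial_poly i) 0 = (if i = 0 then 1 else 0)"
    by (simp add: binomial_poly_def poly_0_coeff_0[symmetric] poly_prod)
  show "coeff (binomial_poly i) 1 = (if i = 0 then 0 else - ((-1) ^ i / real i))"
  proof (cases i)
    case 0 then show ?thesis by (simp add: binomial_poly_def)
  next
    case (Suc k)
    have "(\<Prod>l<i. [:- real l, 1:]) = [:0, 1:] * (\<Prod>l<k. [:- real (Suc l), 1:])"
      by (simp add: Suc prod.lessThan_Suc_shift del: prod.lessThan_Suc)
    then have "coeff (\<Prod>l<i. [:- real l, 1:]) 1 = coeff (\<Prod>l<k. [:- real (Suc l), 1:]) 0"
      by (simp add: coeff_pCons)
    also have "\<dots> = (\<Prod>l<k. - real (Suc l))" by (simp add: poly_0_coeff_0[symmetric] poly_prod)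
    also have "\<dots> = (-1) ^ k * fact k"
      by (induction k) (auto simp: algebra_simps)
    finally show ?thesis by (simp add: binomial_poly_def Suc)
  qed
qed

text \<open>The polynomial whose value at \<open>j\<close> is the number of ways to write \<open>P\<close> as the sum of a \<open>j\<close>-tuple
  of possibly empty linear collections.\<close>

definition linear_count_poly :: "collection \<Rightarrow> real poly" where
  "linear_count_poly P = (\<Sum>i\<le>size P. smult (real (N_tuples i P)) (binomial_poly i))"

lemma poly_linear_count_poly:
  "poly (linear_count_poly P) (real j) = real (card (mset_tuples linear_collection j P))"
proof -
  let ?f = "\<lambda>i. (j choose i) * N_tuples i P"
  have "(\<Sum>i\<le>size P. ?f i) = (\<Sum>i\<in>{..size P} \<inter> {..j}. ?f i)"
    by (rule sum.mono_neutral_right) (auto simp: binomial_eq_0)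
  also have "\<dots> = (\<Sum>i\<le>j. ?f i)"
  proof (rule sum.mono_neutral_left)
    show "\<forall>i\<in>{..j} - {..size P} \<inter> {..j}. ?f i = 0"
    proof
      fix i assume "i \<in> {..j} - {..size P} \<inter> {..j}"
      then have "size P < i" by auto
      then show "?f i = 0" by (simp add: N_tuples_eq_0)
    qed
  qed auto
  finally have "real (\<Sum>i\<le>size P. ?f i) = real (\<Sum>i\<le>j. ?f i)" by simp
  then show ?thesis
    by (simp add: linear_count_poly_def poly_sum poly_binomial_poly card_linear_tuples_binomial mult_ac)
qed

lemma coeff_linear_count_poly:
  assumes "P \<noteq> {#}"
  shows "coeff (linear_count_poly P) 0 = 0" "coeff (linear_count_poly P) 1 = - N_coeff P"
proof -
  have "N_tuples 0 P = 0" using assms by (simp add: N_tuples_eq mset_tuples_0)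
  then show "coeff (linear_count_poly P) 0 = 0"
    by (auto simp: linear_count_poly_def coeff_sum coeff_binomial_poly intro!: sum.neutral)
  have "coeff (linear_count_poly P) 1
      = (\<Sum>i\<le>size P. real (N_tuples i P) * (if i = 0 then 0 else - ((-1) ^ i / real i)))"
    by (simp add: linear_count_poly_def coeff_sum coeff_binomial_poly[simplified])
  also have "\<dots> = (\<Sum>i\<in>{1..size P}. real (N_tuples i P) * (if i = 0 then 0 else - ((-1) ^ i / real i)))"
    by (rule sum.mono_neutral_right) auto
  also have "\<dots> = - N_coeff P"
    unfolding N_coeff_def sum_negf[symmetric] by (intro sum.cong) auto
  finally show "coeff (linear_count_poly P) 1 = - N_coeff P" .
qed

lemma linear_collection_union:
  assumes "linear_collection R" "linear_collection S"
    and sep: "\<And>k a l b. (k, a) \<in># R \<Longrightarrow> (l, b) \<in># S \<Longrightarrow> k < l - int b"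
    and disj: "set_mset R \<inter> set_mset S = {}"
  shows "linear_collection (R + S)"
  unfolding linear_collection_def
proof (intro allI impI)
  fix k a l b assume sub: "{#(k, a), (l, b)#} \<subseteq># R + S"
  then have mem: "(k, a) \<in># R + S" "(l, b) \<in># R + S"
    by (auto dest: mset_subset_eqD)
  have count: "count {#(k, a), (l, b)#} x \<le> count R x + count S x" for x
    using sub by (metis count_union mset_subset_eq_count)
  consider "(k, a) \<in># R" "(l, b) \<in># R" | "(k, a) \<in># S" "(l, b) \<in># S"
    | "(k, a) \<in># R" "(l, b) \<in># S" | "(k, a) \<in># S" "(l, b) \<in># R"
    using mem by auto
  then show "k < l - int b \<or> l < k - int a"
  proof cases
    case 1
    then have "(k, a) \<notin># S" "(l, b) \<notin># S" using disj by auto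
    then have "{#(k, a), (l, b)#} \<subseteq># R"
      using count by (intro mset_subset_eqI) (metis (no_types, opaque_lifting) add.right_neutral count_add_mset count_empty not_in_iff zero_le)
    then show ?thesis using assms(1) by (auto simp: linear_collection_def)
  next
    case 2
    then have "(k, a) \<notin># R" "(l, b) \<notin># R" using disj by auto
    then have "{#(k, a), (l, b)#} \<subseteq># S"
      using count by (intro mset_subset_eqI) (metis (no_types, opaque_lifting) add_0 count_add_mset count_empty not_in_iff zero_le)
    then show ?thesis using assms(2) by (auto simp: linear_collection_def)
  qed (use sep in auto)
qed

text \<open>If every couple of \<open>A\<close> lies below every couple of \<open>B\<close>, then linearity of a part of \<open>A + B\<close> can be
  tested separately on its parts in \<open>A\<close> and in \<open>B\<close>.  The predicate \<open>p\<close> tells the couples of \<open>A\<close>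
  and \<open>B\<close> apart.\<close>

lemma card_linear_tuples_union:
  assumes sep: "\<And>k a l b. (k, a) \<in># A \<Longrightarrow> (l, b) \<in># B \<Longrightarrow> k < l - int b"
    and A: "\<And>x. x \<in># A \<Longrightarrow> p x" and B: "\<And>x. x \<in># B \<Longrightarrow> \<not> p x"
  shows "card (mset_tuples linear_collection j (A + B))
    = card (mset_tuples linear_collection j A) * card (mset_tuples linear_collection j B)"
  using assms
proof (induction j arbitrary: A B)
  case 0 then show ?case by (auto simp: mset_tuples_0)
next
  case (Suc j)
  let ?L = "\<lambda>P. {R. R \<subseteq># P \<and> linear_collection R}"
  let ?c = "\<lambda>P. card (mset_tuples linear_collection j P)"
  have p1: "filter_mset p R = R" "filter_mset (\<lambda>x. \<not> p x) R = {#}" if "R \<subseteq># A" for R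
    using that Suc.prems(2) by (auto simp: filter_mset_eq_conv dest: mset_subset_eqD)
  have p2: "filter_mset p R = {#}" "filter_mset (\<lambda>x. \<not> p x) R = R" if "R \<subseteq># B" for R
    using that Suc.prems(3) by (auto simp: filter_mset_eq_conv dest: mset_subset_eqD)
  have split: "filter_mset p R \<subseteq># A" "filter_mset (\<lambda>x. \<not> p x) R \<subseteq># B" if "R \<subseteq># A + B" for R
    using multiset_filter_mono[OF that, of p] multiset_filter_mono[OF that, of "\<lambda>x. \<not> p x"]
      p1[of A] p2[of B] by auto
  have "card (mset_tuples linear_collection (Suc j) (A + B))
      = (\<Sum>R\<in>?L (A + B). ?c (A + B - R))"
    by (rule card_mset_tuples_Suc)
  also have "\<dots> = (\<Sum>(R, S)\<in>?L A \<times> ?L B. ?c (A - R) * ?c (B - S))"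
  proof (rule sum.reindex_bij_witness
      [of _ "\<lambda>(R, S). R + S" "\<lambda>T. (filter_mset p T, filter_mset (\<lambda>x. \<not> p x) T)"])
    fix T assume T: "T \<in> ?L (A + B)"
    show "(case (filter_mset p T, filter_mset (\<lambda>x. \<not> p x) T) of (R, S) \<Rightarrow> R + S) = T"
      using multiset_partition[of T p] by simp
    show "(filter_mset p T, filter_mset (\<lambda>x. \<not> p x) T) \<in> ?L A \<times> ?L B"
      using T split[of T] by (auto intro: linear_collection_subset)
    have eq: "A + B - T = (A - filter_mset p T) + (B - filter_mset (\<lambda>x. \<not> p x) T)"
    proof -
      obtain A' B' where AB: "A = filter_mset p T + A'" "B = filter_mset (\<lambda>x. \<not> p x) T + B'"
        using T split[of T] by (auto simp: mset_subset_eq_exists_conv)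
      have "A + B = T + (A' + B')"
        using multiset_partition[of T p] AB by (metis (no_types, lifting) add.assoc add.left_commute)
      then have "A + B - T = A' + B'" by simp
      moreover have "A - filter_mset p T = A'" "B - filter_mset (\<lambda>x. \<not> p x) T = B'"
        by (subst AB, simp)+
      ultimately show ?thesis by simp
    qed
    have "?c ((A - filter_mset p T) + (B - filter_mset (\<lambda>x. \<not> p x) T))
      = ?c (A - filter_mset p T) * ?c (B - filter_mset (\<lambda>x. \<not> p x) T)"
      by (rule Suc.IH) (meson Suc.prems in_diffD)+
    then show "(case (filter_mset p T, filter_mset (\<lambda>x. \<not> p x) T) of (R, S) \<Rightarrow> ?c (A - R) * ?c (B - S))
        = ?c (A + B - T)" using eq by simp
  next
    fix U assume U: "U \<in> ?L A \<times> ?L B"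
    obtain R S where RS: "U = (R, S)" "R \<subseteq># A" "S \<subseteq># B" "linear_collection R" "linear_collection S"
      using U by auto
    show "(filter_mset p (case U of (R, S) \<Rightarrow> R + S), filter_mset (\<lambda>x. \<not> p x) (case U of (R, S) \<Rightarrow> R + S)) = U"
      using RS p1[of R] p2[of S] by simp
    have "linear_collection (R + S)"
    proof (rule linear_collection_union)
      show "k < l - int b" if "(k, a) \<in># R" "(l, b) \<in># S" for k a l b
        using Suc.prems(1) that RS by (meson mset_subset_eqD)
      show "set_mset R \<inter> set_mset S = {}"
        using RS Suc.prems(2,3) by (meson disjoint_iff mset_subset_eqD)
    qed (use RS in auto)
    then show "(case U of (R, S) \<Rightarrow> R + S) \<in> ?L (A + B)"
      using RS by (auto intro: subset_mset.add_mono)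
  qed
  also have "\<dots> = (\<Sum>R\<in>?L A. ?c (A - R)) * (\<Sum>S\<in>?L B. ?c (B - S))"
    by (simp add: sum_product sum.cartesian_product)
  also have "\<dots> = card (mset_tuples linear_collection (Suc j) A) * card (mset_tuples linear_collection (Suc j) B)"
    by (simp only: card_mset_tuples_Suc)
  finally show ?case .
qed

text \<open>At a cut the count of linear decompositions is a product of two polynomials vanishing at
  \<open>0\<close>, so that its derivative at \<open>0\<close>, which is \<open>- N(P)\<close>, vanishes.\<close>

lemma N_coeff_cut:
  assumes "is_cut P K" shows "N_coeff P = 0"
proof (cases "P = {#}")
  case True then show ?thesis by (simp add: N_coeff_def)
next
  case ne: False
  define A where "A = filter_mset (\<lambda>x. fst x < K) P"
  define B where "B = filter_mset (\<lambda>x. \<not> fst x < K) P"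
  have P: "P = A + B" unfolding A_def B_def by (rule multiset_partition)
  have fin: "finite (fst ` set_mset P)" "fst ` set_mset P \<noteq> {}" using ne by auto
  have A: "A \<noteq> {#}"
    using Min_in[OF fin] assms by (force simp: A_def is_cut_def)
  have B: "B \<noteq> {#}"
    using Max_in[OF fin] assms by (force simp: B_def is_cut_def)
  have count: "card (mset_tuples linear_collection j (A + B))
    = card (mset_tuples linear_collection j A) * card (mset_tuples linear_collection j B)" for j
  proof (rule card_linear_tuples_union[where p = "\<lambda>x. fst x < K"])
    show "k < l - int b" if "(k, a) \<in># A" "(l, b) \<in># B" for k a l b
    proof -
      have "l \<noteq> K" using assms that by (auto simp: is_cut_def B_def)
      then have "k < K" "K < l" "(k, a) \<in># P" "(l, b) \<in># P" using that by (auto simp: A_def B_def)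
      then show ?thesis using assms by (fastforce simp: is_cut_def)
    qed
  qed (auto simp: A_def B_def)
  have "linear_count_poly P = linear_count_poly A * linear_count_poly B"
  proof (rule ccontr)
    let ?D = "linear_count_poly P - linear_count_poly A * linear_count_poly B"
    assume "\<not> ?thesis"
    then have "finite {x. poly ?D x = 0}" by (intro poly_roots_finite) auto
    moreover have "range real \<subseteq> {x. poly ?D x = 0}"
      using count by (auto simp: P poly_linear_count_poly)
    ultimately have "finite (range real)" by (rule rev_finite_subset)
    then show False using finite_imageD[of real UNIV] by (auto simp: inj_on_def)
  qed
  then have "coeff (linear_count_poly P) 1 = 0"
    using coeff_linear_count_poly(1)[OF A] coeff_linear_count_poly(1)[OF B]
    by (simp add: coeff_mult atMost_Suc)
  then show ?thesis using coeff_linear_count_poly(2)[OF ne] by simp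
qed

section \<open>Translates and cut-free collections\<close>

lemma shift_collection_0 [simp]: "shift_collection P 0 = P"
  by (simp add: shift_collection_def case_prod_unfold)

lemma shift_collection_add:
  "shift_collection (shift_collection P m) n = shift_collection P (m + n)"
  by (simp add: shift_collection_def multiset.map_comp comp_def case_prod_unfold add.assoc)

lemma shift_collection_union:
  "shift_collection (P + R) n = shift_collection P n + shift_collection R n"
  by (simp add: shift_collection_def)

lemma shift_collection_sum_list:
  "shift_collection (sum_list Ps) n = sum_list (map (\<lambda>P. shift_collection P n) Ps)"
  by (induction Ps) (auto simp: shift_collection_union, simp add: shift_collection_def)

lemma shift_collection_eq_empty [simp]: "shift_collection P n = {#} \<longleftrightarrow> P = {#}"
  by (simp add: shift_collection_def)

lemma size_shift_collection [simp]: "size (shift_collection P n) = size P"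
  by (simp add: shift_collection_def)

lemma set_mset_shift_collection:
  "set_mset (shift_collection P n) = (\<lambda>(k, a). (k + n, a)) ` set_mset P"
  by (simp add: shift_collection_def)

lemma linear_collection_shift:
  assumes "linear_collection P" shows "linear_collection (shift_collection P n)"
  unfolding linear_collection_def
proof (intro allI impI)
  fix k a l b assume "{#(k, a), (l, b)#} \<subseteq># shift_collection P n"
  then have "shift_collection {#(k, a), (l, b)#} (- n) \<subseteq># shift_collection (shift_collection P n) (- n)"
    unfolding shift_collection_def by (rule image_mset_subseteq_mono)
  then have "{#(k - n, a), (l - n, b)#} \<subseteq># P"
    unfolding shift_collection_add by (simp add: shift_collection_def[of "{#(k, a), (l, b)#}"])
  then have "k - n < l - n - int b \<or> l - n < k - n - int a"
    using assms unfolding linear_collection_def by blast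
  then show "k < l - int b \<or> l < k - int a" by linarith
qed

lemma N_tuples_shift_le: "N_tuples j P \<le> N_tuples j (shift_collection P n)"
  unfolding N_tuples_eq
proof (rule card_inj_on_le[where f = "map (\<lambda>R. shift_collection R n)"])
  have "inj (\<lambda>R. shift_collection R n)"
    by (rule inj_on_inverseI[where g = "\<lambda>R. shift_collection R (- n)"]) (simp add: shift_collection_add)
  then show "inj_on (map (\<lambda>R. shift_collection R n))
      (mset_tuples (\<lambda>R. R \<noteq> {#} \<and> linear_collection R) j P)"
    by (meson inj_mapI inj_on_subset subset_UNIV)
  show "map (\<lambda>R. shift_collection R n) ` mset_tuples (\<lambda>R. R \<noteq> {#} \<and> linear_collection R) j P
      \<subseteq> mset_tuples (\<lambda>R. R \<noteq> {#} \<and> linear_collection R) j (shift_collection P n)"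
    by (auto simp: mset_tuples_def shift_collection_sum_list intro!: linear_collection_shift)
qed auto

lemma N_coeff_shift: "N_coeff (shift_collection P n) = N_coeff P"
proof -
  have "N_tuples j (shift_collection P n) = N_tuples j P" for j
    using N_tuples_shift_le[of j P n] N_tuples_shift_le[of j "shift_collection P n" "- n"]
    by (simp add: shift_collection_add)
  then show ?thesis by (simp add: N_coeff_def)
qed

lemma M_set_shift: "shift_collection P n \<in> M_set m \<longleftrightarrow> P \<in> M_set m"
  by (simp add: M_set_def shift_collection_def multiset.map_comp comp_def case_prod_unfold)

lemma fst_shift_collection:
  "fst ` set_mset (shift_collection P n) = (\<lambda>k. k + n) ` fst ` set_mset P"
  by (force simp: set_mset_shift_collection)

lemma Max_fst_shift:
  assumes "P \<noteq> {#}"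
  shows "Max (fst ` set_mset (shift_collection P n)) = Max (fst ` set_mset P) + n"
  unfolding fst_shift_collection
  using Max_add_commute[of "fst ` set_mset P" "\<lambda>k. k" n] assms by simp

lemma Min_fst_shift:
  assumes "P \<noteq> {#}"
  shows "Min (fst ` set_mset (shift_collection P n)) = Min (fst ` set_mset P) + n"
  unfolding fst_shift_collection
  using Min_add_commute[of "fst ` set_mset P" "\<lambda>k. k" n] assms by simp

lemma is_cut_iff:
  "is_cut P K \<longleftrightarrow> (\<forall>x\<in>#P. fst x \<noteq> K) \<and> Min (fst ` set_mset P) < K \<and> K < Max (fst ` set_mset P) \<and>
     (\<forall>x\<in>#P. \<forall>y\<in>#P. fst x < K \<longrightarrow> K < fst y \<longrightarrow> fst x < fst y - int (snd y))"
  unfolding is_cut_def case_prod_unfold by blast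

lemma is_cut_shift_imp:
  assumes "P \<noteq> {#}" "is_cut P K" shows "is_cut (shift_collection P n) (K + n)"
proof -
  have "fst x + n < fst y + n - int (snd y)"
    if "x \<in># P" "y \<in># P" "fst x < K" "K < fst y" for x y
  proof -
    have "fst x < fst y - int (snd y)" using assms(2) that unfolding is_cut_iff by blast
    then show ?thesis by simp
  qed
  moreover have "Min (fst ` set_mset (shift_collection P n)) < K + n"
    "K + n < Max (fst ` set_mset (shift_collection P n))"
    using assms(2) unfolding is_cut_iff Max_fst_shift[OF assms(1)] Min_fst_shift[OF assms(1)] by simp_all
  moreover have "\<forall>x\<in>#P. fst x \<noteq> K" using assms(2) unfolding is_cut_iff by blast
  ultimately show ?thesis
    unfolding is_cut_iff by (simp add: set_mset_shift_collection case_prod_unfold)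
qed

lemma is_cut_shift:
  assumes "P \<noteq> {#}" shows "(\<exists>K. is_cut (shift_collection P n) K) \<longleftrightarrow> (\<exists>K. is_cut P K)"
proof
  assume "\<exists>K. is_cut (shift_collection P n) K"
  then obtain K where "is_cut (shift_collection P n) K" by auto
  from is_cut_shift_imp[OF _ this, of "- n"] assms show "\<exists>K. is_cut P K"
    by (auto simp: shift_collection_add)
qed (use is_cut_shift_imp[OF assms] in auto)

lemma collection_sum_bounds:
  assumes "P \<in> M_set m"
  shows "\<And>k a. (k, a) \<in># P \<Longrightarrow> 1 \<le> a \<and> a \<le> m" "size P \<le> m" "(\<Sum>x\<in>set_mset P. snd x) \<le> m"
proof -
  have m: "(\<Sum>x\<in>#P. snd x) = m" and pos: "\<forall>x\<in>#P. snd x \<ge> 1"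
    using assms by (auto simp: M_set_def case_prod_unfold)
  show "1 \<le> a \<and> a \<le> m" if "(k, a) \<in># P" for k a
  proof -
    have "m = (\<Sum>x\<in>#(P - {#(k, a)#}) + {#(k, a)#}. snd x)" using m that by simp
    then have "a \<le> m" by (simp only: image_mset_union sum_mset.union) simp
    then show ?thesis using that pos by force
  qed
  have "size P = (\<Sum>x\<in>#P. 1)" by simp
  also have "\<dots> \<le> (\<Sum>x\<in>#P. snd x)" using pos by (intro sum_mset_mono) auto
  finally show "size P \<le> m" using m by simp
  have "mset_set (set_mset P) \<subseteq># P"
    by (rule mset_subset_eqI) (simp add: count_mset_set')
  then obtain R where "P = mset_set (set_mset P) + R" by (auto simp: mset_subset_eq_exists_conv)
  then have "(\<Sum>x\<in>#P. snd x) = (\<Sum>x\<in>#mset_set (set_mset P). snd x) + (\<Sum>x\<in>#R. snd x)"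
    by (metis image_mset_union sum_mset.union)
  then show "(\<Sum>x\<in>set_mset P. snd x) \<le> m" using m by (simp add: sum_unfold_sum_mset)
qed

lemma finite_bounded_M_set:
  assumes "finite I" shows "finite {P \<in> M_set m. fst ` set_mset P \<subseteq> I}"
proof (rule finite_subset)
  show "{P \<in> M_set m. fst ` set_mset P \<subseteq> I}
      \<subseteq> (\<Union>n\<in>{..m}. multisets_of_size (I \<times> {1..m}) n)"
  proof
    fix P assume P: "P \<in> {P \<in> M_set m. fst ` set_mset P \<subseteq> I}"
    then have "x \<in> I \<times> {1..m}" if "x \<in># P" for x
      using collection_sum_bounds(1)[of P m "fst x" "snd x"] that by (cases x) force
    then have "P \<in> multisets_of_size (I \<times> {1..m}) (size P)"
      by (auto simp: multisets_of_size_def)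
    then show "P \<in> (\<Union>n\<in>{..m}. multisets_of_size (I \<times> {1..m}) n)"
      using P collection_sum_bounds(2) by blast
  qed
  show "finite (\<Union>n\<in>{..m}. multisets_of_size (I \<times> {1..m}) n)"
    using assms by auto
qed

text \<open>If there is no cut, then every integer strictly between the extreme indices lies in one of
  the intervals \<open>(k - a, k]\<close>, and the total length of these intervals is at most \<open>m\<close>.\<close>

lemma cut_free_range:
  assumes P: "P \<in> M_set m" and nc: "\<nexists>K. is_cut P K"
  shows "Max (fst ` set_mset P) - Min (fst ` set_mset P) \<le> int m + 1"
proof -
  let ?lo = "Min (fst ` set_mset P)" and ?hi = "Max (fst ` set_mset P)"
  let ?I = "\<lambda>x. {fst x - int (snd x)<..fst x}"
  have "{?lo<..<?hi} \<subseteq> (\<Union>x\<in>set_mset P. ?I x)"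
  proof
    fix K assume K: "K \<in> {?lo<..<?hi}"
    show "K \<in> (\<Union>x\<in>set_mset P. ?I x)"
    proof (cases "\<exists>x\<in>#P. fst x = K")
      case True
      then obtain a where "(K, a) \<in># P" by force
      then show ?thesis using collection_sum_bounds(1)[OF P, of K a] by (intro UN_I[of "(K, a)"]) auto
    next
      case False
      have "\<not> is_cut P K" using nc by blast
      with K False obtain x y where "y \<in># P" "fst x < K" "K < fst y" "\<not> fst x < fst y - int (snd y)"
        unfolding is_cut_iff by auto
      then show ?thesis by (intro UN_I[of y]) auto
    qed
  qed
  then have "card {?lo<..<?hi} \<le> card (\<Union>x\<in>set_mset P. ?I x)"
    by (intro card_mono) auto
  also have "\<dots> \<le> (\<Sum>x\<in>set_mset P. card (?I x))" by (rule card_UN_le) auto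
  also have "\<dots> \<le> m" using collection_sum_bounds(3)[OF P] by simp
  finally show ?thesis by simp
qed

text \<open>The collections all of whose couples satisfy \<open>0 \<le> k < n\<close> and \<open>-1 \<le> k - a\<close>.  If \<open>\<alpha>\<close> vanishes
  below \<open>-1\<close>, then \<open>beta \<alpha> P = 0\<close> for every other \<open>P \<in> M_set m\<close> with indices below \<open>n\<close>.\<close>

definition window :: "nat \<Rightarrow> collection \<Rightarrow> bool" where
  "window n P \<longleftrightarrow> (\<forall>(k, a)\<in>#P. 0 \<le> k \<and> k < int n \<and> 1 \<le> a \<and> int a \<le> k + 1)"

lemma finite_window_M_set: "finite {P \<in> M_set m. window n P}"
  by (rule finite_subset[OF _ finite_bounded_M_set[of "{0..<int n}" m]])
    (auto simp: window_def)

lemma beta_eq_0: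
  assumes "P \<in> M_set m" "\<not> window n P" "\<And>k. k \<in> fst ` set_mset P \<Longrightarrow> k < int n"
    and \<alpha>: "\<And>k. k < -1 \<Longrightarrow> \<alpha> k = 0"
  shows "beta \<alpha> P = 0"
proof -
  obtain k a where ka: "(k, a) \<in># P" "\<not> (0 \<le> k \<and> k < int n \<and> 1 \<le> a \<and> int a \<le> k + 1)"
    using assms(2) unfolding window_def by blast
  have "k < int n" using assms(3)[of k] ka(1) by force
  have "\<alpha> (k - int a) = 0" using ka \<open>k < int n\<close> collection_sum_bounds(1)[OF assms(1) ka(1)] by (intro \<alpha>) auto
  then have "(\<lambda>(k, a). \<alpha> k * cnj (\<alpha> (k - int a))) (k, a) = 0" by simp
  then show ?thesis unfolding beta_def using ka(1)
    by (metis (no_types, lifting) image_eqI multiset.set_map prod_mset_zero_iff)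
qed

text \<open>A collection without cuts is the translate of a unique member of \<open>M0_set m\<close>, namely by its top
  index; the collections with cuts have coefficient \<open>0\<close>.\<close>

lemma sum_window_eq_sum_translates:
  fixes \<alpha> :: "int \<Rightarrow> complex"
  assumes \<alpha>: "\<And>k. k < -1 \<Longrightarrow> \<alpha> k = 0"
  shows "(\<Sum>P | P \<in> M_set m \<and> window n P. complex_of_real (N_coeff P) * beta \<alpha> P)
    = (\<Sum>k<n. \<Sum>P\<in>M0_set m. complex_of_real (N_coeff P) * beta \<alpha> (shift_collection P (int k)))"
proof -
  let ?f = "\<lambda>P. complex_of_real (N_coeff P) * beta \<alpha> P"
  let ?top = "\<lambda>P :: collection. Max (fst ` set_mset P)"
  define U where "U = {P \<in> M_set m. (\<nexists>K. is_cut P K) \<and> 0 \<le> ?top P \<and> ?top P < int n}"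
  have ne: "P \<noteq> {#}" if "P \<in> M_set m" for P using that by (simp add: M_set_def)
  have "(\<Sum>k<n. \<Sum>P\<in>M0_set m. complex_of_real (N_coeff P) * beta \<alpha> (shift_collection P (int k)))
      = (\<Sum>(k, P)\<in>{..<n} \<times> M0_set m. ?f (shift_collection P (int k)))"
    by (simp add: sum.cartesian_product N_coeff_shift)
  also have "\<dots> = (\<Sum>P\<in>U. ?f P)"
  proof (rule sum.reindex_bij_witness[of _ "\<lambda>P. (nat (?top P), shift_collection P (- ?top P))"
        "\<lambda>(k, P). shift_collection P (int k)"])
    fix x assume "x \<in> {..<n} \<times> M0_set m"
    then obtain k P where x: "x = (k, P)" "k < n" "P \<in> M0_set m" by auto
    then have P: "P \<in> M_set m" "\<nexists>K. is_cut P K" "?top P = 0" "P \<noteq> {#}"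
      using ne by (auto simp: M0_set_def)
    show "(nat (?top (case x of (k, P) \<Rightarrow> shift_collection P (int k))),
        shift_collection (case x of (k, P) \<Rightarrow> shift_collection P (int k))
          (- ?top (case x of (k, P) \<Rightarrow> shift_collection P (int k)))) = x"
      using P by (simp add: x Max_fst_shift shift_collection_add)
    show "(case x of (k, P) \<Rightarrow> shift_collection P (int k)) \<in> U"
      using P x is_cut_shift[OF P(4), of "int k"] by (simp add: U_def Max_fst_shift M_set_shift)
  next
    fix P assume "P \<in> U"
    then have P: "P \<in> M_set m" "\<nexists>K. is_cut P K" "0 \<le> ?top P" "?top P < int n" "P \<noteq> {#}"
      using ne by (auto simp: U_def)
    define t where "t = ?top P"
    have top: "Max (fst ` set_mset (shift_collection P (- t))) = 0"
      unfolding Max_fst_shift[OF P(5)] t_def by (rule add.right_inverse)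
    have "shift_collection P (- t) \<in> M0_set m"
      using P(1,2) top is_cut_shift[OF P(5), of "- t"] by (simp add: M0_set_def M_set_shift)
    then show "(nat (?top P), shift_collection P (- ?top P)) \<in> {..<n} \<times> M0_set m"
      using P(3,4) unfolding t_def[symmetric] by simp
    show "(case (nat (?top P), shift_collection P (- ?top P)) of (k, P) \<Rightarrow> shift_collection P (int k)) = P"
      using P(3) unfolding t_def[symmetric] by (simp add: shift_collection_add)
  qed (auto simp: case_prod_beta)
  also have "\<dots> = (\<Sum>P | P \<in> M_set m \<and> window n P. ?f P)"
  proof -
    have "U \<inter> {P \<in> M_set m. window n P} = U \<inter> {P. window n P}" by (auto simp: U_def)
    have finU: "finite U"
    proof (rule finite_subset)
      show "U \<subseteq> {P \<in> M_set m. fst ` set_mset P \<subseteq> {- int m - 1..int n}}"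
      proof
        fix P assume P: "P \<in> U"
        then have "?top P - Min (fst ` set_mset P) \<le> int m + 1" "0 \<le> ?top P" "?top P < int n"
          using cut_free_range[of P m] by (auto simp: U_def)
        moreover have "Min (fst ` set_mset P) \<le> k" "k \<le> ?top P" if "k \<in> fst ` set_mset P" for k
          using that by auto
        ultimately have "fst ` set_mset P \<subseteq> {- int m - 1..int n}" by fastforce
        then show "P \<in> {P \<in> M_set m. fst ` set_mset P \<subseteq> {- int m - 1..int n}}"
          using P by (auto simp: U_def)
      qed
    qed (simp add: finite_bounded_M_set)
    have "(\<Sum>P\<in>U. ?f P) = (\<Sum>P\<in>U \<inter> {P \<in> M_set m. window n P}. ?f P)"
    proof (rule sum.mono_neutral_right[OF finU])
      show "\<forall>P\<in>U - U \<inter> {P \<in> M_set m. window n P}. ?f P = 0"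
      proof
        fix P assume P: "P \<in> U - U \<inter> {P \<in> M_set m. window n P}"
        then have "P \<in> M_set m" "\<not> window n P" "?top P < int n" by (auto simp: U_def)
        moreover have "k \<le> ?top P" if "k \<in> fst ` set_mset P" for k using that by auto
        ultimately have "beta \<alpha> P = 0" using \<alpha> by (intro beta_eq_0[of P m n]) (blast intro: le_less_trans)+
        then show "?f P = 0" by simp
      qed
    qed auto
    also have "\<dots> = (\<Sum>P | P \<in> M_set m \<and> window n P. ?f P)"
    proof (rule sum.mono_neutral_left[OF finite_window_M_set])
      show "\<forall>P\<in>{P \<in> M_set m. window n P} - U \<inter> {P \<in> M_set m. window n P}. ?f P = 0"
      proof
        fix P assume P: "P \<in> {P \<in> M_set m. window n P} - U \<inter> {P \<in> M_set m. window n P}"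
        then have "?top P \<in> fst ` set_mset P" using ne by (intro Max_in) auto
        then have "0 \<le> ?top P" "?top P < int n" using P by (auto simp: window_def)
        then obtain K where "is_cut P K" using P by (auto simp: U_def)
        then show "?f P = 0" by (simp add: N_coeff_cut)
      qed
    qed auto
    finally show ?thesis .
  qed
  finally show ?thesis by simp
qed

section \<open>The Szego recursion\<close>

text \<open>The pair \<open>(\<Phi>\<^sub>n, \<Phi>\<^sub>n\<^sup>*)\<close> produced by the Szego recursion from a sequence of
  coefficients.\<close>

primrec szego_pair :: "(nat \<Rightarrow> complex) \<Rightarrow> nat \<Rightarrow> complex poly \<times> complex poly" where
  "szego_pair a 0 = (1, 1)"
| "szego_pair a (Suc n) =
     (pCons 0 (fst (szego_pair a n)) - smult (cnj (a n)) (snd (szego_pair a n)),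
      snd (szego_pair a n) - smult (a n) (pCons 0 (fst (szego_pair a n))))"

definition szego_poly :: "(nat \<Rightarrow> complex) \<Rightarrow> nat \<Rightarrow> complex poly" where
  "szego_poly a n = fst (szego_pair a n)"

definition szego_rev :: "(nat \<Rightarrow> complex) \<Rightarrow> nat \<Rightarrow> complex poly" where
  "szego_rev a n = snd (szego_pair a n)"

lemma szego_poly_simps [simp]:
  "szego_poly a 0 = 1"
  "szego_poly a (Suc n) = pCons 0 (szego_poly a n) - smult (cnj (a n)) (szego_rev a n)"
  by (simp_all add: szego_poly_def szego_rev_def)

lemma szego_rev_simps [simp]:
  "szego_rev a 0 = 1"
  "szego_rev a (Suc n) = szego_rev a n - smult (a n) (pCons 0 (szego_poly a n))"
  by (simp_all add: szego_poly_def szego_rev_def)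

lemma szego_rev_eq_reversed:
  assumes "z \<noteq> 0"
  shows "poly (szego_rev a n) z = z ^ n * cnj (poly (szego_poly a n) (1 / cnj z))"
    and "poly (szego_poly a n) z = z ^ n * cnj (poly (szego_rev a n) (1 / cnj z))"
proof (induction n)
  case (Suc n)
  { case 1 show ?case using Suc assms by (simp add: field_simps) }
  { case 2 show ?case using Suc assms by (simp add: field_simps) }
qed auto

lemma szego_rev_circle:
  assumes "cmod z = 1"
  shows "poly (szego_rev a n) z = z ^ n * cnj (poly (szego_poly a n) z)"
proof -
  have "z \<noteq> 0" using assms by auto
  moreover have "1 / cnj z = z"
    using assms by (metis complex_div_cnj complex_cnj_cnj complex_cnj_one complex_norm_square div_by_1 complex_mod_cnj mult_1 of_real_1 one_power2)
  ultimately show ?thesis using szego_rev_eq_reversed(1)[of z a n] by simp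
qed

lemma cmod_szego_rev_circle:
  "cmod z = 1 \<Longrightarrow> cmod (poly (szego_rev a n) z) = cmod (poly (szego_poly a n) z)"
  by (simp add: szego_rev_circle norm_mult norm_power)

lemma degree_szego:
  "degree (szego_poly a n) = n \<and> coeff (szego_poly a n) n = 1 \<and> degree (szego_rev a n) \<le> n"
proof (induction n)
  case (Suc n)
  have c: "coeff (szego_poly a (Suc n)) (Suc n) = 1"
    using Suc by (simp add: coeff_eq_0)
  have "degree (szego_poly a (Suc n)) \<le> Suc n"
    using Suc by (auto intro!: degree_diff_le degree_pCons_le order.trans[OF degree_smult_le] simp: order.trans[OF degree_pCons_le])
  moreover have "Suc n \<le> degree (szego_poly a (Suc n))" by (rule le_degree) (use c in simp)
  moreover have "degree (szego_rev a (Suc n)) \<le> Suc n"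
    using Suc by (auto intro!: degree_diff_le order.trans[OF degree_smult_le] order.trans[OF degree_pCons_le])
  ultimately show ?case using c by (auto intro: le_antisym simp del: szego_poly_simps szego_rev_simps)
qed auto

lemma szego_poly_nonzero: "szego_poly a n \<noteq> 0"
  using degree_szego[of a n] by (metis coeff_0 zero_neq_one)

lemma szego_rev_0: "poly (szego_rev a n) 0 = 1"
  by (induction n) auto

text \<open>With \<open>p = \<Phi>\<^sub>n z\<close> and \<open>r = \<Phi>\<^sub>n\<^sup>* z\<close> this gives \<open>|\<Phi>\<^sub>n| \<le> |\<Phi>\<^sub>n\<^sup>*|\<close> on the
  closed disc by induction.\<close>

lemma szego_step_norm:
  fixes a p r z :: complex
  shows "(cmod (r - a * (z * p)))\<^sup>2 - (cmod (z * p - cnj a * r))\<^sup>2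
    = (1 - (cmod a)\<^sup>2) * ((cmod r)\<^sup>2 - (cmod z)\<^sup>2 * (cmod p)\<^sup>2)"
  unfolding cmod_power2 by (simp add: algebra_simps power2_eq_square)

lemma szego_rev_nonzero:
  assumes a: "\<And>n. cmod (a n) < 1" and z: "cmod z \<le> 1"
  shows "poly (szego_rev a n) z \<noteq> 0"
    and "cmod (poly (szego_poly a n) z) \<le> cmod (poly (szego_rev a n) z)"
proof (induction n)
  case (Suc n)
  let ?p = "poly (szego_poly a n) z" and ?r = "poly (szego_rev a n) z"
  have zp: "cmod (z * ?p) \<le> cmod ?r"
    using Suc(2) z mult_mono[of "cmod z" 1 "cmod ?p" "cmod ?r"] by (simp add: norm_mult)
  { case 1
    have "cmod (a n * (z * ?p)) \<le> cmod (a n) * cmod ?r"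
      using zp by (simp add: norm_mult[of "a n"] mult_left_mono)
    also have "\<dots> < cmod ?r" using Suc(1) a[of n] by simp
    finally have "?r \<noteq> a n * (z * ?p)" by auto
    then show ?case by (simp add: mult.left_commute) }
  { case 2
    have "(cmod z)\<^sup>2 * (cmod ?p)\<^sup>2 \<le> (cmod ?r)\<^sup>2"
      using zp by (metis norm_ge_zero norm_mult power_mono power_mult_distrib)
    moreover have "(cmod (a n))\<^sup>2 \<le> 1" using a[of n] by (simp add: abs_square_le_1 less_imp_le)
    ultimately have "0 \<le> (1 - (cmod (a n))\<^sup>2) * ((cmod ?r)\<^sup>2 - (cmod z)\<^sup>2 * (cmod ?p)\<^sup>2)"
      by simp
    then have "(cmod (z * ?p - cnj (a n) * ?r))\<^sup>2 \<le> (cmod (?r - a n * (z * ?p)))\<^sup>2"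
      using szego_step_norm[of ?r "a n" z ?p] by linarith
    then show ?case by (simp add: power2_le_iff_abs_le mult.left_commute) }
qed auto

section \<open>Coefficients of the reversed polynomials and of their logarithms\<close>

text \<open>The number \<open>m\<close> for which a non-empty collection with positive second components belongs to
  \<open>M_set m\<close>.\<close>

definition collection_degree :: "collection \<Rightarrow> nat" where
  "collection_degree P = (\<Sum>(k, a)\<in>#P. a)"

text \<open>The linear collections that contribute to \<open>\<Phi>\<^sub>n\<^sup>*\<close>.\<close>

definition linear_window :: "nat \<Rightarrow> collection set" where
  "linear_window n = {P. linear_collection P \<and> window n P}"

text \<open>A linear collection contains at most one couple \<open>(n, b)\<close> with top index \<open>n\<close>, and its other couples
  have indices below \<open>n - b\<close>.  The subtraction \<open>n - b\<close> on natural numbers is truncated for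
  \<open>b = n + 1\<close>, when \<open>linear_window 0\<close> contains the empty collection only, as it should.\<close>

lemma linear_window_Suc:
  "linear_window (Suc n) =
     linear_window n \<union> (\<Union>b\<in>{1..Suc n}. add_mset (int n, b) ` linear_window (n - b))"
    (is "?L = ?R")
proof (intro set_eqI iffI)
  fix P assume P: "P \<in> ?L"
  show "P \<in> ?R"
  proof (cases "\<exists>b. (int n, b) \<in># P")
    case False
    then have "window n P" using P unfolding linear_window_def window_def
      by (auto simp: less_le dest!: bspec)
    then show ?thesis using P by (auto simp: linear_window_def)
  next
    case True
    then obtain b P' where P': "P = add_mset (int n, b) P'" by (metis insert_DiffM)
    have b: "b \<in> {1..Suc n}" using P by (auto simp: P' linear_window_def window_def)
    have "0 \<le> l \<and> l < int (n - b) \<and> 1 \<le> c \<and> int c \<le> l + 1" if "(l, c) \<in># P'" for l c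
    proof -
      have "{#(int n, b), (l, c)#} \<subseteq># P" using that by (simp add: P')
      then have "int n < l - int c \<or> l < int n - int b"
        using P by (auto simp: linear_window_def linear_collection_def)
      moreover have "0 \<le> l \<and> l < int (Suc n) \<and> 1 \<le> c \<and> int c \<le> l + 1"
        using P that unfolding linear_window_def window_def P' by fastforce
      ultimately show ?thesis by auto
    qed
    then have "window (n - b) P'" by (auto simp: window_def)
    moreover have "linear_collection P'"
      using P by (auto simp: linear_window_def P' intro: linear_collection_subset)
    ultimately show ?thesis using P' b by (auto simp: linear_window_def)
  qed
next
  fix P assume P: "P \<in> ?R"
  show "P \<in> ?L"
  proof (cases "P \<in> linear_window n")
    case True then show ?thesis by (fastforce simp: linear_window_def window_def)
  next
    case False
    then obtain b P' where b: "b \<in> {1..Suc n}" "P = add_mset (int n, b) P'" "P' \<in> linear_window (n - b)"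
      using P by auto
    have el: "0 \<le> l \<and> l < int (n - b) \<and> 1 \<le> c \<and> int c \<le> l + 1" if "(l, c) \<in># P'" for l c
      using b(3) that unfolding linear_window_def window_def by fastforce
    have "linear_collection (P' + {#(int n, b)#})"
    proof (rule linear_collection_union)
      show "linear_collection P'" using b by (simp add: linear_window_def)
      show "linear_collection {#(int n, b)#}"
        unfolding linear_collection_def by (auto dest: size_mset_mono)
      show "k < l - int c" if "(k, a) \<in># P'" "(l, c) \<in># {#(int n, b)#}" for k a l c
        using el[OF that(1)] that(2) by auto
      show "set_mset P' \<inter> set_mset {#(int n, b)#} = {}" using el[of "int n" b] by auto
    qed
    moreover have "window (Suc n) P" using el b by (fastforce simp: window_def)
    ultimately show ?thesis using b by (simp add: linear_window_def)
  qed
qed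

lemma linear_window_0: "linear_window 0 = {{#}}"
proof -
  have "P = {#}" if "window 0 P" for P
    using that by (cases P) (auto simp: window_def)
  then show ?thesis by (auto simp: linear_window_def window_def)
qed

lemma finite_linear_window [simp, intro]: "finite (linear_window n)"
proof (induction n rule: less_induct)
  case (less n)
  show ?case
  proof (cases n)
    case 0 then show ?thesis by (simp add: linear_window_0)
  next
    case (Suc k)
    have "finite (linear_window (k - b))" for b using less Suc by simp
    then show ?thesis using less Suc by (simp add: linear_window_Suc)
  qed
qed

text \<open>The monomial \<open>\<beta>(P) X\<^sup>m\<close> for \<open>P \<in> M\<^sub>m\<close>.\<close>

definition collection_weight :: "(int \<Rightarrow> complex) \<Rightarrow> collection \<Rightarrow> complex fps" where
  "collection_weight v P = fps_const (beta v P) * fps_X ^ collection_degree P"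

lemma beta_union: "beta v (P + R) = beta v P * beta v R"
  by (simp add: beta_def)

lemma collection_degree_union: "collection_degree (P + R) = collection_degree P + collection_degree R"
  by (simp add: collection_degree_def)

lemma collection_weight_empty [simp]: "collection_weight v {#} = 1"
  by (simp add: collection_weight_def beta_def collection_degree_def)

lemma collection_weight_union:
  "collection_weight v (P + R) = collection_weight v P * collection_weight v R"
  unfolding collection_weight_def beta_union collection_degree_union power_add
    fps_const_mult[symmetric] by (simp only: mult_ac)

lemma collection_weight_add_mset:
  "collection_weight v (add_mset (k, b) P)
    = fps_const (v k * cnj (v (k - int b))) * fps_X ^ b * collection_weight v P"
  using collection_weight_union[of v "{#(k, b)#}" P]
  by (simp add: collection_weight_def beta_def collection_degree_def)

lemma collection_weight_sum_list:
  "collection_weight v (sum_list Ps) = prod_list (map (collection_weight v) Ps)"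
  by (induction Ps) (auto simp: collection_weight_union)

lemma nth_collection_weight:
  "fps_nth (collection_weight v P) m = (if collection_degree P = m then beta v P else 0)"
  by (simp add: collection_weight_def)

lemma sum_power_lists:
  fixes w :: "'b \<Rightarrow> 'c :: comm_semiring_1"
  assumes "finite A"
  shows "(\<Sum>x\<in>A. w x) ^ j = (\<Sum>xs | length xs = j \<and> set xs \<subseteq> A. prod_list (map w xs))"
proof (induction j)
  case 0
  have "{xs :: 'b list. length xs = 0 \<and> set xs \<subseteq> A} = {[]}" by auto
  then show ?case by simp
next
  case (Suc j)
  let ?L = "\<lambda>j. {xs. length xs = j \<and> set xs \<subseteq> A}"
  have fin: "finite (?L j)" using finite_lists_length_eq[OF assms, of j] by (simp add: conj_commute)
  have "(\<Sum>x\<in>A. w x) ^ Suc j = (\<Sum>(x, xs)\<in>A \<times> ?L j. w x * prod_list (map w xs))"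
    by (simp add: Suc sum_product sum.cartesian_product)
  also have "\<dots> = (\<Sum>xs\<in>?L (Suc j). prod_list (map w xs))"
    by (rule sum.reindex_bij_witness[of _ "\<lambda>xs. (hd xs, tl xs)" "\<lambda>(x, xs). x # xs"])
      (auto simp: length_Suc_conv)
  finally show ?case .
qed

context
  fixes v :: "int \<Rightarrow> complex" and a :: "nat \<Rightarrow> complex"
  assumes v_nat: "\<And>n. v (int n) = a n" and v_m1: "v (-1) = -1"
begin

text \<open>Iterating the recursion for \<open>\<Phi>\<^sub>n\<close> down to \<open>\<Phi>\<^sub>0 = 1\<close>, which enters as the summand
  \<open>b = n + 1\<close> on account of \<open>\<alpha>\<^sub>-\<^sub>1 = -1\<close>.\<close>

lemma fps_szego_poly:
  "fps_X * fps_of_poly (szego_poly a n) =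
    - (\<Sum>b=1..Suc n. fps_const (cnj (v (int n - int b))) * fps_X ^ b * fps_of_poly (szego_rev a (n - b)))"
proof (induction n)
  case 0 then show ?case by (simp add: v_m1)
next
  case (Suc n)
  let ?t = "\<lambda>n b. fps_const (cnj (v (int n - int b))) * fps_X ^ b * fps_of_poly (szego_rev a (n - b))"
  have "fps_X * fps_of_poly (szego_poly a (Suc n))
      = fps_X * (fps_X * fps_of_poly (szego_poly a n)) - fps_const (cnj (a n)) * fps_X * fps_of_poly (szego_rev a n)"
    by (simp add: fps_of_poly_diff fps_of_poly_pCons fps_of_poly_smult algebra_simps)
  also have "\<dots> = - (\<Sum>b=1..Suc n. fps_X * ?t n b) - ?t (Suc n) 1"
    unfolding Suc by (simp add: sum_distrib_left v_nat del: sum.cl_ivl_Suc)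
  also have "(\<Sum>b=1..Suc n. fps_X * ?t n b) = (\<Sum>b=1..Suc n. ?t (Suc n) (Suc b))"
    by (intro sum.cong) (auto simp: algebra_simps)
  also have "\<dots> = (\<Sum>b=Suc 1..Suc (Suc n). ?t (Suc n) b)"
    by (rule sum.shift_bounds_cl_Suc_ivl[symmetric])
  also have "- \<dots> - ?t (Suc n) 1 = - (\<Sum>b=1..Suc (Suc n). ?t (Suc n) b)"
    by (subst (2) sum.atLeast_Suc_atMost) auto
  finally show ?case .
qed

lemma fps_szego_rev_Suc:
  "fps_of_poly (szego_rev a (Suc n)) = fps_of_poly (szego_rev a n) +
    (\<Sum>b=1..Suc n. fps_const (v (int n) * cnj (v (int n - int b))) * fps_X ^ b
      * fps_of_poly (szego_rev a (n - b)))"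
proof -
  have "fps_of_poly (szego_rev a (Suc n))
      = fps_of_poly (szego_rev a n) - fps_const (a n) * (fps_X * fps_of_poly (szego_poly a n))"
    by (simp add: fps_of_poly_diff fps_of_poly_pCons fps_of_poly_smult algebra_simps)
  then show ?thesis unfolding fps_szego_poly
    by (simp add: sum_distrib_left v_nat mult.assoc[symmetric] del: sum.cl_ivl_Suc)
qed

theorem fps_szego_rev:
  "fps_of_poly (szego_rev a n) = (\<Sum>P\<in>linear_window n. collection_weight v P)"
proof (induction n rule: less_induct)
  case (less n)
  show ?case
  proof (cases n)
    case 0 then show ?thesis by (simp add: linear_window_0)
  next
    case (Suc k)
    let ?w = "collection_weight v"
    let ?A = "\<lambda>b. add_mset (int k, b) ` linear_window (k - b)"
    have top: "l < int k" if "P \<in> linear_window (k - b)" "(l, c) \<in># P" for P l b c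
      using that unfolding linear_window_def window_def by fastforce
    have "(\<Sum>P\<in>linear_window n. ?w P) = (\<Sum>P\<in>linear_window k. ?w P) + (\<Sum>P\<in>(\<Union>b\<in>{1..Suc k}. ?A b). ?w P)"
      unfolding Suc linear_window_Suc
    proof (rule sum.union_disjoint)
      show "linear_window k \<inter> (\<Union>b\<in>{1..Suc k}. ?A b) = {}"
        using top[of _ 0] by fastforce
    qed auto
    also have "(\<Sum>P\<in>(\<Union>b\<in>{1..Suc k}. ?A b). ?w P) = (\<Sum>b\<in>{1..Suc k}. \<Sum>P\<in>?A b. ?w P)"
    proof (rule sum.UNION_disjoint)
      show "\<forall>i\<in>{1..Suc k}. \<forall>j\<in>{1..Suc k}. i \<noteq> j \<longrightarrow> ?A i \<inter> ?A j = {}"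
      proof (intro ballI impI)
        fix i j :: nat assume "i \<noteq> j"
        show "?A i \<inter> ?A j = {}"
        proof (rule ccontr)
          assume "?A i \<inter> ?A j \<noteq> {}"
          then obtain P P' where "P \<in> linear_window (k - i)" "P' \<in> linear_window (k - j)"
            "add_mset (int k, i) P = add_mset (int k, j) P'" by auto
          then have "(int k, j) \<in># add_mset (int k, i) P" by simp
          with \<open>i \<noteq> j\<close> have "(int k, j) \<in># P" by simp
          then show False using top[OF \<open>P \<in> linear_window (k - i)\<close>] by force
        qed
      qed
    qed auto
    also have "\<dots> = (\<Sum>b\<in>{1..Suc k}. \<Sum>P\<in>linear_window (k - b). ?w (add_mset (int k, b) P))"
      by (rule sum.cong[OF refl], subst sum.reindex) (auto simp: inj_on_def)
    also have "\<dots> = (\<Sum>b=1..Suc k. fps_const (v (int k) * cnj (v (int k - int b))) * fps_X ^ b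
      * fps_of_poly (szego_rev a (k - b)))"
      using less Suc by (intro sum.cong refl) (simp add: collection_weight_add_mset sum_distrib_left)
    also have "(\<Sum>P\<in>linear_window k. ?w P) = fps_of_poly (szego_rev a k)" using less Suc by simp
    finally show ?thesis unfolding Suc fps_szego_rev_Suc by simp
  qed
qed

lemma nth_power_szego_rev:
  assumes "0 < j"
  shows "fps_nth ((fps_of_poly (szego_rev a n) - 1) ^ j) m
    = (\<Sum>P | P \<in> M_set m \<and> window n P. of_nat (N_tuples j P) * beta v P)"
proof -
  let ?A = "linear_window n - {{#}}"
  let ?W = "{P \<in> M_set m. window n P}"
  let ?L = "{Ps. length Ps = j \<and> set Ps \<subseteq> ?A}"
  have finL: "finite ?L" using finite_lists_length_eq[of ?A j] by (simp add: conj_commute)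
  have "{#} \<in> linear_window n" by (simp add: linear_window_def window_def)
  then have "fps_of_poly (szego_rev a n) - 1 = (\<Sum>P\<in>?A. collection_weight v P)"
    unfolding fps_szego_rev by (subst sum.remove[of _ "{#}"]) auto
  then have "fps_nth ((fps_of_poly (szego_rev a n) - 1) ^ j) m
      = fps_nth (\<Sum>Ps\<in>?L. prod_list (map (collection_weight v) Ps)) m"
    by (simp add: sum_power_lists)
  also have "\<dots> = (\<Sum>Ps\<in>?L. if collection_degree (sum_list Ps) = m then beta v (sum_list Ps) else 0)"
    unfolding collection_weight_sum_list[symmetric] by (simp add: fps_sum_nth nth_collection_weight)
  also have "\<dots> = (\<Sum>Ps | Ps \<in> ?L \<and> collection_degree (sum_list Ps) = m. beta v (sum_list Ps))"
    by (rule sum.inter_filter[OF finL, symmetric])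
  also have "\<dots> = (\<Sum>P\<in>?W. \<Sum>Ps | Ps \<in> {Ps \<in> ?L. collection_degree (sum_list Ps) = m} \<and> sum_list Ps = P. beta v (sum_list Ps))"
  proof (rule sum.group[symmetric])
    show "sum_list ` {Ps \<in> ?L. collection_degree (sum_list Ps) = m} \<subseteq> ?W"
    proof safe
      fix Ps assume Ps: "set Ps \<subseteq> ?A" "j = length Ps" "m = collection_degree (sum_list Ps)"
      have mem: "x \<in># sum_list Ps \<longleftrightarrow> (\<exists>R\<in>set Ps. x \<in># R)" for x
        by (induction Ps) auto
      show w: "window n (sum_list Ps)"
        using Ps(1) unfolding window_def by (auto simp: mem linear_window_def window_def)
      have "sum_list Ps \<noteq> {#}" using Ps assms by (cases Ps) auto
      moreover have "\<forall>(k, a)\<in>#sum_list Ps. a \<ge> 1" using w unfolding window_def by fastforce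
      ultimately show "sum_list Ps \<in> M_set (collection_degree (sum_list Ps))"
        unfolding M_set_def collection_degree_def by simp
    qed
  qed (use finL finite_window_M_set in \<open>auto intro: rev_finite_subset\<close>)
  also have "\<dots> = (\<Sum>P\<in>?W. of_nat (N_tuples j P) * beta v P)"
  proof (intro sum.cong refl)
    fix P assume P: "P \<in> ?W"
    have "{Ps. Ps \<in> {Ps \<in> ?L. collection_degree (sum_list Ps) = m} \<and> sum_list Ps = P}
        = {Ps. length Ps = j \<and> (\<forall>R\<in>set Ps. R \<noteq> {#} \<and> linear_collection R) \<and> sum_list Ps = P}"
      (is "?S = ?T")
    proof
      show "?T \<subseteq> ?S"
      proof
        fix Ps assume Ps: "Ps \<in> ?T"
        have sub: "R \<subseteq># P" if R: "R \<in> set Ps" for R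
        proof -
          obtain ys zs where "Ps = ys @ R # zs" using split_list[OF R] by blast
          then have "sum_list Ps = R + (sum_list ys + sum_list zs)"
            by (simp only: sum_list.append sum_list.Cons add.left_commute)
          moreover have "sum_list Ps = P" using Ps by blast
          ultimately show ?thesis by (metis mset_subset_eq_add_left)
        qed
        have win: "window n R" if R: "R \<in> set Ps" for R
        proof -
          have "set_mset R \<subseteq> set_mset P" using sub[OF R] by (rule set_mset_mono)
          then show ?thesis using P unfolding window_def by (metis (no_types, lifting) mem_Collect_eq subsetD)
        qed
        have "collection_degree P = m" using P by (simp add: M_set_def collection_degree_def)
        moreover have "set Ps \<subseteq> ?A"
        proof
          fix R assume R: "R \<in> set Ps"
          moreover have "R \<noteq> {#} \<and> linear_collection R" using Ps R by simp
          ultimately show "R \<in> ?A" using win by (simp add: linear_window_def)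
        qed
        ultimately show "Ps \<in> ?S" using Ps by simp
      qed
    qed (auto simp: linear_window_def)
    then have "(\<Sum>Ps | Ps \<in> {Ps \<in> ?L. collection_degree (sum_list Ps) = m} \<and> sum_list Ps = P. beta v (sum_list Ps))
        = (\<Sum>Ps\<in>?T. beta v P)" by (intro sum.cong) auto
    then show "(\<Sum>Ps | Ps \<in> {Ps \<in> ?L. collection_degree (sum_list Ps) = m} \<and> sum_list Ps = P. beta v (sum_list Ps))
        = of_nat (N_tuples j P) * beta v P" by (simp add: N_tuples_def)
  qed
  finally show ?thesis .
qed

text \<open>The coefficients of the formal logarithm \<open>log \<Phi>\<^sub>n\<^sup>* = \<Sum>\<^sub>j (-1)\<^sup>j\<^sup>+\<^sup>1 (\<Phi>\<^sub>n\<^sup>* - 1)\<^sup>j / j\<close>.\<close>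

theorem nth_log_szego_rev:
  assumes "0 < m"
  shows "fps_nth (fps_compose (fps_ln 1) (fps_of_poly (szego_rev a n) - 1)) m
    = - (\<Sum>P | P \<in> M_set m \<and> window n P. complex_of_real (N_coeff P) * beta v P)"
proof -
  let ?W = "{P \<in> M_set m. window n P}"
  have "fps_nth (fps_compose (fps_ln 1) (fps_of_poly (szego_rev a n) - 1)) m
      = (\<Sum>j=0..m. fps_nth (fps_ln 1 :: complex fps) j * fps_nth ((fps_of_poly (szego_rev a n) - 1) ^ j) m)"
    by (simp add: fps_compose_nth)
  also have "\<dots> = (\<Sum>j=1..m. fps_nth (fps_ln 1 :: complex fps) j * fps_nth ((fps_of_poly (szego_rev a n) - 1) ^ j) m)"
    by (rule sum.mono_neutral_right) (auto simp: fps_ln_def)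
  also have "\<dots> = (\<Sum>j=1..m. \<Sum>P\<in>?W. - ((-1) ^ j / of_nat j) * of_nat (N_tuples j P) * beta v P)"
  proof (intro sum.cong refl)
    fix j assume j: "j \<in> {1..m}"
    then obtain i where "j = Suc i" by (cases j) auto
    then have "fps_nth (fps_ln 1 :: complex fps) j = - ((-1) ^ j / of_nat j)"
      by (simp add: fps_ln_def)
    then show "fps_nth (fps_ln 1 :: complex fps) j * fps_nth ((fps_of_poly (szego_rev a n) - 1) ^ j) m
      = (\<Sum>P\<in>?W. - ((-1) ^ j / of_nat j) * of_nat (N_tuples j P) * beta v P)"
      using j by (simp add: nth_power_szego_rev sum_distrib_left mult.assoc)
  qed
  also have "\<dots> = (\<Sum>P\<in>?W. \<Sum>j=1..m. - ((-1) ^ j / of_nat j) * of_nat (N_tuples j P) * beta v P)"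
    by (rule sum.swap)
  also have "\<dots> = (\<Sum>P\<in>?W. - (complex_of_real (N_coeff P) * beta v P))"
  proof (intro sum.cong refl)
    fix P assume P: "P \<in> ?W"
    have "(\<Sum>j=1..m. - ((-1) ^ j / of_nat j) * of_nat (N_tuples j P) * beta v P)
      = (\<Sum>j=1..size P. - ((-1) ^ j / of_nat j) * of_nat (N_tuples j P) * beta v P)"
      using P collection_sum_bounds(2)[of P m]
      by (intro sum.mono_neutral_right) (auto simp: N_tuples_eq_0)
    then show "(\<Sum>j=1..m. - ((-1) ^ j / of_nat j) * of_nat (N_tuples j P) * beta v P)
        = - (complex_of_real (N_coeff P) * beta v P)"
      by (simp add: N_coeff_def sum_distrib_right sum_negf)
  qed
  finally show ?thesis by (simp add: sum_negf)
qed

end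

section \<open>Normalized Lebesgue measure on the circle\<close>

text \<open>The image of \<open>d\<theta>/2\<pi>\<close> on the circle.\<close>

definition circ :: "complex measure" where
  "circ = distr angle_measure circle_borel cis"

lemma sets_angle_measure [measurable_cong]: "sets angle_measure = sets (restrict_space borel {0..<2 * pi})"
  by (simp add: angle_measure_def sets_restrict_space)

lemma space_angle_measure [simp]: "space angle_measure = {0..<2 * pi}"
  by (simp add: angle_measure_def space_restrict_space)

lemma cis_measurable [measurable]: "cis \<in> angle_measure \<rightarrow>\<^sub>M circle_borel"
proof (rule measurable_restrict_space2)
  have "cis \<in> borel_measurable borel" by (intro borel_measurable_continuous_onI continuous_intros)
  then show "cis \<in> angle_measure \<rightarrow>\<^sub>M borel"
    by (simp add: measurable_cong_sets[OF sets_angle_measure refl] measurable_restrict_space1)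
qed auto

lemma sets_circ [simp, measurable_cong]: "sets circ = sets circle_borel"
  by (simp add: circ_def)

lemma space_circ [simp]: "space circ = sphere 0 1"
  by (simp add: circ_def space_restrict_space)

lemma prob_space_angle_measure: "prob_space angle_measure"
proof
  have "emeasure angle_measure (space angle_measure)
      = ennreal (1 / (2 * pi)) * emeasure lborel {0..<2 * pi}"
    unfolding angle_measure_def
    by (subst emeasure_density_const)
      (auto simp: space_restrict_space emeasure_restrict_space sets_restrict_space)
  also have "\<dots> = 1" by (simp add: ennreal_mult[symmetric])
  finally show "emeasure angle_measure (space angle_measure) = 1" .
qed

lemma prob_space_circ: "prob_space circ"
  unfolding circ_def by (intro prob_space.prob_space_distr prob_space_angle_measure) simp

interpretation circ: prob_space circ by (rule prob_space_circ)

lemma continuous_circle_measurable: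
  assumes "continuous_on (sphere 0 1) f" "sets M = sets circle_borel"
  shows "f \<in> borel_measurable M"
  using borel_measurable_continuous_on_restrict[OF assms(1)]
  by (simp add: measurable_cong_sets[OF assms(2) refl])

lemma space_circle: "sets M = sets circle_borel \<Longrightarrow> space M = sphere 0 1"
  by (drule sets_eq_imp_space_eq) (simp add: space_restrict_space)

lemma integrable_continuous_circle:
  fixes f :: "complex \<Rightarrow> 'b :: {banach, second_countable_topology}"
  assumes "finite_measure M" "sets M = sets circle_borel" "continuous_on (sphere 0 1) f"
  shows "integrable M f"
proof -
  have "bounded (f ` sphere 0 1)"
    using compact_continuous_image[OF assms(3)] compact_imp_bounded by auto
  then obtain B where "\<forall>z\<in>sphere 0 1. norm (f z) \<le> B"
    by (auto simp: bounded_iff)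
  then show ?thesis
    using assms continuous_circle_measurable[OF assms(3,2)] space_circle[OF assms(2)]
    by (intro finite_measure.integrable_const_bound[of M f B]) auto
qed

lemma circ_integrable:
  fixes f :: "complex \<Rightarrow> 'b :: {banach, second_countable_topology}"
  shows "continuous_on (sphere 0 1) f \<Longrightarrow> integrable circ f"
  by (rule integrable_continuous_circle[OF prob_space.finite_measure[OF prob_space_circ] sets_circ])

lemma circ_cong: "(\<And>z. cmod z = 1 \<Longrightarrow> f z = g z) \<Longrightarrow> integral\<^sup>L circ f = integral\<^sup>L circ g"
  by (rule Bochner_Integration.integral_cong) auto

lemma integral_circ:
  fixes f :: "complex \<Rightarrow> 'b :: {banach, second_countable_topology}"
  assumes [measurable]: "f \<in> borel_measurable circle_borel"
  shows "(\<integral>z. f z \<partial>circ) = (\<integral>\<theta>. f (cis \<theta>) \<partial>angle_measure)"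
  unfolding circ_def by (rule integral_distr) auto

lemma integral_angle_measure:
  fixes g :: "real \<Rightarrow> complex"
  assumes g: "g \<in> borel_measurable borel"
  shows "(\<integral>\<theta>. g \<theta> \<partial>angle_measure) = (1 / (2 * pi)) *\<^sub>R (\<integral>\<theta>. indicator {0..2 * pi} \<theta> *\<^sub>R g \<theta> \<partial>lborel)"
proof -
  have "g \<in> borel_measurable angle_lebesgue"
    using g by (simp add: measurable_restrict_space1)
  then have "(\<integral>\<theta>. g \<theta> \<partial>angle_measure) = (\<integral>\<theta>. (1 / (2 * pi)) *\<^sub>R g \<theta> \<partial>angle_lebesgue)"
    unfolding angle_measure_def by (intro integral_density) auto
  also have "\<dots> = (1 / (2 * pi)) *\<^sub>R (\<integral>\<theta>. g \<theta> \<partial>angle_lebesgue)" by simp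
  also have "(\<integral>\<theta>. g \<theta> \<partial>angle_lebesgue) = (\<integral>\<theta>. indicator {0..<2 * pi} \<theta> *\<^sub>R g \<theta> \<partial>lborel)"
    by (subst integral_restrict_space) (auto simp: set_lebesgue_integral_def)
  also have "\<dots> = (\<integral>\<theta>. indicator {0..2 * pi} \<theta> *\<^sub>R g \<theta> \<partial>lborel)"
  proof (rule integral_cong_AE)
    have "AE \<theta> in lborel. \<theta> \<noteq> 2 * pi" by (rule AE_lborel_singleton)
    then show "AE \<theta> in lborel. indicator {0..<2 * pi} \<theta> *\<^sub>R g \<theta> = indicator {0..2 * pi} \<theta> *\<^sub>R g \<theta>"
      by eventually_elim (auto simp: indicator_def)
  qed (use g in measurable)
  finally show ?thesis .
qed

lemma integral_circ_power:
  assumes "k \<noteq> 0" shows "(\<integral>z. z ^ k \<partial>circ) = 0"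
proof -
  let ?F = "\<lambda>\<theta>. cis (real k * \<theta>) / (\<i> * of_nat k)"
  have "(\<integral>z. z ^ k \<partial>circ) = (\<integral>\<theta>. cis \<theta> ^ k \<partial>angle_measure)"
    by (intro integral_circ continuous_circle_measurable continuous_intros) auto
  also have "\<dots> = (1 / (2 * pi)) *\<^sub>R (\<integral>\<theta>. indicator {0..2 * pi} \<theta> *\<^sub>R cis \<theta> ^ k \<partial>lborel)"
    by (intro integral_angle_measure borel_measurable_continuous_onI continuous_intros)
  also have "(\<integral>\<theta>. indicator {0..2 * pi} \<theta> *\<^sub>R cis \<theta> ^ k \<partial>lborel) = ?F (2 * pi) - ?F 0"
  proof (rule integral_FTC_atLeastAtMost)
    fix x :: real
    have "((\<lambda>\<theta>. exp (\<i> * of_nat k * of_real \<theta>) / (\<i> * of_nat k)) has_vector_derivative cis x ^ k)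
        (at x within {0..2 * pi})"
      using assms by (auto intro!: derivative_eq_intros has_vector_derivative_real_field
        simp: cis_conv_exp exp_of_nat_mult[symmetric] mult_ac)
    then show "(?F has_vector_derivative cis x ^ k) (at x within {0..2 * pi})"
      by (simp add: cis_conv_exp mult_ac)
  qed (auto intro!: continuous_intros)
  also have "\<dots> = 0"
    using cis_multiple_2pi[of "real k"] by (simp add: mult.commute mult.left_commute)
  finally show ?thesis by simp
qed

lemma cnj_mult_self_circle: "cmod z = 1 \<Longrightarrow> cnj z * z = 1"
  using complex_norm_square[of z] by (simp add: mult.commute)

lemma cnj_power_mult_power:
  assumes "cmod z = 1"
  shows "cnj z ^ j * z ^ k = (if j \<le> k then z ^ (k - j) else cnj z ^ (j - k))"
proof -
  have 1: "cnj z ^ i * z ^ i = 1" for i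
    by (simp add: power_mult_distrib[symmetric] cnj_mult_self_circle[OF assms])
  show ?thesis
  proof (cases "j \<le> k")
    case True
    then have "cnj z ^ j * z ^ k = (cnj z ^ j * z ^ j) * z ^ (k - j)"
      by (metis le_add_diff_inverse mult.assoc power_add)
    then show ?thesis using True 1 by simp
  next
    case False
    then have "cnj z ^ j * z ^ k = (cnj z ^ k * z ^ k) * cnj z ^ (j - k)"
      by (metis le_add_diff_inverse mult.assoc mult.commute nat_le_linear power_add)
    then show ?thesis using False 1 by simp
  qed
qed

lemma integral_circ_monomial:
  "(\<integral>z. cnj z ^ j * z ^ k \<partial>circ) = (if j = k then 1 else 0)"
proof -
  have eq: "(\<integral>z. cnj z ^ j * z ^ k \<partial>circ)
      = (\<integral>z. (if j \<le> k then z ^ (k - j) else cnj z ^ (j - k)) \<partial>circ)"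
    by (rule Bochner_Integration.integral_cong) (auto simp: cnj_power_mult_power)
  consider "j = k" | "j < k" | "k < j" by linarith
  then show ?thesis
  proof cases
    case 1 then show ?thesis using eq circ.prob_space by simp
  next
    case 2 then show ?thesis using eq integral_circ_power[of "k - j"] by simp
  next
    case 3
    have "(\<integral>z. cnj z ^ (j - k) \<partial>circ) = cnj (\<integral>z. z ^ (j - k) \<partial>circ)"
      using Bochner_Integration.integral_cnj[of circ "\<lambda>z. z ^ (j - k)"] by simp
    then show ?thesis using 3 eq integral_circ_power[of "j - k"] by simp
  qed
qed

text \<open>Fourier coefficients of a function holomorphic beyond the closed disc.\<close>

lemma integral_circ_holomorphic:
  assumes f: "f holomorphic_on ball 0 R" and R: "1 < R"
  shows "(\<integral>z. cnj z ^ j * f z \<partial>circ) = (deriv ^^ j) f 0 / fact j"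
    and "(\<integral>z. z ^ j * f z \<partial>circ) = (if j = 0 then f 0 else 0)"
proof -
  define c where "c n = (deriv ^^ n) f 0 / fact n" for n
  have sums: "(\<lambda>n. c n * z ^ n) sums f z" if "cmod z < R" for z
    using holomorphic_power_series[OF f, of z] that by (simp add: c_def)
  obtain r where r: "1 < r" "r < R" using R dense by blast
  have "summable (\<lambda>n. c n * of_real r ^ n)"
    using sums[of "of_real r"] r by (auto simp: sums_iff)
  then have "summable (\<lambda>n. norm (c n * 1 ^ n))"
    by (rule powser_insidea) (use r in auto)
  then have summ: "summable (\<lambda>n. cmod (c n))" by simp
  have main: "(\<lambda>n. \<integral>z. g z * (c n * z ^ n) \<partial>circ) sums (\<integral>z. g z * f z \<partial>circ)"
    if g: "continuous_on (sphere 0 1) g" "\<And>z. cmod z = 1 \<Longrightarrow> cmod (g z) = 1" for g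
  proof -
    have norm: "cmod (g z * (c n * z ^ n)) = cmod (c n)" if "cmod z = 1" for z n
      using that g(2) by (simp add: norm_mult norm_power)
    have int: "(\<integral>z. cmod (g z * (c n * z ^ n)) \<partial>circ) = cmod (c n)" for n
    proof -
      have "(\<integral>z. cmod (g z * (c n * z ^ n)) \<partial>circ) = (\<integral>z. cmod (c n) \<partial>circ)"
        by (rule Bochner_Integration.integral_cong[OF refl], rule norm) simp
      then show ?thesis using circ.prob_space by simp
    qed
    have "(\<lambda>n. \<integral>z. g z * (c n * z ^ n) \<partial>circ) sums (\<integral>z. (\<Sum>n. g z * (c n * z ^ n)) \<partial>circ)"
    proof (rule sums_integral)
      show "integrable circ (\<lambda>z. g z * (c n * z ^ n))" for n
        by (rule integrable_continuous_circle) (auto intro!: continuous_intros g circ.finite_measure_axioms)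
      show "AE z in circ. summable (\<lambda>n. cmod (g z * (c n * z ^ n)))"
        by (rule AE_I2) (simp add: norm summ)
      show "summable (\<lambda>n. \<integral>z. cmod (g z * (c n * z ^ n)) \<partial>circ)"
        unfolding int by (rule summ)
    qed
    also have "(\<integral>z. (\<Sum>n. g z * (c n * z ^ n)) \<partial>circ) = (\<integral>z. g z * f z \<partial>circ)"
    proof (rule Bochner_Integration.integral_cong[OF refl])
      fix z assume "z \<in> space circ"
      then have "(\<lambda>n. g z * (c n * z ^ n)) sums (g z * f z)"
        using sums[of z] R by (intro sums_mult) auto
      then show "(\<Sum>n. g z * (c n * z ^ n)) = g z * f z" by (rule sums_unique[symmetric])
    qed
    finally show ?thesis .
  qed
  have "(\<integral>z. cnj z ^ j * (c n * z ^ n) \<partial>circ) = (if n = j then c j else 0)" for n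
  proof -
    have "(\<integral>z. cnj z ^ j * (c n * z ^ n) \<partial>circ) = (\<integral>z. c n * (cnj z ^ j * z ^ n) \<partial>circ)"
      by (simp only: mult.left_commute)
    then show ?thesis by (simp add: integral_circ_monomial)
  qed
  then have "(\<lambda>n. if n = j then c j else 0) sums (\<integral>z. cnj z ^ j * f z \<partial>circ)"
    using main[of "\<lambda>z. cnj z ^ j"] by (simp add: continuous_intros norm_power)
  then show "(\<integral>z. cnj z ^ j * f z \<partial>circ) = (deriv ^^ j) f 0 / fact j"
    using sums_single[of j "\<lambda>_. c j"] sums_unique2 unfolding c_def by blast
  have "(\<integral>z. z ^ j * (c n * z ^ n) \<partial>circ) = (if n = 0 then (if j = 0 then c 0 else 0) else 0)" for n
  proof -
    have "(\<integral>z. z ^ j * (c n * z ^ n) \<partial>circ) = (\<integral>z. c n * (cnj z ^ 0 * z ^ (j + n)) \<partial>circ)"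
      by (simp add: power_add mult.left_commute)
    also have "\<dots> = c n * (if 0 = j + n then 1 else 0)"
      by (simp only: integral_mult_right_zero integral_circ_monomial)
    finally show ?thesis by auto
  qed
  then have "(\<lambda>n. if n = 0 then (if j = 0 then c 0 else 0) else 0) sums (\<integral>z. z ^ j * f z \<partial>circ)"
    using main[of "\<lambda>z. z ^ j"] by (simp add: continuous_intros norm_power)
  then have "(\<integral>z. z ^ j * f z \<partial>circ) = (if j = 0 then c 0 else 0)"
    using sums_single[of 0 "\<lambda>_. if j = 0 then c 0 else 0"] sums_unique2 by blast
  then show "(\<integral>z. z ^ j * f z \<partial>circ) = (if j = 0 then f 0 else 0)"
    by (simp add: c_def)
qed

section \<open>The logarithm of a reversed polynomial\<close>

lemma has_fps_expansion_Ln: "(\<lambda>z. Ln (1 + z)) has_fps_expansion fps_ln 1"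
proof (rule has_fps_expansionI)
  have "(\<lambda>n. fps_nth (fps_ln 1 :: complex fps) n * u ^ n) sums Ln (1 + u)" if "cmod u < 1" for u
  proof -
    have "fps_nth (fps_ln 1 :: complex fps) n * u ^ n = - ((- u) ^ n) / of_nat n" for n
      by (cases n) (auto simp: fps_ln_nth power_minus')
    then show ?thesis using Ln_series'[OF that] by simp
  qed
  moreover have "eventually (\<lambda>u. u \<in> ball 0 1) (nhds (0 :: complex))"
    by (rule eventually_nhds_in_open) auto
  ultimately show "eventually (\<lambda>u. (\<lambda>n. fps_nth (fps_ln 1 :: complex fps) n * u ^ n) sums Ln (1 + u)) (nhds 0)"
    by (auto elim!: eventually_mono)
qed

lemma has_fps_expansion_poly: "poly p has_fps_expansion fps_of_poly (p :: complex poly)"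
proof (rule has_fps_expansionI, rule always_eventually, rule allI)
  fix u
  have "(\<lambda>n. coeff p n * u ^ n) sums (\<Sum>n\<le>degree p. coeff p n * u ^ n)"
    by (rule sums_finite) (auto simp: coeff_eq_0)
  then show "(\<lambda>n. fps_nth (fps_of_poly p) n * u ^ n) sums poly p u"
    by (simp add: poly_altdef)
qed

text \<open>A polynomial without zeros on the closed disc has a holomorphic logarithm on a larger disc.\<close>

lemma poly_holomorphic_log:
  assumes nz: "\<And>z. cmod z \<le> 1 \<Longrightarrow> poly p z \<noteq> (0 :: complex)" and p0: "poly p 0 = 1"
  obtains L R where "1 < R" "L holomorphic_on ball 0 R" "\<And>z. cmod z < R \<Longrightarrow> exp (L z) = poly p z"
    "L 0 = 0" "L has_fps_expansion fps_compose (fps_ln 1) (fps_of_poly p - 1)"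
proof -
  have "open {z. poly p z \<noteq> 0}"
    by (intro open_Collect_neq continuous_intros)
  moreover have "cball 0 1 \<subseteq> {z. poly p z \<noteq> 0}" using nz by auto
  ultimately obtain e where e: "e > 0" "(\<Union>z\<in>cball 0 1. ball z e) \<subseteq> {z. poly p z \<noteq> 0}"
    using compact_subset_open_imp_ball_epsilon_subset[of "cball 0 1" "{z. poly p z \<noteq> 0}"] by auto
  define R where "R = 1 + e"
  have R: "1 < R" using e by (simp add: R_def)
  have nzR: "poly p z \<noteq> 0" if z: "z \<in> ball 0 R" for z
  proof (cases "cmod z \<le> 1")
    case False
    have "dist (z / of_real (cmod z)) z = cmod z - 1"
    proof -
      have "z / of_real (cmod z) - z = of_real (1 - cmod z) * (z / of_real (cmod z))"
      proof -
        have "complex_of_real (cmod z) \<noteq> 0" using False by auto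
        then show ?thesis by (simp add: field_simps)
      qed
      then have "dist (z / of_real (cmod z)) z = \<bar>1 - cmod z\<bar> * cmod (z / of_real (cmod z))"
        by (simp only: dist_norm norm_mult norm_of_real)
      moreover have "z \<noteq> 0" using False by auto
      then have "cmod (z / of_real (cmod z)) = 1" by (simp add: norm_divide)
      ultimately show ?thesis using False by simp
    qed
    then have "z \<in> ball (z / of_real (cmod z)) e" using z by (simp add: R_def)
    moreover have "z \<noteq> 0" using False by auto
    then have "z / of_real (cmod z) \<in> cball 0 1" by (simp add: norm_divide)
    ultimately show ?thesis using e(2) by blast
  qed (use nz in auto)
  have holp: "poly p holomorphic_on ball 0 R"
    unfolding holomorphic_on_def field_differentiable_def
    by (blast intro: poly_DERIV has_field_derivative_at_within)
  have "0 \<in> ball (0 :: complex) R" using R by simp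
  from holomorphic_logarithm_exists[OF convex_ball open_ball holp nzR this]
  obtain g where g: "g holomorphic_on ball 0 R" "\<And>z. z \<in> ball 0 R \<Longrightarrow> exp (g z) = poly p z"
    by blast
  define L where "L z = g z - g 0" for z
  have hol: "L holomorphic_on ball 0 R" unfolding L_def by (intro holomorphic_intros g)
  have "exp (g 0) = 1" using g(2)[of 0] R p0 by simp
  then have expL: "exp (L z) = poly p z" if "cmod z < R" for z
    using g(2)[of z] that by (simp add: L_def exp_diff)
  have "eventually (\<lambda>z. L z = ((\<lambda>z. Ln (1 + z)) \<circ> (\<lambda>z. poly p z - 1)) z) (nhds 0)"
  proof -
    have "isCont L 0"
      using hol R by (metis centre_in_ball continuous_on_interior holomorphic_on_imp_continuous_on interior_ball less_trans zero_less_one)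
    then have "((\<lambda>z. L z) \<longlongrightarrow> L 0) (nhds 0)" 
      by (simp add: continuous_within tendsto_at_iff_tendsto_nhds)
    then have "eventually (\<lambda>z. L z \<in> ball 0 1) (nhds 0)"
      by (rule topological_tendstoD) (auto simp: L_def)
    moreover have "eventually (\<lambda>z. z \<in> ball 0 R) (nhds (0 :: complex))"
      using R by (intro eventually_nhds_in_open) auto
    ultimately show ?thesis
    proof eventually_elim
      case (elim z)
      have "\<bar>Im (L z)\<bar> < 1" using elim abs_Im_le_cmod[of "L z"] by simp
      then have "Ln (exp (L z)) = L z" using pi_gt3 by (intro Ln_exp) auto
      then show ?case using elim expL[of z] by simp
    qed
  qed
  moreover have "((\<lambda>z. Ln (1 + z)) \<circ> (\<lambda>z. poly p z - 1)) has_fps_expansion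
      fps_compose (fps_ln 1) (fps_of_poly p - 1)"
    using p0 by (intro has_fps_expansion_compose has_fps_expansion_Ln has_fps_expansion_diff
      has_fps_expansion_poly has_fps_expansion_1) (simp add: poly_0_coeff_0)
  ultimately have "L has_fps_expansion fps_compose (fps_ln 1) (fps_of_poly p - 1)"
    using has_fps_expansion_cong by blast
  moreover have "L 0 = 0" by (simp add: L_def)
  ultimately show thesis using that[OF R hol expL] by blast
qed

section \<open>Orthogonal polynomials\<close>

text \<open>The property that defines the polynomial \<open>\<Phi>\<^sub>n\<close> of \<open>\<mu>\<close>.\<close>

definition is_monic_OP :: "complex measure \<Rightarrow> nat \<Rightarrow> complex poly \<Rightarrow> bool" where
  "is_monic_OP \<mu> n p \<longleftrightarrow> degree p = n \<and> lead_coeff p = 1 \<and>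
     (\<forall>j<n. (\<integral>z. cnj (z ^ j) * poly p z \<partial>\<mu>) = 0)"

text \<open>The squared norm in \<open>L\<^sup>2(\<mu>)\<close>.\<close>

definition poly_norm2 :: "complex measure \<Rightarrow> complex poly \<Rightarrow> real" where
  "poly_norm2 \<mu> p = (\<integral>z. (cmod (poly p z))\<^sup>2 \<partial>\<mu>)"

locale nontrivial_circle_measure =
  fixes \<mu> :: "complex measure"
  assumes nontrivial: "nontrivial_circle_prob \<mu>"
begin

lemma mu_prob: "prob_space \<mu>" and mu_sets: "sets \<mu> = sets circle_borel"
  and mu_support: "infinite (circle_support \<mu>)"
  using nontrivial by (auto simp: nontrivial_circle_prob_def)

lemma mu_space: "space \<mu> = sphere 0 1"
  by (rule space_circle[OF mu_sets])

lemma mu_integrable: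
  fixes f :: "complex \<Rightarrow> 'b :: {banach, second_countable_topology}"
  shows "continuous_on (sphere 0 1) f \<Longrightarrow> integrable \<mu> f"
  by (rule integrable_continuous_circle[OF prob_space.finite_measure[OF mu_prob] mu_sets])

lemma mu_cong: "(\<And>z. cmod z = 1 \<Longrightarrow> f z = g z) \<Longrightarrow> integral\<^sup>L \<mu> f = integral\<^sup>L \<mu> g"
  by (rule Bochner_Integration.integral_cong) (auto simp: mu_space)

text \<open>A support with infinitely many points has one that is not a zero of \<open>p\<close>.\<close>

lemma poly_norm2_pos:
  assumes "p \<noteq> 0" shows "0 < poly_norm2 \<mu> p"
proof (rule ccontr)
  assume "\<not> 0 < poly_norm2 \<mu> p"
  moreover have "0 \<le> poly_norm2 \<mu> p" by (simp add: poly_norm2_def)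
  ultimately have "poly_norm2 \<mu> p = 0" by linarith
  then have "(\<integral>z. (cmod (poly p z))\<^sup>2 \<partial>\<mu>) = 0" by (simp add: poly_norm2_def)
  moreover have int: "integrable \<mu> (\<lambda>z. (cmod (poly p z))\<^sup>2)"
    by (intro mu_integrable continuous_intros)
  ultimately have ae: "AE z in \<mu>. (cmod (poly p z))\<^sup>2 = 0"
    by (subst (asm) integral_nonneg_eq_0_iff_AE) auto
  let ?Z = "{z. poly p z = 0}"
  have fin: "finite ?Z" using assms by (rule poly_roots_finite)
  then obtain z where z: "z \<in> circle_support \<mu>" "z \<notin> ?Z"
    using mu_support by (metis finite_subset subsetI)
  have op: "open (- ?Z)" using fin by (simp add: finite_imp_closed open_Compl)
  with z have pos: "emeasure \<mu> (- ?Z \<inter> sphere 0 1) > 0" by (auto simp: circle_support_def)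
  have "- ?Z \<inter> sphere 0 1 \<in> sets \<mu>"
    unfolding mu_sets sets_restrict_space using op by (intro image_eqI[of _ _ "- ?Z"]) auto
  moreover have "- ?Z \<inter> sphere 0 1 = {z \<in> space \<mu>. \<not> (cmod (poly p z))\<^sup>2 = 0}"
    by (auto simp: mu_space)
  ultimately have "emeasure \<mu> (- ?Z \<inter> sphere 0 1) = 0"
    using ae AE_iff_measurable by metis
  then show False using pos by simp
qed

lemma poly_norm2_complex: "complex_of_real (poly_norm2 \<mu> p) = (\<integral>z. cnj (poly p z) * poly p z \<partial>\<mu>)"
  unfolding poly_norm2_def integral_complex_of_real[symmetric]
  by (rule mu_cong) (subst complex_norm_square, rule mult.commute)

lemma OP_orthogonal:
  assumes "is_monic_OP \<mu> n p" "degree s \<le> n"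
  shows "(\<integral>z. cnj (poly s z) * poly p z \<partial>\<mu>) = cnj (coeff s n) * (\<integral>z. cnj (z ^ n) * poly p z \<partial>\<mu>)"
proof -
  have "(\<integral>z. cnj (poly s z) * poly p z \<partial>\<mu>)
      = (\<integral>z. (\<Sum>j\<le>n. cnj (coeff s j) * (cnj (z ^ j) * poly p z)) \<partial>\<mu>)"
  proof (rule mu_cong)
    fix z :: complex
    have "poly s z = (\<Sum>j\<le>n. coeff s j * z ^ j)"
      unfolding poly_altdef using assms(2) by (intro sum.mono_neutral_left) (auto simp: coeff_eq_0)
    then show "cnj (poly s z) * poly p z = (\<Sum>j\<le>n. cnj (coeff s j) * (cnj (z ^ j) * poly p z))"
      by (simp add: sum_distrib_right mult.assoc)
  qed
  also have "\<dots> = (\<Sum>j\<le>n. cnj (coeff s j) * (\<integral>z. cnj (z ^ j) * poly p z \<partial>\<mu>))"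
    by (subst Bochner_Integration.integral_sum) (auto intro!: mu_integrable continuous_intros)
  also have "\<dots> = (\<Sum>j\<in>{n}. cnj (coeff s j) * (\<integral>z. cnj (z ^ j) * poly p z \<partial>\<mu>))"
    using assms(1) by (intro sum.mono_neutral_right) (auto simp: is_monic_OP_def)
  finally show ?thesis by simp
qed

lemma OP_norm2:
  assumes "is_monic_OP \<mu> n p"
  shows "(\<integral>z. cnj (z ^ n) * poly p z \<partial>\<mu>) = complex_of_real (poly_norm2 \<mu> p)"
  using OP_orthogonal[OF assms, of p] assms unfolding poly_norm2_complex
  by (auto simp: is_monic_OP_def)

lemma OP_unique:
  assumes "is_monic_OP \<mu> n p" "is_monic_OP \<mu> n q" shows "p = q"
proof (rule ccontr)
  assume "p \<noteq> q"
  let ?r = "p - q"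
  have deg: "degree ?r \<le> n" "coeff ?r n = 0"
    using assms by (auto simp: is_monic_OP_def intro: degree_diff_le)
  have "complex_of_real (poly_norm2 \<mu> ?r)
      = (\<integral>z. cnj (poly ?r z) * poly p z - cnj (poly ?r z) * poly q z \<partial>\<mu>)"
    unfolding poly_norm2_complex by (simp add: algebra_simps)
  also have "\<dots> = (\<integral>z. cnj (poly ?r z) * poly p z \<partial>\<mu>) - (\<integral>z. cnj (poly ?r z) * poly q z \<partial>\<mu>)"
    by (intro Bochner_Integration.integral_diff mu_integrable continuous_intros)
  also have "\<dots> = 0"
    using OP_orthogonal[OF assms(1) deg(1)] OP_orthogonal[OF assms(2) deg(1)] deg(2) by simp
  finally show False using poly_norm2_pos[of ?r] \<open>p \<noteq> q\<close> by simp
qed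

lemma monic_OP_eq:
  assumes "is_monic_OP \<mu> n p" shows "monic_OP \<mu> n = p"
  unfolding monic_OP_def is_monic_OP_def[symmetric]
  using assms OP_unique by (intro the_equality) auto

lemma OP_reversed_orthogonal:
  assumes p: "is_monic_OP \<mu> n p" and r: "\<And>z. cmod z = 1 \<Longrightarrow> poly r z = z ^ n * cnj (poly p z)"
    and j: "j \<le> n"
  shows "(\<integral>z. cnj (z ^ j) * poly r z \<partial>\<mu>) = (if j = 0 then complex_of_real (poly_norm2 \<mu> p) else 0)"
proof -
  have "(\<integral>z. cnj (z ^ j) * poly r z \<partial>\<mu>) = (\<integral>z. cnj (cnj (z ^ (n - j)) * poly p z) \<partial>\<mu>)"
  proof (rule mu_cong)
    fix z :: complex assume z: "cmod z = 1"
    have "cnj (z ^ j) * poly r z = (cnj z ^ j * z ^ n) * cnj (poly p z)"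
      using r[OF z] by simp
    then show "cnj (z ^ j) * poly r z = cnj (cnj (z ^ (n - j)) * poly p z)"
      using cnj_power_mult_power[OF z, of j n] j by simp
  qed
  also have "\<dots> = cnj (\<integral>z. cnj (z ^ (n - j)) * poly p z \<partial>\<mu>)"
    by (rule Bochner_Integration.integral_cnj)
  also have "\<dots> = (if j = 0 then complex_of_real (poly_norm2 \<mu> p) else 0)"
    using p j OP_norm2[OF p] by (auto simp: is_monic_OP_def)
  finally show ?thesis .
qed

text \<open>Existence of the next orthogonal polynomial and the Szego recursion at once: with \<open>r = p\<^sup>*\<close> the
  polynomial \<open>z p - c r\<close> is orthogonal to \<open>z, \<dots>, z\<^sup>n\<close> for every \<open>c\<close>, and \<open>c\<close> is chosen to
  make it orthogonal to \<open>1\<close>.\<close>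

lemma OP_Suc:
  fixes p r :: "complex poly"
  assumes p: "is_monic_OP \<mu> n p" and r: "\<And>z. cmod z = 1 \<Longrightarrow> poly r z = z ^ n * cnj (poly p z)"
    and deg: "degree r \<le> n"
  defines "c \<equiv> (\<integral>z. z * poly p z \<partial>\<mu>) / complex_of_real (poly_norm2 \<mu> p)"
  defines "q \<equiv> pCons 0 p - smult c r"
  shows "is_monic_OP \<mu> (Suc n) q"
    and "poly_norm2 \<mu> q = (1 - (cmod c)\<^sup>2) * poly_norm2 \<mu> p"
proof -
  have "p \<noteq> 0" using p by (auto simp: is_monic_OP_def)
  then have pos: "0 < poly_norm2 \<mu> p" by (rule poly_norm2_pos)
  have lead: "coeff q (Suc n) = 1"
    using p deg by (auto simp: q_def is_monic_OP_def coeff_eq_0)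
  have "degree q \<le> Suc n" unfolding q_def
    using p deg by (intro degree_diff_le order.trans[OF degree_pCons_le] order.trans[OF degree_smult_le])
      (auto simp: is_monic_OP_def)
  with lead have degq: "degree q = Suc n" by (intro antisym le_degree) auto
  have orth: "(\<integral>z. cnj (z ^ j) * poly q z \<partial>\<mu>) = 0" if j: "j \<le> n" for j
  proof -
    have "(\<integral>z. cnj (z ^ j) * poly q z \<partial>\<mu>)
        = (\<integral>z. cnj (z ^ j) * (z * poly p z) - c * (cnj (z ^ j) * poly r z) \<partial>\<mu>)"
      by (rule mu_cong) (simp add: q_def algebra_simps)
    also have "\<dots> = (\<integral>z. cnj (z ^ j) * (z * poly p z) \<partial>\<mu>) - c * (\<integral>z. cnj (z ^ j) * poly r z \<partial>\<mu>)"
      by (subst Bochner_Integration.integral_diff) (auto intro!: mu_integrable continuous_intros)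
    also have "\<dots> = 0"
    proof (cases j)
      case 0
      then show ?thesis using OP_reversed_orthogonal[OF p r j] pos by (simp add: c_def)
    next
      case (Suc i)
      have "(\<integral>z. cnj (z ^ j) * (z * poly p z) \<partial>\<mu>) = (\<integral>z. cnj (z ^ i) * poly p z \<partial>\<mu>)"
      proof (rule mu_cong)
        fix z :: complex assume z: "cmod z = 1"
        have "cnj (z ^ j) * (z * poly p z) = (cnj z * z) * (cnj (z ^ i) * poly p z)"
          by (simp add: Suc mult_ac)
        then show "cnj (z ^ j) * (z * poly p z) = cnj (z ^ i) * poly p z"
          by (simp add: cnj_mult_self_circle[OF z])
      qed
      also have "\<dots> = 0" using p j Suc by (auto simp: is_monic_OP_def)
      finally show ?thesis using OP_reversed_orthogonal[OF p r j] Suc by simp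
    qed
    finally show ?thesis .
  qed
  show OPq: "is_monic_OP \<mu> (Suc n) q"
    unfolding is_monic_OP_def using degq lead orth by auto
  have rq: "(\<integral>z. cnj (poly r z) * poly q z \<partial>\<mu>) = 0"
    using OP_orthogonal[OF OPq, of r] deg by (simp add: coeff_eq_0)
  have qr: "(\<integral>z. cnj (poly q z) * poly r z \<partial>\<mu>) = 0"
  proof -
    have "(\<integral>z. cnj (poly q z) * poly r z \<partial>\<mu>) = (\<integral>z. cnj (cnj (poly r z) * poly q z) \<partial>\<mu>)"
      by (simp add: mult.commute)
    also have "\<dots> = cnj (\<integral>z. cnj (poly r z) * poly q z \<partial>\<mu>)" by (rule Bochner_Integration.integral_cnj)
    finally show ?thesis using rq by simp
  qed
  have norm_r: "poly_norm2 \<mu> r = poly_norm2 \<mu> p" unfolding poly_norm2_def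
    by (rule mu_cong) (simp add: r norm_mult norm_power)
  have "complex_of_real (poly_norm2 \<mu> p) = (\<integral>z. cnj (z * poly p z) * (z * poly p z) \<partial>\<mu>)"
    unfolding poly_norm2_complex
  proof (rule mu_cong)
    fix z :: complex assume z: "cmod z = 1"
    have "cnj (z * poly p z) * (z * poly p z) = (cnj z * z) * (cnj (poly p z) * poly p z)"
      by (simp add: mult_ac)
    then show "cnj (poly p z) * poly p z = cnj (z * poly p z) * (z * poly p z)"
      by (simp add: cnj_mult_self_circle[OF z])
  qed
  also have "\<dots> = (\<integral>z. cnj (poly q z) * poly q z + c * (cnj (poly q z) * poly r z)
      + cnj c * (cnj (poly r z) * poly q z) + (c * cnj c) * (cnj (poly r z) * poly r z) \<partial>\<mu>)"
  proof (rule mu_cong)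
    fix z :: complex
    have "z * poly p z = poly q z + c * poly r z" by (simp add: q_def)
    then show "cnj (z * poly p z) * (z * poly p z) = cnj (poly q z) * poly q z + c * (cnj (poly q z) * poly r z)
      + cnj c * (cnj (poly r z) * poly q z) + (c * cnj c) * (cnj (poly r z) * poly r z)"
      by (simp add: algebra_simps)
  qed
  also have "\<dots> = (\<integral>z. cnj (poly q z) * poly q z \<partial>\<mu>) + c * (\<integral>z. cnj (poly q z) * poly r z \<partial>\<mu>)
      + cnj c * (\<integral>z. cnj (poly r z) * poly q z \<partial>\<mu>) + (c * cnj c) * (\<integral>z. cnj (poly r z) * poly r z \<partial>\<mu>)"
    by (subst Bochner_Integration.integral_add, (auto intro!: mu_integrable continuous_intros)[2])+
      simp
  also have "\<dots> = complex_of_real (poly_norm2 \<mu> q + (cmod c)\<^sup>2 * poly_norm2 \<mu> p)"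
    unfolding rq qr poly_norm2_complex[symmetric] norm_r of_real_add of_real_mult complex_norm_square by simp
  finally have "poly_norm2 \<mu> p = poly_norm2 \<mu> q + (cmod c)\<^sup>2 * poly_norm2 \<mu> p"
    by (simp only: of_real_eq_iff)
  then show "poly_norm2 \<mu> q = (1 - (cmod c)\<^sup>2) * poly_norm2 \<mu> p" by (simp add: algebra_simps)
qed

abbreviation (input) "\<Phi> \<equiv> szego_poly (verblunsky_nat \<mu>)"
abbreviation (input) "\<Phi>s \<equiv> szego_rev (verblunsky_nat \<mu>)"

lemma szego_OP_step:
  assumes IH: "is_monic_OP \<mu> n (\<Phi> n)"
  shows "cnj (verblunsky_nat \<mu> n) = (\<integral>z. z * poly (\<Phi> n) z \<partial>\<mu>) / complex_of_real (poly_norm2 \<mu> (\<Phi> n))"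
proof -
  let ?c = "(\<integral>z. z * poly (\<Phi> n) z \<partial>\<mu>) / complex_of_real (poly_norm2 \<mu> (\<Phi> n))"
  have "is_monic_OP \<mu> (Suc n) (pCons 0 (\<Phi> n) - smult ?c (\<Phi>s n))"
    by (rule OP_Suc[OF IH]) (use szego_rev_circle degree_szego in auto)
  then have eq: "monic_OP \<mu> (Suc n) = pCons 0 (\<Phi> n) - smult ?c (\<Phi>s n)" by (rule monic_OP_eq)
  have rev: "reversed_OP \<mu> n z = poly (\<Phi>s n) z" if "z \<noteq> 0" for z
    using szego_rev_eq_reversed(1)[OF that] by (simp add: reversed_OP_def monic_OP_eq[OF IH])
  have "\<Phi>s n \<noteq> 0" using szego_rev_0[of "verblunsky_nat \<mu>" n] by auto
  then have "finite (insert 0 {z. poly (\<Phi>s n) z = 0})" by (simp add: poly_roots_finite)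
  then obtain z0 where "z0 \<notin> insert 0 {z. poly (\<Phi>s n) z = 0}"
    using ex_new_if_finite[OF infinite_UNIV_char_0] by blast
  then have z0: "z0 \<noteq> 0" "poly (\<Phi>s n) z0 \<noteq> 0" by auto
  have "(THE b. \<forall>z. z \<noteq> 0 \<longrightarrow> poly (monic_OP \<mu> (Suc n)) z =
      z * poly (monic_OP \<mu> n) z - cnj b * reversed_OP \<mu> n z) = cnj ?c"
  proof (rule the_equality)
    show "\<forall>z. z \<noteq> 0 \<longrightarrow> poly (monic_OP \<mu> (Suc n)) z =
        z * poly (monic_OP \<mu> n) z - cnj (cnj ?c) * reversed_OP \<mu> n z"
      using rev unfolding eq monic_OP_eq[OF IH] by simp
  next
    fix b assume b: "\<forall>z. z \<noteq> 0 \<longrightarrow> poly (monic_OP \<mu> (Suc n)) z =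
        z * poly (monic_OP \<mu> n) z - cnj b * reversed_OP \<mu> n z"
    have "poly (monic_OP \<mu> (Suc n)) z0 = z0 * poly (\<Phi> n) z0 - cnj b * poly (\<Phi>s n) z0"
      using b z0(1) unfolding rev[OF z0(1), symmetric] monic_OP_eq[OF IH] by blast
    then have "?c * poly (\<Phi>s n) z0 = cnj b * poly (\<Phi>s n) z0"
      unfolding eq by (simp add: mult.commute)
    then have "?c = cnj b" by (rule mult_right_cancel[OF z0(2), THEN iffD1])
    then show "b = cnj ?c" by (simp only: complex_cnj_cnj)
  qed
  then have "verblunsky_nat \<mu> n = cnj ?c" by (subst verblunsky_nat_def)
  then show ?thesis by (simp only: complex_cnj_cnj)
qed

theorem is_monic_OP_szego: "is_monic_OP \<mu> n (\<Phi> n)"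
proof (induction n)
  case 0 then show ?case by (simp add: is_monic_OP_def)
next
  case (Suc n)
  have "is_monic_OP \<mu> (Suc n) (pCons 0 (\<Phi> n) - smult (cnj (verblunsky_nat \<mu> n)) (\<Phi>s n))"
    unfolding szego_OP_step[OF Suc]
    by (rule OP_Suc[OF Suc]) (use szego_rev_circle degree_szego in auto)
  then show ?case by simp
qed

lemma poly_norm2_szego_Suc:
  "poly_norm2 \<mu> (\<Phi> (Suc n)) = (1 - (cmod (verblunsky_nat \<mu> n))\<^sup>2) * poly_norm2 \<mu> (\<Phi> n)"
proof -
  let ?c = "cnj (verblunsky_nat \<mu> n)"
  have "poly_norm2 \<mu> (pCons 0 (\<Phi> n) - smult ?c (\<Phi>s n)) = (1 - (cmod ?c)\<^sup>2) * poly_norm2 \<mu> (\<Phi> n)"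
    unfolding szego_OP_step[OF is_monic_OP_szego]
    by (rule OP_Suc[OF is_monic_OP_szego]) (use szego_rev_circle degree_szego in auto)
  then show ?thesis by simp
qed

lemma cmod_verblunsky_less_1: "cmod (verblunsky_nat \<mu> n) < 1"
proof -
  have "0 < poly_norm2 \<mu> (\<Phi> (Suc n))" "0 < poly_norm2 \<mu> (\<Phi> n)"
    by (intro poly_norm2_pos szego_poly_nonzero)+
  then have "0 < 1 - (cmod (verblunsky_nat \<mu> n))\<^sup>2"
    unfolding poly_norm2_szego_Suc by (simp add: zero_less_mult_iff)
  then show ?thesis by (simp add: power_less_one_iff abs_square_less_1)
qed

lemma poly_norm2_szego: "poly_norm2 \<mu> (\<Phi> n) = (\<Prod>k<n. 1 - (cmod (verblunsky_nat \<mu> k))\<^sup>2)"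
proof (induction n)
  case 0 then show ?case using prob_space.prob_space[OF mu_prob] by (simp add: poly_norm2_def)
next
  case (Suc n) then show ?case by (simp only: poly_norm2_szego_Suc) simp
qed

section \<open>Bernstein--Szego approximation\<close>

text \<open>The density of the Bernstein--Szego approximation, the measure whose Verblunsky coefficients
  are those of \<open>\<mu>\<close> up to index \<open>n - 1\<close> and \<open>0\<close> afterwards.\<close>

definition bs_density :: "nat \<Rightarrow> complex \<Rightarrow> real" where
  "bs_density n z = poly_norm2 \<mu> (\<Phi> n) / (cmod (poly (\<Phi> n) z))\<^sup>2"

lemma szego_poly_circle_nonzero: "cmod z = 1 \<Longrightarrow> poly (\<Phi> n) z \<noteq> 0"
  using szego_rev_nonzero(1)[of "verblunsky_nat \<mu>" z n] cmod_verblunsky_less_1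
    cmod_szego_rev_circle[of z "verblunsky_nat \<mu>" n] by auto

lemma bs_density_pos: "cmod z = 1 \<Longrightarrow> 0 < bs_density n z"
  using szego_poly_circle_nonzero poly_norm2_pos[OF szego_poly_nonzero]
  by (auto simp: bs_density_def)

lemma continuous_bs_density [continuous_intros]: "continuous_on (sphere 0 1) (bs_density n)"
  unfolding bs_density_def using szego_poly_circle_nonzero by (intro continuous_intros) auto

text \<open>The difference of the integrals against \<open>\<mu>\<close> and its Bernstein--Szego approximation.\<close>

definition bs_diff :: "nat \<Rightarrow> (complex \<Rightarrow> complex) \<Rightarrow> complex" where
  "bs_diff n f = (\<integral>z. f z \<partial>\<mu>) - (\<integral>z. f z * complex_of_real (bs_density n z) \<partial>circ)"

lemma bs_diff_cong: "(\<And>z. cmod z = 1 \<Longrightarrow> f z = g z) \<Longrightarrow> bs_diff n f = bs_diff n g"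
  unfolding bs_diff_def by (intro arg_cong2[of _ _ _ _ "(-)"] mu_cong circ_cong) auto

lemma bs_diff_add:
  assumes "continuous_on (sphere 0 1) f" "continuous_on (sphere 0 1) g"
  shows "bs_diff n (\<lambda>z. f z + g z) = bs_diff n f + bs_diff n g"
proof -
  have "(\<integral>z. f z + g z \<partial>\<mu>) = (\<integral>z. f z \<partial>\<mu>) + (\<integral>z. g z \<partial>\<mu>)"
    by (intro Bochner_Integration.integral_add mu_integrable assms)
  moreover have "(\<integral>z. f z * complex_of_real (bs_density n z) + g z * complex_of_real (bs_density n z) \<partial>circ)
    = (\<integral>z. f z * complex_of_real (bs_density n z) \<partial>circ) + (\<integral>z. g z * complex_of_real (bs_density n z) \<partial>circ)"
    by (intro Bochner_Integration.integral_add circ_integrable continuous_intros assms)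
  ultimately show ?thesis unfolding bs_diff_def by (simp add: distrib_right)
qed

lemma bs_diff_cmult: "bs_diff n (\<lambda>z. c * f z) = c * bs_diff n f"
  unfolding bs_diff_def by (simp add: mult.assoc right_diff_distrib)

lemma bs_diff_cnj: "bs_diff n (\<lambda>z. cnj (f z)) = cnj (bs_diff n f)"
proof -
  have "(\<integral>z. cnj (f z) * complex_of_real (bs_density n z) \<partial>circ)
      = (\<integral>z. cnj (f z * complex_of_real (bs_density n z)) \<partial>circ)" by simp
  then show ?thesis unfolding bs_diff_def by (simp only: Bochner_Integration.integral_cnj complex_cnj_diff)
qed

lemma bs_diff_sum:
  assumes "finite A" "\<And>i. i \<in> A \<Longrightarrow> continuous_on (sphere 0 1) (f i)"
  shows "bs_diff n (\<lambda>z. \<Sum>i\<in>A. f i z) = (\<Sum>i\<in>A. bs_diff n (f i))"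
  using assms
proof (induction A rule: finite_induct)
  case empty then show ?case by (simp add: bs_diff_def)
next
  case (insert x A)
  then have "bs_diff n (\<lambda>z. f x z + (\<Sum>i\<in>A. f i z)) = bs_diff n (f x) + bs_diff n (\<lambda>z. \<Sum>i\<in>A. f i z)"
    by (intro bs_diff_add continuous_on_sum) auto
  then show ?case using insert by simp
qed

text \<open>On the circle \<open>\<Phi>\<^sub>n / |\<Phi>\<^sub>n|\<^sup>2 = z\<^sup>n / \<Phi>\<^sub>n\<^sup>*\<close>, where \<open>1 / \<Phi>\<^sub>n\<^sup>*\<close> is holomorphic beyond the closed
  disc.\<close>

lemma bs_diff_top:
  assumes "j \<le> n" shows "bs_diff n (\<lambda>z. cnj z ^ j * poly (\<Phi> n) z) = 0"
proof -
  have nz: "poly (\<Phi>s n) z \<noteq> 0" if "cmod z \<le> 1" for z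
    using szego_rev_nonzero(1) cmod_verblunsky_less_1 that by blast
  obtain L R where L: "1 < R" "L holomorphic_on ball 0 R"
    "\<And>z. cmod z < R \<Longrightarrow> exp (L z) = poly (\<Phi>s n) z" "L 0 = 0"
    using poly_holomorphic_log[OF nz szego_rev_0] by metis
  have hol: "(\<lambda>z. exp (- L z)) holomorphic_on ball 0 R" by (intro holomorphic_intros L)
  let ?K = "complex_of_real (poly_norm2 \<mu> (\<Phi> n))"
  have "(\<integral>z. cnj z ^ j * poly (\<Phi> n) z * complex_of_real (bs_density n z) \<partial>circ)
      = (\<integral>z. ?K * (z ^ (n - j) * exp (- L z)) \<partial>circ)"
  proof (rule circ_cong)
    fix z :: complex assume z: "cmod z = 1"
    let ?p = "poly (\<Phi> n) z"
    have p: "?p \<noteq> 0" by (rule szego_poly_circle_nonzero[OF z])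
    have e1: "exp (- L z) = 1 / (z ^ n * cnj ?p)"
      using L(1) L(3)[of z] z szego_rev_circle[OF z] by (simp add: exp_minus divide_inverse)
    have e2: "complex_of_real (bs_density n z) = ?K / (?p * cnj ?p)"
      unfolding bs_density_def of_real_divide complex_norm_square ..
    have e3: "z ^ (n - j) = cnj z ^ j * z ^ n"
      using cnj_power_mult_power[OF z, of j n] assms by simp
    have "z \<noteq> 0" using z by auto
    then show "cnj z ^ j * ?p * complex_of_real (bs_density n z) = ?K * (z ^ (n - j) * exp (- L z))"
      unfolding e1 e2 e3 using p by (simp add: field_simps)
  qed
  also have "\<dots> = ?K * (if n - j = 0 then 1 else 0)"
    using integral_circ_holomorphic(2)[OF hol L(1), of "n - j"] L(4) by simp
  also have "\<dots> = (\<integral>z. cnj z ^ j * poly (\<Phi> n) z \<partial>\<mu>)"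
    using is_monic_OP_szego[of n] OP_norm2[OF is_monic_OP_szego, of n] assms
    by (auto simp: is_monic_OP_def le_less)
  finally show ?thesis by (simp add: bs_diff_def)
qed

text \<open>Descending the recursion, in the form \<open>(1 - |\<alpha>\<^sub>m|\<^sup>2) z \<Phi>\<^sub>m = \<Phi>\<^sub>m\<^sub>+\<^sub>1 + cnj \<alpha>\<^sub>m \<Phi>\<^sub>m\<^sub>+\<^sub>1\<^sup>*\<close>, the
  approximating measure has the same orthogonal polynomials of degree at most \<open>n\<close> as \<open>\<mu>\<close>.\<close>

lemma bs_diff_OP:
  assumes "m \<le> n" "j \<le> m" shows "bs_diff n (\<lambda>z. cnj z ^ j * poly (\<Phi> m) z) = 0"
  using assms
proof (induction m arbitrary: j rule: inc_induct)
  case base then show ?case by (rule bs_diff_top)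
next
  case (step m)
  let ?a = "verblunsky_nat \<mu> m"
  let ?f = "\<lambda>z. cnj z ^ Suc j * poly (\<Phi> (Suc m)) z" and ?g = "\<lambda>z. cnj z ^ Suc j * poly (\<Phi>s (Suc m)) z"
  let ?d = "1 - (cmod ?a)\<^sup>2"
  have f: "bs_diff n ?f = 0" using step by (intro step.IH) auto
  have "bs_diff n ?g = bs_diff n (\<lambda>z. cnj (cnj z ^ (m - j) * poly (\<Phi> (Suc m)) z))"
  proof (rule bs_diff_cong)
    fix z :: complex assume z: "cmod z = 1"
    have "?g z = (cnj z ^ Suc j * z ^ Suc m) * cnj (poly (\<Phi> (Suc m)) z)"
      by (simp only: szego_rev_circle[OF z] mult.assoc)
    also have "cnj z ^ Suc j * z ^ Suc m = z ^ (m - j)"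
      using cnj_power_mult_power[OF z, of "Suc j" "Suc m"] step.prems by simp
    finally show "?g z = cnj (cnj z ^ (m - j) * poly (\<Phi> (Suc m)) z)" by simp
  qed
  also have "\<dots> = cnj (bs_diff n (\<lambda>z. cnj z ^ (m - j) * poly (\<Phi> (Suc m)) z))" by (rule bs_diff_cnj)
  also have "\<dots> = 0" using step.IH[of "m - j"] by simp
  finally have g: "bs_diff n ?g = 0" .
  have "complex_of_real ?d * bs_diff n (\<lambda>z. cnj z ^ j * poly (\<Phi> m) z)
      = bs_diff n (\<lambda>z. complex_of_real ?d * (cnj z ^ j * poly (\<Phi> m) z))" by (rule bs_diff_cmult[symmetric])
  also have "\<dots> = bs_diff n (\<lambda>z. ?f z + cnj ?a * ?g z)"
  proof (rule bs_diff_cong)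
    fix z :: complex assume z: "cmod z = 1"
    have "?f z + cnj ?a * ?g z = (cnj z * z) * (cnj z ^ j * poly (\<Phi> m) z) * (1 - ?a * cnj ?a)"
      by (simp add: algebra_simps)
    then show "complex_of_real ?d * (cnj z ^ j * poly (\<Phi> m) z) = ?f z + cnj ?a * ?g z"
      by (simp only: cnj_mult_self_circle[OF z] of_real_diff complex_norm_square) (simp add: mult.commute)
  qed
  also have "\<dots> = bs_diff n ?f + cnj ?a * bs_diff n ?g"
    by (subst bs_diff_add) (auto intro!: continuous_intros simp: bs_diff_cmult)
  also have "\<dots> = 0" using f g by simp
  finally have "complex_of_real ?d * bs_diff n (\<lambda>z. cnj z ^ j * poly (\<Phi> m) z) = 0" .
  moreover have "?d \<noteq> 0" using cmod_verblunsky_less_1[of m] by (simp add: abs_square_eq_1)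
  ultimately show ?case by (metis mult_eq_0_iff of_real_eq_0_iff)
qed

text \<open>Hence \<open>\<mu>\<close> and the approximating measure have the same moments up to order \<open>n\<close>.\<close>

lemma bs_diff_power:
  assumes "k \<le> n" shows "bs_diff n (\<lambda>z. z ^ k) = 0"
  using assms
proof (induction k rule: less_induct)
  case (less k)
  have "poly (\<Phi> k) z = (\<Sum>i<k. coeff (\<Phi> k) i * z ^ i) + z ^ k" for z
    using degree_szego[of "verblunsky_nat \<mu>" k] by (simp add: poly_altdef lessThan_Suc_atMost[symmetric])
  moreover have "bs_diff n (\<lambda>z. poly (\<Phi> k) z) = 0" using bs_diff_OP[of k n 0] less.prems by simp
  ultimately have "0 = bs_diff n (\<lambda>z. (\<Sum>i<k. coeff (\<Phi> k) i * z ^ i) + z ^ k)" by simp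
  also have "\<dots> = (\<Sum>i<k. coeff (\<Phi> k) i * bs_diff n (\<lambda>z. z ^ i)) + bs_diff n (\<lambda>z. z ^ k)"
    by (subst bs_diff_add) (auto intro!: continuous_intros simp: bs_diff_sum bs_diff_cmult continuous_intros)
  also have "(\<Sum>i<k. coeff (\<Phi> k) i * bs_diff n (\<lambda>z. z ^ i)) = 0"
    using less by (intro sum.neutral) auto
  finally show ?case by simp
qed

lemma bs_diff_trig_poly:
  assumes "s + degree p \<le> n" shows "bs_diff n (\<lambda>z. cnj z ^ s * poly p z) = 0"
proof -
  have mono: "bs_diff n (\<lambda>z. cnj z ^ s * z ^ i) = 0" if "i \<le> degree p" for i
  proof (cases "s \<le> i")
    case True
    then have "bs_diff n (\<lambda>z. cnj z ^ s * z ^ i) = bs_diff n (\<lambda>z. z ^ (i - s))"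
      by (intro bs_diff_cong) (simp add: cnj_power_mult_power)
    then show ?thesis using assms that bs_diff_power[of "i - s" n] by simp
  next
    case False
    then have "bs_diff n (\<lambda>z. cnj z ^ s * z ^ i) = bs_diff n (\<lambda>z. cnj (z ^ (s - i)))"
      by (intro bs_diff_cong) (simp add: cnj_power_mult_power)
    then show ?thesis using assms that bs_diff_power[of "s - i" n] by (simp only: bs_diff_cnj) simp
  qed
  have "bs_diff n (\<lambda>z. cnj z ^ s * poly p z)
      = bs_diff n (\<lambda>z. \<Sum>i\<le>degree p. coeff p i * (cnj z ^ s * z ^ i))"
    by (intro bs_diff_cong) (simp add: poly_altdef sum_distrib_left mult_ac)
  also have "\<dots> = (\<Sum>i\<le>degree p. coeff p i * bs_diff n (\<lambda>z. cnj z ^ s * z ^ i))"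
    by (subst bs_diff_sum) (auto intro!: continuous_intros simp: bs_diff_cmult)
  finally show ?thesis using mono by simp
qed

end

section \<open>Continuous approximation of measurable functions\<close>

text \<open>Inner and outer regularity, for measures that live on the subspace formed by the circle.\<close>

lemma circle_regular:
  assumes fin: "finite_measure M" and sets: "sets M = sets circle_borel"
    and A: "A \<in> sets circle_borel" and e: "0 < (e :: real)"
  obtains K U where "compact K" "open U" "K \<subseteq> A" "A \<subseteq> U"
    "measure M ((U - K) \<inter> sphere 0 1) < e"
proof -
  interpret finite_measure M by fact
  have space: "space M = sphere 0 1" by (rule space_circle[OF sets])
  define M' where "M' = distr M borel (\<lambda>z. z)"
  have id[measurable]: "(\<lambda>z. z) \<in> M \<rightarrow>\<^sub>M borel"
    by (simp add: measurable_cong_sets[OF sets refl] measurable_restrict_space1)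
  have sets': "sets M' = sets borel" by (simp add: M'_def)
  interpret M': finite_measure M' unfolding M'_def by (rule finite_measure_distr) simp
  have meas: "measure M' B = measure M (B \<inter> sphere 0 1)" if "B \<in> sets borel" for B
    using that by (simp add: M'_def measure_distr space Int_commute vimage_def)
  have Ab: "A \<in> sets borel"
    using A by (auto simp: sets_restrict_space)
  have fin': "emeasure M' (space M') \<noteq> \<infinity>" by simp
  have "\<exists>K. K \<subseteq> A \<and> compact K \<and> measure M' A < measure M' K + e / 2"
  proof (rule ccontr)
    assume "\<not> ?thesis"
    then have le: "measure M' K \<le> measure M' A - e / 2" if "K \<subseteq> A" "compact K" for K
      using that by force
    from le[of "{}"] have nn: "0 \<le> measure M' A - e / 2" by simp
    have "(SUP K\<in>{K. K \<subseteq> A \<and> compact K}. emeasure M' K) \<le> ennreal (measure M' A - e / 2)"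
      using le by (intro SUP_least) (auto simp: M'.emeasure_eq_measure intro!: ennreal_leI)
    also have "\<dots> < ennreal (measure M' A)" using e nn by (intro ennreal_lessI) auto
    finally show False using inner_regular[OF sets' fin' Ab] by (simp add: M'.emeasure_eq_measure)
  qed
  then obtain K where K: "K \<subseteq> A" "compact K" "measure M' A < measure M' K + e / 2" by blast
  have "\<exists>U. A \<subseteq> U \<and> open U \<and> measure M' U < measure M' A + e / 2"
  proof (rule ccontr)
    assume "\<not> ?thesis"
    then have le: "measure M' A + e / 2 \<le> measure M' U" if "A \<subseteq> U" "open U" for U
      using that by force
    have "ennreal (measure M' A) < ennreal (measure M' A + e / 2)" using e by (intro ennreal_lessI) (auto intro: add_nonneg_pos)
    also have "\<dots> \<le> (INF U\<in>{U. A \<subseteq> U \<and> open U}. emeasure M' U)"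
      using le by (intro INF_greatest) (auto simp: M'.emeasure_eq_measure intro!: ennreal_leI)
    finally show False using outer_regular[OF sets' fin' Ab] by (simp add: M'.emeasure_eq_measure)
  qed
  then obtain U where U: "A \<subseteq> U" "open U" "measure M' U < measure M' A + e / 2" by blast
  have "measure M' (U - K) = measure M' U - measure M' K"
    using K U by (intro M'.finite_measure_Diff) (auto simp: sets' compact_imp_closed)
  also have "\<dots> < e" using K U by linarith
  finally have "measure M' (U - K) < e" .
  then have "measure M ((U - K) \<inter> sphere 0 1) < e"
    using meas[of "U - K"] K U by (simp add: compact_imp_closed)
  then show thesis using that[of K U] K U by blast
qed

lemma indicator_continuous_approx:
  assumes fin: "finite_measure M1" "finite_measure M2"
    and sets: "sets M1 = sets circle_borel" "sets M2 = sets circle_borel"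
    and A: "A \<in> sets circle_borel" and e: "0 < (e :: real)"
  shows "\<exists>h. continuous_on (sphere 0 1) h \<and>
    (\<integral>z. \<bar>indicator A z - h z\<bar> \<partial>M1) < e \<and> (\<integral>z. \<bar>indicator A z - h z\<bar> \<partial>M2) < e"
proof -
  obtain K1 U1 where 1: "compact K1" "open U1" "K1 \<subseteq> A" "A \<subseteq> U1" "measure M1 ((U1 - K1) \<inter> sphere 0 1) < e"
    using circle_regular[OF fin(1) sets(1) A e] .
  obtain K2 U2 where 2: "compact K2" "open U2" "K2 \<subseteq> A" "A \<subseteq> U2" "measure M2 ((U2 - K2) \<inter> sphere 0 1) < e"
    using circle_regular[OF fin(2) sets(2) A e] .
  define K U where "K = K1 \<union> K2" and "U = U1 \<inter> U2"
  have K: "compact K" "K \<subseteq> A" and U: "open U" "A \<subseteq> U" using 1 2 by (auto simp: K_def U_def)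
  obtain h :: "complex \<Rightarrow> real" where h: "continuous_on UNIV h" "\<And>z. h z \<in> closed_segment 1 0"
      "\<And>z. z \<in> K \<Longrightarrow> h z = 1" "\<And>z. z \<in> - U \<Longrightarrow> h z = 0"
    by (rule Urysohn[of K "- U" 1 0]) (use K U in \<open>auto intro: compact_imp_closed\<close>)
  have h01: "0 \<le> h z" "h z \<le> 1" for z using h(2)[of z] by (auto simp: closed_segment_eq_real_ivl)
  have cont: "continuous_on (sphere 0 1) h" using h(1) continuous_on_subset by blast
  have est: "(\<integral>z. \<bar>indicator A z - h z\<bar> \<partial>M) < e"
    if M: "finite_measure M" "sets M = sets circle_borel"
      and m: "compact K'" "open U'" "K' \<subseteq> K" "U \<subseteq> U'" "measure M ((U' - K') \<inter> sphere 0 1) < e"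
    for M K' U'
  proof -
    interpret finite_measure M by fact
    have space: "space M = sphere 0 1" by (rule space_circle[OF M(2)])
    have hm: "h \<in> borel_measurable M" by (rule continuous_circle_measurable[OF cont M(2)])
    have Am: "A \<in> sets M" using A M(2) by simp
    have D: "(U' - K') \<inter> sphere 0 1 \<in> sets M"
      unfolding M(2) sets_restrict_space using m
      by (intro image_eqI[of _ _ "U' - K'"]) (auto simp: compact_imp_closed)
    have "(\<integral>z. \<bar>indicator A z - h z\<bar> \<partial>M) \<le> (\<integral>z. indicator ((U' - K') \<inter> sphere 0 1) z \<partial>M)"
    proof (rule integral_mono)
      show "integrable M (\<lambda>z. \<bar>indicator A z - h z\<bar>)"
      proof (rule integrable_const_bound[of _ 1])
        show "AE z in M. norm \<bar>indicator A z - h z\<bar> \<le> 1"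
        proof (rule AE_I2)
          fix z show "norm \<bar>indicator A z - h z\<bar> \<le> 1"
            using h01[of z] by (simp add: indicator_def)
        qed
      qed (use hm Am in auto)
      show "integrable M (\<lambda>z. indicator ((U' - K') \<inter> sphere 0 1) z :: real)"
        using D by (intro integrable_real_indicator) (auto simp: emeasure_eq_measure)
      fix z assume z: "z \<in> space M"
      show "\<bar>indicator A z - h z\<bar> \<le> indicator ((U' - K') \<inter> sphere 0 1) z"
      proof (cases "z \<in> U' - K'")
        case True
        then show ?thesis using z h01[of z] space by (auto simp: indicator_def abs_if)
      next
        case False
        then have "z \<in> K' \<or> z \<notin> U'" by auto
        then have "indicator A z = h z"
        proof
          assume "z \<in> K'"
          then have "z \<in> K" "z \<in> A" using m K by auto
          then show ?thesis using h(3) by simp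
        next
          assume "z \<notin> U'"
          then have "z \<notin> U" "z \<notin> A" using m U by auto
          then show ?thesis using h(4) by simp
        qed
        then show ?thesis by simp
      qed
    qed
    also have "\<dots> = measure M ((U' - K') \<inter> sphere 0 1)"
      using D by (simp add: space)
    finally show ?thesis using m(5) by simp
  qed
  show ?thesis
    using est[OF fin(1) sets(1), of K1 U1] est[OF fin(2) sets(2), of K2 U2] 1 2 cont
    by (intro exI[of _ h]) (auto simp: K_def U_def)
qed

lemma continuous_approx_nonneg:
  assumes fin: "finite_measure M1" "finite_measure M2"
    and sets: "sets M1 = sets circle_borel" "sets M2 = sets circle_borel"
    and u: "u \<in> borel_measurable circle_borel" "\<And>z. 0 \<le> (u z :: real)"
    and int: "integrable M1 u" "integrable M2 u" and e: "0 < (e :: real)"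
  shows "\<exists>h. continuous_on (sphere 0 1) h \<and> (\<integral>z. \<bar>u z - h z\<bar> \<partial>M1) < e \<and> (\<integral>z. \<bar>u z - h z\<bar> \<partial>M2) < e"
  using u int e
proof (induction u arbitrary: e rule: borel_measurable_induct_real)
  case (set A)
  then show ?case using indicator_continuous_approx[OF fin sets] by blast
next
  case (mult u c)
  show ?case
  proof (cases "c = 0")
    case True
    then show ?thesis using mult.prems by (intro exI[of _ "\<lambda>_. 0"]) auto
  next
    case False
    then have c: "0 < c" using mult by simp
    have "integrable M1 u" "integrable M2 u"
      using mult.prems c by (auto simp: integrable_mult_right_iff)
    moreover have "0 < e / c" using mult.prems c by simp
    ultimately obtain h where h: "continuous_on (sphere 0 1) h"
      "(\<integral>z. \<bar>u z - h z\<bar> \<partial>M1) < e / c" "(\<integral>z. \<bar>u z - h z\<bar> \<partial>M2) < e / c"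
      using mult.IH by blast
    have eq: "\<bar>c * u z - c * h z\<bar> = c * \<bar>u z - h z\<bar>" for z
      using c by (simp add: right_diff_distrib[symmetric] abs_mult)
    show ?thesis
      using h c by (intro exI[of _ "\<lambda>z. c * h z"])
        (auto intro!: continuous_intros simp: eq field_simps)
  qed
next
  case (add u v)
  have intu: "integrable M u" and intv: "integrable M v"
    if "sets M = sets circle_borel" "integrable M (\<lambda>z. v z + u z)" for M
  proof -
    have m: "u \<in> borel_measurable M" "v \<in> borel_measurable M"
      using add.hyps by (simp_all add: measurable_cong_sets[OF that(1) refl])
    show "integrable M u" "integrable M v"
      using add.hyps m by (auto intro!: Bochner_Integration.integrable_bound[OF that(2)] AE_I2)
  qed
  have e2: "0 < e / 2" using add.prems by simp
  obtain h where h: "continuous_on (sphere 0 1) h"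
      "(\<integral>z. \<bar>u z - h z\<bar> \<partial>M1) < e / 2" "(\<integral>z. \<bar>u z - h z\<bar> \<partial>M2) < e / 2"
    using add.IH(1)[OF _ _ e2] intu add.prems sets by blast
  obtain k where k: "continuous_on (sphere 0 1) k"
      "(\<integral>z. \<bar>v z - k z\<bar> \<partial>M1) < e / 2" "(\<integral>z. \<bar>v z - k z\<bar> \<partial>M2) < e / 2"
    using add.IH(2)[OF _ _ e2] intv add.prems sets by blast
  have est: "(\<integral>z. \<bar>v z + u z - (k z + h z)\<bar> \<partial>M) < e"
    if M: "finite_measure M" "sets M = sets circle_borel" "integrable M (\<lambda>z. v z + u z)"
      "(\<integral>z. \<bar>u z - h z\<bar> \<partial>M) < e / 2" "(\<integral>z. \<bar>v z - k z\<bar> \<partial>M) < e / 2" for M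
  proof -
    have i: "integrable M u" "integrable M v" "integrable M h" "integrable M k"
      using intu intv M h k by (auto intro: integrable_continuous_circle)
    have "(\<integral>z. \<bar>v z + u z - (k z + h z)\<bar> \<partial>M) \<le> (\<integral>z. \<bar>v z - k z\<bar> + \<bar>u z - h z\<bar> \<partial>M)"
      using i by (intro integral_mono) auto
    also have "\<dots> = (\<integral>z. \<bar>v z - k z\<bar> \<partial>M) + (\<integral>z. \<bar>u z - h z\<bar> \<partial>M)"
      using i by (intro Bochner_Integration.integral_add) auto
    finally show ?thesis using M by linarith
  qed
  show ?case
    using est[OF fin(1) sets(1)] est[OF fin(2) sets(2)] h k add.prems
    by (intro exI[of _ "\<lambda>z. k z + h z"]) (auto intro!: continuous_intros)
next
  case (seq U)
  have le: "U i z \<le> u z" if "z \<in> sphere 0 1" for i z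
  proof -
    have "incseq (\<lambda>i. U i z)" using seq.hyps by (auto simp: incseq_def le_fun_def)
    then show ?thesis using seq.hyps(4)[of z] that by (intro incseq_le) (auto simp: space_restrict_space)
  qed
  have conv: "integrable M (U i)" "(\<lambda>i. \<integral>z. \<bar>u z - U i z\<bar> \<partial>M) \<longlonglongrightarrow> 0"
    if M: "sets M = sets circle_borel" "integrable M u" for M i
  proof -
    have sp: "space M = sphere 0 1" by (rule space_circle[OF M(1)])
    have m: "U i \<in> borel_measurable M" for i
      using seq.hyps by (simp add: measurable_cong_sets[OF M(1) refl])
    show "integrable M (U i)"
      using seq.hyps le m sp by (intro Bochner_Integration.integrable_bound[OF M(2)] AE_I2) (auto intro: order_trans[OF le abs_ge_self])
    have "(\<lambda>i. \<integral>z. \<bar>u z - U i z\<bar> \<partial>M) \<longlonglongrightarrow> (\<integral>z. 0 \<partial>M)"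
    proof (rule integral_dominated_convergence[where w = u])
      show "AE z in M. (\<lambda>i. \<bar>u z - U i z\<bar>) \<longlonglongrightarrow> 0"
      proof (rule AE_I2)
        fix z assume "z \<in> space M"
        then have "(\<lambda>i. U i z) \<longlonglongrightarrow> u z" using seq.hyps(4) sp by (simp add: space_restrict_space)
        then have "(\<lambda>i. \<bar>u z - U i z\<bar>) \<longlonglongrightarrow> \<bar>u z - u z\<bar>" by (intro tendsto_intros)
        then show "(\<lambda>i. \<bar>u z - U i z\<bar>) \<longlonglongrightarrow> 0" by simp
      qed
      show "AE z in M. norm \<bar>u z - U i z\<bar> \<le> u z" for i
        using le seq.hyps(2) sp by (intro AE_I2) auto
    qed (use M m in auto)
    then show "(\<lambda>i. \<integral>z. \<bar>u z - U i z\<bar> \<partial>M) \<longlonglongrightarrow> 0" by simp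
  qed
  have e2: "0 < e / 2" using seq.prems by simp
  have "eventually (\<lambda>i. (\<integral>z. \<bar>u z - U i z\<bar> \<partial>M1) < e / 2) sequentially"
    "eventually (\<lambda>i. (\<integral>z. \<bar>u z - U i z\<bar> \<partial>M2) < e / 2) sequentially"
    by (rule order_tendstoD(2)[OF conv(2)[OF sets(1) seq.prems(1)] e2],
        rule order_tendstoD(2)[OF conv(2)[OF sets(2) seq.prems(2)] e2])
  then have "eventually (\<lambda>i. (\<integral>z. \<bar>u z - U i z\<bar> \<partial>M1) < e / 2 \<and> (\<integral>z. \<bar>u z - U i z\<bar> \<partial>M2) < e / 2) sequentially"
    by (rule eventually_conj)
  then obtain i where i: "(\<integral>z. \<bar>u z - U i z\<bar> \<partial>M1) < e / 2" "(\<integral>z. \<bar>u z - U i z\<bar> \<partial>M2) < e / 2"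
    by (auto simp: eventually_sequentially)
  obtain h where h: "continuous_on (sphere 0 1) h"
      "(\<integral>z. \<bar>U i z - h z\<bar> \<partial>M1) < e / 2" "(\<integral>z. \<bar>U i z - h z\<bar> \<partial>M2) < e / 2"
    using seq.IH[OF _ _ e2] conv(1) seq.prems sets by blast
  have est: "(\<integral>z. \<bar>u z - h z\<bar> \<partial>M) < e"
    if M: "finite_measure M" "sets M = sets circle_borel" "integrable M u"
      "(\<integral>z. \<bar>u z - U i z\<bar> \<partial>M) < e / 2" "(\<integral>z. \<bar>U i z - h z\<bar> \<partial>M) < e / 2" for M
  proof -
    have i: "integrable M (U i)" "integrable M h"
      using conv(1) M h by (auto intro: integrable_continuous_circle)
    have "(\<integral>z. \<bar>u z - h z\<bar> \<partial>M) \<le> (\<integral>z. \<bar>u z - U i z\<bar> + \<bar>U i z - h z\<bar> \<partial>M)"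
      using i M by (intro integral_mono) auto
    also have "\<dots> = (\<integral>z. \<bar>u z - U i z\<bar> \<partial>M) + (\<integral>z. \<bar>U i z - h z\<bar> \<partial>M)"
      using i M by (intro Bochner_Integration.integral_add) auto
    finally show ?thesis using M by linarith
  qed
  show ?case
    using est[OF fin(1) sets(1)] est[OF fin(2) sets(2)] h i seq.prems by (intro exI[of _ h]) auto
qed

text \<open>Bounded measurable functions are approximated by continuous functions in \<open>L\<^sup>1\<close> of two measures
  simultaneously, without leaving the range \<open>[a, b]\<close>.\<close>

lemma continuous_approx_bounded:
  fixes u :: "complex \<Rightarrow> real"
  assumes fin: "finite_measure M1" "finite_measure M2"
    and sets: "sets M1 = sets circle_borel" "sets M2 = sets circle_borel"
    and u: "u \<in> borel_measurable circle_borel" "\<And>z. a \<le> u z" "\<And>z. u z \<le> b" and e: "0 < (e :: real)"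
  obtains h where "continuous_on (sphere 0 1) h" "\<And>z. a \<le> h z" "\<And>z. h z \<le> b"
    "(\<integral>z. \<bar>u z - h z\<bar> \<partial>M1) < e" "(\<integral>z. \<bar>u z - h z\<bar> \<partial>M2) < e"
proof -
  have int: "integrable M u" if "finite_measure M" "sets M = sets circle_borel" for M
  proof (rule finite_measure.integrable_const_bound[OF that(1)])
    show "u \<in> borel_measurable M" using u(1) by (simp add: measurable_cong_sets[OF that(2) refl])
    show "AE z in M. norm (u z) \<le> max \<bar>a\<bar> \<bar>b\<bar>"
    proof (rule AE_I2)
      fix z show "norm (u z) \<le> max \<bar>a\<bar> \<bar>b\<bar>" using u(2,3)[of z] by auto
    qed
  qed
  have intc: "integrable M (\<lambda>z. u z - a)" if "finite_measure M" "sets M = sets circle_borel" for M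
    by (intro Bochner_Integration.integrable_diff int[OF that] finite_measure.integrable_const[OF that(1)])
  have "\<exists>k. continuous_on (sphere 0 1) k \<and> (\<integral>z. \<bar>u z - a - k z\<bar> \<partial>M1) < e \<and> (\<integral>z. \<bar>u z - a - k z\<bar> \<partial>M2) < e"
    by (rule continuous_approx_nonneg[OF fin sets]) (use u e intc fin sets in auto)
  then obtain k where k: "continuous_on (sphere 0 1) k"
    "(\<integral>z. \<bar>u z - a - k z\<bar> \<partial>M1) < e" "(\<integral>z. \<bar>u z - a - k z\<bar> \<partial>M2) < e" by blast
  define h where "h z = max a (min b (a + k z))" for z
  have ab: "a \<le> b" using u(2,3)[of 0] by linarith
  have cont: "continuous_on (sphere 0 1) h" unfolding h_def by (intro continuous_intros k)
  have est: "(\<integral>z. \<bar>u z - h z\<bar> \<partial>M) < e"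
    if M: "finite_measure M" "sets M = sets circle_borel" "(\<integral>z. \<bar>u z - a - k z\<bar> \<partial>M) < e" for M
  proof -
    have "(\<integral>z. \<bar>u z - h z\<bar> \<partial>M) \<le> (\<integral>z. \<bar>u z - a - k z\<bar> \<partial>M)"
    proof (rule integral_mono)
      show "integrable M (\<lambda>z. \<bar>u z - h z\<bar>)" "integrable M (\<lambda>z. \<bar>u z - a - k z\<bar>)"
        using int[OF M(1,2)] intc[OF M(1,2)] integrable_continuous_circle[OF M(1,2) cont]
          integrable_continuous_circle[OF M(1,2) k(1)] by auto
      fix z show "\<bar>u z - h z\<bar> \<le> \<bar>u z - a - k z\<bar>"
        using u(2,3)[of z] by (auto simp: h_def max_def min_def abs_if)
    qed
    then show ?thesis using M(3) by linarith
  qed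
  show thesis
  proof (rule that[OF cont])
    show "a \<le> h z" "h z \<le> b" for z using ab by (auto simp: h_def)
  qed (use est[OF fin(1) sets(1)] est[OF fin(2) sets(2)] k in auto)
qed

section \<open>Weak convergence of the Bernstein--Szego approximations\<close>

text \<open>Real polynomials in \<open>Re z\<close> and \<open>Im z\<close> are trigonometric polynomials on the circle.\<close>

lemma real_polynomial_circle:
  assumes "real_polynomial_function (f :: complex \<Rightarrow> real)"
  shows "\<exists>s p. \<forall>z. cmod z = 1 \<longrightarrow> complex_of_real (f z) = cnj z ^ s * poly p z"
  using assms
proof (induction f rule: real_polynomial_function.induct)
  case (linear f)
  interpret bounded_linear f by fact
  let ?a = "complex_of_real (f 1)" and ?b = "complex_of_real (f \<i>)"
  \<comment> \<open>\<open>cnj z * ?p z\<close> is \<open>Re z * f 1 + Im z * f \<i>\<close> because \<open>cnj z * z = 1\<close>\<close>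
  let ?p = "[:(?a + \<i> * ?b) / 2, 0, (?a - \<i> * ?b) / 2:]"
  show ?case
  proof (intro exI allI impI)
    fix z :: complex assume z: "cmod z = 1"
    have "z = Re z *\<^sub>R 1 + Im z *\<^sub>R \<i>" by (simp add: complex_eq_iff)
    from arg_cong[OF this, of f] have "f z = Re z * f 1 + Im z * f \<i>" by (simp add: add scaleR)
    then have 1: "complex_of_real (f z) = of_real (Re z) * ?a + of_real (Im z) * ?b" by simp
    have "cnj z ^ 1 * poly ?p z = (?a + \<i> * ?b) / 2 * cnj z + (?a - \<i> * ?b) / 2 * z * (cnj z * z)"
      by (simp add: algebra_simps)
    also have "\<dots> = ?a * ((z + cnj z) / 2) + ?b * ((z - cnj z) / (2 * \<i>))"
      by (simp only: cnj_mult_self_circle[OF z]) (simp add: field_simps)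
    also have "\<dots> = complex_of_real (f z)"
      unfolding 1 by (simp add: complex_add_cnj complex_diff_cnj mult_ac)
    finally show "complex_of_real (f z) = cnj z ^ 1 * poly ?p z" by simp
  qed
next
  case (const c)
  show ?case by (rule exI[of _ 0], rule exI[of _ "[:complex_of_real c:]"]) simp
next
  case (add f g)
  then obtain s p t q where st: "\<And>z. cmod z = 1 \<Longrightarrow> complex_of_real (f z) = cnj z ^ s * poly p z"
    "\<And>z. cmod z = 1 \<Longrightarrow> complex_of_real (g z) = cnj z ^ t * poly q z" by blast
  show ?case
  proof (intro exI allI impI)
    fix z :: complex assume z: "cmod z = 1"
    have one: "cnj z ^ i * z ^ i = 1" for i using cnj_power_mult_power[OF z, of i i] by simp
    have "cnj z ^ (s + t) * poly (monom 1 t * p + monom 1 s * q) z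
        = (cnj z ^ t * z ^ t) * (cnj z ^ s * poly p z) + (cnj z ^ s * z ^ s) * (cnj z ^ t * poly q z)"
      by (simp add: poly_monom power_add algebra_simps)
    then show "complex_of_real (f z + g z) = cnj z ^ (s + t) * poly (monom 1 t * p + monom 1 s * q) z"
      using st[OF z] one by simp
  qed
next
  case (mult f g)
  then obtain s p t q where st: "\<And>z. cmod z = 1 \<Longrightarrow> complex_of_real (f z) = cnj z ^ s * poly p z"
    "\<And>z. cmod z = 1 \<Longrightarrow> complex_of_real (g z) = cnj z ^ t * poly q z" by blast
  show ?case
    using st by (intro exI[of _ "s + t"] exI[of _ "p * q"]) (simp add: power_add algebra_simps)
qed

context nontrivial_circle_measure
begin

lemma integral_bs_density: "(\<integral>z. bs_density n z \<partial>circ) = 1"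
proof -
  have "bs_diff n (\<lambda>z. 1) = 0" using bs_diff_power[of 0 n] by simp
  then have "complex_of_real 1 = (\<integral>z. complex_of_real (bs_density n z) \<partial>circ)"
    using prob_space.prob_space[OF mu_prob] by (simp add: bs_diff_def)
  then show ?thesis by (simp only: integral_complex_of_real of_real_eq_iff)
qed

theorem bs_weak_convergence:
  fixes f :: "complex \<Rightarrow> real"
  assumes f: "continuous_on (sphere 0 1) f"
  shows "(\<lambda>n. \<integral>z. f z * bs_density n z \<partial>circ) \<longlonglongrightarrow> (\<integral>z. f z \<partial>\<mu>)"
proof (rule LIMSEQ_I)
  fix e :: real assume e: "0 < e"
  obtain g where g: "real_polynomial_function g" "\<And>z. z \<in> sphere 0 1 \<Longrightarrow> \<bar>f z - g z\<bar> < e / 3"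
    using Stone_Weierstrass_real_polynomial_function[of "sphere 0 1" f "e / 3"] f e by auto
  have contg: "continuous_on (sphere 0 1) g"
    using g(1) by (simp add: continuous_on_polymonial_function real_polynomial_function_eq)
  obtain s p where sp: "\<And>z. cmod z = 1 \<Longrightarrow> complex_of_real (g z) = cnj z ^ s * poly p z"
    using real_polynomial_circle[OF g(1)] by blast
  show "\<exists>no. \<forall>n\<ge>no. norm ((\<integral>z. f z * bs_density n z \<partial>circ) - (\<integral>z. f z \<partial>\<mu>)) < e"
  proof (intro exI allI impI)
    fix n assume n: "s + degree p \<le> n"
    have "bs_diff n (\<lambda>z. complex_of_real (g z)) = bs_diff n (\<lambda>z. cnj z ^ s * poly p z)"
      by (rule bs_diff_cong) (rule sp)
    also have "\<dots> = 0" by (rule bs_diff_trig_poly[OF n])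
    finally have "complex_of_real (\<integral>z. g z \<partial>\<mu>) = complex_of_real (\<integral>z. g z * bs_density n z \<partial>circ)"
      unfolding bs_diff_def by (simp flip: of_real_mult)
    then have eq: "(\<integral>z. g z \<partial>\<mu>) = (\<integral>z. g z * bs_density n z \<partial>circ)" by (simp only: of_real_eq_iff)
    have int: "integrable circ (\<lambda>z. f z * bs_density n z)" "integrable circ (\<lambda>z. g z * bs_density n z)"
      "integrable circ (\<lambda>z. bs_density n z)" "integrable \<mu> f" "integrable \<mu> g"
      by (intro circ_integrable mu_integrable continuous_intros f contg)+
    have "\<bar>(\<integral>z. f z * bs_density n z \<partial>circ) - (\<integral>z. g z * bs_density n z \<partial>circ)\<bar>
        = \<bar>\<integral>z. (f z - g z) * bs_density n z \<partial>circ\<bar>"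
      using int by (simp add: left_diff_distrib)
    also have "\<dots> \<le> (\<integral>z. \<bar>(f z - g z) * bs_density n z\<bar> \<partial>circ)" by (rule integral_abs_bound)
    also have "\<dots> \<le> (\<integral>z. e / 3 * bs_density n z \<partial>circ)"
    proof (rule integral_mono)
      show "integrable circ (\<lambda>z. \<bar>(f z - g z) * bs_density n z\<bar>)"
        using int by (simp add: left_diff_distrib)
      fix z assume "z \<in> space circ"
      then show "\<bar>(f z - g z) * bs_density n z\<bar> \<le> e / 3 * bs_density n z"
        using g(2)[of z] bs_density_pos[of z n] by (simp add: abs_mult mult_right_mono)
    qed (use int in simp)
    also have "\<dots> = e / 3" by (simp add: integral_bs_density)
    finally have 1: "\<bar>(\<integral>z. f z * bs_density n z \<partial>circ) - (\<integral>z. g z * bs_density n z \<partial>circ)\<bar> \<le> e / 3" .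
    have "\<bar>(\<integral>z. f z \<partial>\<mu>) - (\<integral>z. g z \<partial>\<mu>)\<bar> = \<bar>\<integral>z. f z - g z \<partial>\<mu>\<bar>" using int by simp
    also have "\<dots> \<le> (\<integral>z. \<bar>f z - g z\<bar> \<partial>\<mu>)" by (rule integral_abs_bound)
    also have "\<dots> \<le> (\<integral>z. e / 3 \<partial>\<mu>)"
      using int g(2) by (intro integral_mono) (auto simp: mu_space prob_space.finite_measure[OF mu_prob] finite_measure.integrable_const intro: less_imp_le)
    also have "\<dots> = e / 3" using prob_space.prob_space[OF mu_prob] by simp
    finally show "norm ((\<integral>z. f z * bs_density n z \<partial>circ) - (\<integral>z. f z \<partial>\<mu>)) < e"
      using 1 eq e by (simp only: real_norm_def)
  qed
qed

end

section \<open>The absolutely continuous part\<close>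

lemma Arg2pi_measurable: "Arg2pi \<in> borel_measurable borel"
proof (rule measurable_piecewise_restrict[of "{\<real>\<^sub>\<ge>\<^sub>0, - \<real>\<^sub>\<ge>\<^sub>0}"])
  fix \<Omega> :: "complex set" assume "\<Omega> \<in> {\<real>\<^sub>\<ge>\<^sub>0, - \<real>\<^sub>\<ge>\<^sub>0}"
  then consider "\<Omega> = \<real>\<^sub>\<ge>\<^sub>0" | "\<Omega> = - \<real>\<^sub>\<ge>\<^sub>0" by auto
  then show "\<Omega> \<inter> space borel \<in> sets borel"
    by cases (auto intro: borel_closed borel_comp closed_nonneg_Reals_complex)
  show "Arg2pi \<in> borel_measurable (restrict_space borel \<Omega>)"
    using \<open>\<Omega> \<in> _\<close>
  proof (elim insertE emptyE)
    assume \<Omega>: "\<Omega> = \<real>\<^sub>\<ge>\<^sub>0"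
    have "Arg2pi z = 0" if "z \<in> space (restrict_space borel \<Omega>)" for z
      using that by (auto simp: \<Omega> space_restrict_space Arg2pi_eq_0 complex_nonneg_Reals_iff complex_is_Real_iff)
    then show ?thesis by (subst measurable_cong[where g = "\<lambda>_. 0"]) auto
  next
    assume \<Omega>: "\<Omega> = - \<real>\<^sub>\<ge>\<^sub>0"
    show ?thesis
      by (intro borel_measurable_continuous_on_restrict continuous_at_imp_continuous_on)
        (auto simp: \<Omega> intro: continuous_at_Arg2pi)
  qed
qed auto

lemma integrable_bounded_circle:
  fixes f :: "complex \<Rightarrow> real"
  assumes "finite_measure M" "sets M = sets circle_borel" "f \<in> borel_measurable circle_borel"
    "\<And>z. cmod z = 1 \<Longrightarrow> \<bar>f z\<bar> \<le> B"
  shows "integrable M f"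
proof (rule finite_measure.integrable_const_bound[OF assms(1)])
  show "AE z in M. norm (f z) \<le> B" using assms(4) by (intro AE_I2) (simp add: space_circle[OF assms(2)])
  show "f \<in> borel_measurable M" using assms(3) by (simp add: measurable_cong_sets[OF assms(2) refl])
qed

lemma continuous_bounded_circle:
  fixes g :: "complex \<Rightarrow> real"
  assumes "continuous_on (sphere 0 1) g"
  obtains C where "0 < C" "\<And>z. cmod z = 1 \<Longrightarrow> \<bar>g z\<bar> \<le> C"
proof -
  have "bounded (g ` sphere 0 1)"
    using compact_continuous_image[OF assms] compact_imp_bounded by auto
  then obtain B where "\<forall>z\<in>sphere 0 1. norm (g z) \<le> B" by (auto simp: bounded_iff)
  then show thesis using that[of "max 1 B"] by (force simp: le_max_iff_disj)
qed

text \<open>A measure together with the density of its absolutely continuous part.\<close>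

locale circle_ac = nontrivial_circle_measure \<mu> for \<mu> +
  fixes w :: "real \<Rightarrow> real"
  assumes ac: "ac_density \<mu> w"
begin

text \<open>The density as a function on the circle.\<close>

definition W :: "complex \<Rightarrow> real" where "W z = w (Arg2pi z)"

lemma W_measurable [measurable]: "W \<in> borel_measurable circle_borel"
proof -
  have "Arg2pi \<in> circle_borel \<rightarrow>\<^sub>M restrict_space borel {0..<2 * pi}"
    by (intro measurable_restrict_space2 measurable_restrict_space1 Arg2pi_measurable)
      (auto simp: Arg2pi_ge_0 Arg2pi_lt_2pi)
  moreover have "w \<in> borel_measurable (restrict_space borel {0..<2 * pi})"
    using ac by (simp add: ac_density_def)
  ultimately show ?thesis unfolding W_def by (rule measurable_compose)
qed

lemma W_nonneg: "0 \<le> W z"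
  using ac Arg2pi_ge_0[of z] Arg2pi_lt_2pi[of z] by (auto simp: W_def ac_density_def)

lemma W_cis: "\<theta> \<in> {0..<2 * pi} \<Longrightarrow> W (cis \<theta>) = w \<theta>"
  using Arg2pi_unique[of 1 \<theta> "cis \<theta>"] by (simp add: W_def cis_conv_exp)

text \<open>Off a set \<open>S\<close> of Lebesgue measure \<open>0\<close> the measure \<open>\<mu>\<close> has density \<open>W\<close>.\<close>

lemma ac_decomposition:
  obtains S where "S \<in> sets circle_borel" "AE z in circ. z \<notin> S"
    "density \<mu> (\<lambda>z. ennreal (indicator (- S) z)) = density circ (\<lambda>z. ennreal (W z))"
proof -
  obtain \<mu>s S where sets: "sets \<mu>s = sets circle_borel" and S: "S \<in> sets circle_borel"
    and null: "emeasure (distr angle_measure circle_borel cis) S = 0"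
    and sing: "emeasure \<mu>s (sphere 0 1 - S) = 0"
    and dec: "\<And>A. A \<in> sets circle_borel \<Longrightarrow> emeasure \<mu> A =
      emeasure (distr (density angle_measure (\<lambda>\<theta>. ennreal (w \<theta>))) circle_borel cis) A + emeasure \<mu>s A"
    using ac unfolding ac_density_def by blast
  have wm[measurable]: "w \<in> borel_measurable angle_measure"
    using ac by (simp add: ac_density_def measurable_cong_sets[OF sets_angle_measure refl])
  have Wc[measurable]: "W \<in> borel_measurable circ"
    using W_measurable by (simp add: measurable_cong_sets[OF sets_circ refl])
  have W_em: "emeasure (distr (density angle_measure (\<lambda>\<theta>. ennreal (w \<theta>))) circle_borel cis) A
      = emeasure (density circ (\<lambda>z. ennreal (W z))) A" if A[measurable]: "A \<in> sets circle_borel" for A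
  proof -
    have cm: "cis \<in> density angle_measure (\<lambda>\<theta>. ennreal (w \<theta>)) \<rightarrow>\<^sub>M circle_borel" by simp
    have pre: "cis -` A \<inter> space angle_measure \<in> sets angle_measure" by (rule measurable_sets[OF cis_measurable A])
    have "emeasure (distr (density angle_measure (\<lambda>\<theta>. ennreal (w \<theta>))) circle_borel cis) A
        = emeasure (density angle_measure (\<lambda>\<theta>. ennreal (w \<theta>))) (cis -` A \<inter> space angle_measure)"
      using emeasure_distr[OF cm A] by simp
    also have "\<dots> = (\<integral>\<^sup>+\<theta>. ennreal (w \<theta>) * indicator (cis -` A \<inter> space angle_measure) \<theta> \<partial>angle_measure)"
      using pre by (intro emeasure_density) auto
    also have "\<dots> = (\<integral>\<^sup>+\<theta>. ennreal (W (cis \<theta>)) * indicator A (cis \<theta>) \<partial>angle_measure)"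
      by (intro nn_integral_cong) (auto simp: W_cis indicator_def)
    also have "\<dots> = (\<integral>\<^sup>+z. ennreal (W z) * indicator A z \<partial>circ)"
      unfolding circ_def by (rule nn_integral_distr[symmetric]) auto
    also have "\<dots> = emeasure (density circ (\<lambda>z. ennreal (W z))) A"
      using A by (intro emeasure_density[symmetric]) auto
    finally show ?thesis .
  qed
  have nullc: "S \<in> null_sets circ" using null S by (auto simp: null_sets_def circ_def)
  have Sc: "sphere 0 1 - S \<in> sets circle_borel"
    using sets.compl_sets[OF S] by (simp add: space_restrict_space)
  show thesis
  proof (rule that[OF S AE_not_in[OF nullc]], rule measure_eqI)
    fix A assume "A \<in> sets (density \<mu> (\<lambda>z. ennreal (indicator (- S) z)))"
    then have A: "A \<in> sets circle_borel" by (simp add: mu_sets)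
    have AS: "A - S \<in> sets circle_borel" using A S by (rule sets.Diff)
    have sub: "A \<subseteq> sphere 0 1" using sets.sets_into_space[OF A] by (simp add: space_restrict_space)
    have Smu[measurable]: "S \<in> sets \<mu>" "A \<in> sets \<mu>" using S A mu_sets by auto
    have "emeasure (density \<mu> (\<lambda>z. ennreal (indicator (- S) z))) A
        = (\<integral>\<^sup>+z. ennreal (indicator (- S) z) * indicator A z \<partial>\<mu>)"
      by (rule emeasure_density) auto
    also have "\<dots> = (\<integral>\<^sup>+z. indicator (A - S) z \<partial>\<mu>)"
      by (intro nn_integral_cong) (auto simp: indicator_def)
    also have "\<dots> = emeasure \<mu> (A - S)" by simp
    also have "\<dots> = emeasure (density circ (\<lambda>z. ennreal (W z))) (A - S) + emeasure \<mu>s (A - S)"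
      by (simp add: dec[OF AS] W_em[OF AS])
    also have "emeasure \<mu>s (A - S) = 0"
      using sing sub emeasure_mono[of "A - S" "sphere 0 1 - S" \<mu>s] Sc sets by auto
    also have "emeasure (density circ (\<lambda>z. ennreal (W z))) (A - S) = emeasure (density circ (\<lambda>z. ennreal (W z))) A"
    proof -
      have "A - S \<in> sets circ" "A \<in> sets circ" using A AS by auto
      moreover have "AE z in circ. z \<notin> S" by (rule AE_not_in[OF nullc])
      ultimately show ?thesis
        by (auto simp: emeasure_density indicator_def intro!: nn_integral_cong_AE)
    qed
    finally show "emeasure (density \<mu> (\<lambda>z. ennreal (indicator (- S) z))) A = emeasure (density circ (\<lambda>z. ennreal (W z))) A"
      by simp
  qed (simp add: mu_sets)
qed

text \<open>A Lebesgue null set that carries the singular part of \<open>\<mu>\<close>.\<close>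

definition sing_set :: "complex set" where
  "sing_set = (SOME S. S \<in> sets circle_borel \<and> (AE z in circ. z \<notin> S) \<and>
    density \<mu> (\<lambda>z. ennreal (indicator (- S) z)) = density circ (\<lambda>z. ennreal (W z)))"

lemma sing_set: "sing_set \<in> sets circle_borel" "AE z in circ. z \<notin> sing_set"
  "density \<mu> (\<lambda>z. ennreal (indicator (- sing_set) z)) = density circ (\<lambda>z. ennreal (W z))"
proof -
  have "\<exists>S. S \<in> sets circle_borel \<and> (AE z in circ. z \<notin> S) \<and>
    density \<mu> (\<lambda>z. ennreal (indicator (- S) z)) = density circ (\<lambda>z. ennreal (W z))"
    using ac_decomposition by metis
  from someI_ex[OF this] show "sing_set \<in> sets circle_borel" "AE z in circ. z \<notin> sing_set"
    "density \<mu> (\<lambda>z. ennreal (indicator (- sing_set) z)) = density circ (\<lambda>z. ennreal (W z))"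
    unfolding sing_set_def by blast+
qed

lemma circ_borel_measurable: "borel_measurable circ = borel_measurable circle_borel"
  by (intro measurable_cong_sets) auto

lemma mu_borel_measurable: "borel_measurable \<mu> = borel_measurable circle_borel"
  by (intro measurable_cong_sets mu_sets) auto

lemma indicator_sing_measurable [measurable]:
  "(indicator (- sing_set) :: complex \<Rightarrow> real) \<in> borel_measurable circle_borel"
proof -
  have "(\<lambda>z. 1 - indicator sing_set z :: real) \<in> borel_measurable circle_borel"
    using sing_set(1) by simp
  moreover have "(\<lambda>z. 1 - indicator sing_set z :: real) = indicator (- sing_set)"
    by (auto simp: indicator_def)
  ultimately show ?thesis by simp
qed

lemma integral_off_sing_set:
  fixes f :: "complex \<Rightarrow> real"
  assumes f: "f \<in> borel_measurable circle_borel"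
  shows "(\<integral>z. indicator (- sing_set) z * f z \<partial>\<mu>) = (\<integral>z. W z * f z \<partial>circ)"
    and "integrable \<mu> (\<lambda>z. indicator (- sing_set) z * f z) \<longleftrightarrow> integrable circ (\<lambda>z. W z * f z)"
proof -
  have m: "f \<in> borel_measurable \<mu>" "f \<in> borel_measurable circ"
    "W \<in> borel_measurable circ" "(indicator (- sing_set) :: complex \<Rightarrow> real) \<in> borel_measurable \<mu>"
    using f W_measurable indicator_sing_measurable by (simp_all add: circ_borel_measurable mu_borel_measurable)
  have "(\<integral>z. indicator (- sing_set) z * f z \<partial>\<mu>)
      = integral\<^sup>L (density \<mu> (\<lambda>z. ennreal (indicator (- sing_set) z))) f"
    using integral_density[OF m(1,4)] by simp
  also have "\<dots> = (\<integral>z. W z * f z \<partial>circ)"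
    unfolding sing_set(3) using integral_density[OF m(2,3)] W_nonneg by simp
  finally show "(\<integral>z. indicator (- sing_set) z * f z \<partial>\<mu>) = (\<integral>z. W z * f z \<partial>circ)" .
  have "integrable \<mu> (\<lambda>z. indicator (- sing_set) z * f z)
      \<longleftrightarrow> integrable (density \<mu> (\<lambda>z. ennreal (indicator (- sing_set) z))) f"
    using integrable_density[OF m(1,4)] by simp
  also have "\<dots> \<longleftrightarrow> integrable circ (\<lambda>z. W z * f z)"
    unfolding sing_set(3) using integrable_density[OF m(2,3)] W_nonneg by simp
  finally show "integrable \<mu> (\<lambda>z. indicator (- sing_set) z * f z) \<longleftrightarrow> integrable circ (\<lambda>z. W z * f z)" .
qed

lemma integral_W_le:
  assumes f: "continuous_on (sphere 0 1) f" "\<And>z. cmod z = 1 \<Longrightarrow> 0 \<le> f z"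
  shows "integrable circ (\<lambda>z. W z * f z)" "(\<integral>z. W z * f z \<partial>circ) \<le> (\<integral>z. f z \<partial>\<mu>)"
proof -
  have fm: "f \<in> borel_measurable circle_borel" by (rule continuous_circle_measurable[OF f(1)]) simp
  have int: "integrable \<mu> f" by (rule mu_integrable[OF f(1)])
  have bound: "\<bar>indicator (- sing_set) z * f z\<bar> \<le> \<bar>f z\<bar>" for z by (simp add: indicator_def)
  have int2: "integrable \<mu> (\<lambda>z. indicator (- sing_set) z * f z)"
    using bound fm by (intro Bochner_Integration.integrable_bound[OF int] AE_I2) (auto simp: mu_borel_measurable)
  then show "integrable circ (\<lambda>z. W z * f z)" using integral_off_sing_set(2)[OF fm] by simp
  have "(\<integral>z. indicator (- sing_set) z * f z \<partial>\<mu>) \<le> (\<integral>z. f z \<partial>\<mu>)"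
    using f(2) by (intro integral_mono int int2) (auto simp: indicator_def mu_space)
  then show "(\<integral>z. W z * f z \<partial>circ) \<le> (\<integral>z. f z \<partial>\<mu>)" by (simp add: integral_off_sing_set(1)[OF fm])
qed

lemma W_integrable: "integrable circ W" and integral_W_le_1: "(\<integral>z. W z \<partial>circ) \<le> 1"
  using integral_W_le[of "\<lambda>_. 1"] prob_space.prob_space[OF mu_prob] by auto

lemma integrable_mult_ln_max:
  assumes g: "continuous_on (sphere 0 1) g" and \<epsilon>: "0 < \<epsilon>"
  shows "integrable circ (\<lambda>z. g z * ln (max (W z) \<epsilon>))"
proof -
  obtain C where C: "0 < C" "\<And>z. cmod z = 1 \<Longrightarrow> \<bar>g z\<bar> \<le> C" using continuous_bounded_circle[OF g] by blast
  have gm: "g \<in> borel_measurable circle_borel" by (rule continuous_circle_measurable[OF g]) simp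
  have "integrable circ (\<lambda>z. C * (\<bar>ln \<epsilon>\<bar> + W z))" using W_integrable by simp
  then show ?thesis
  proof (rule Bochner_Integration.integrable_bound)
    show "(\<lambda>z. g z * ln (max (W z) \<epsilon>)) \<in> borel_measurable circ"
      using gm unfolding circ_borel_measurable by measurable
    show "AE z in circ. norm (g z * ln (max (W z) \<epsilon>)) \<le> norm (C * (\<bar>ln \<epsilon>\<bar> + W z))"
    proof (rule AE_I2)
      fix z assume "z \<in> space circ"
      have "ln \<epsilon> \<le> ln (max (W z) \<epsilon>)" using \<epsilon> by simp
      moreover have "ln (max (W z) \<epsilon>) \<le> \<bar>ln \<epsilon>\<bar> + W z"
      proof (cases "W z \<le> \<epsilon>")
        case True then show ?thesis using W_nonneg[of z] by (simp add: max_def)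
      next
        case False
        then show ?thesis using \<epsilon> ln_le_minus_one[of "W z"] by (simp add: max_def)
      qed
      ultimately have "\<bar>ln (max (W z) \<epsilon>)\<bar> \<le> \<bar>ln \<epsilon>\<bar> + W z" using W_nonneg[of z] by linarith
      then show "norm (g z * ln (max (W z) \<epsilon>)) \<le> norm (C * (\<bar>ln \<epsilon>\<bar> + W z))"
        using C(2)[of z] C(1) \<open>z \<in> space circ\<close> W_nonneg[of z] by (simp add: abs_mult mult_mono)
    qed
  qed
qed

section \<open>Upper semicontinuity of the entropy\<close>

lemma continuous_ln_bs_density:
  "continuous_on (sphere 0 1) (\<lambda>z. ln (bs_density n z))"
proof (intro continuous_on_ln continuous_bs_density ballI)
  fix z :: complex assume "z \<in> sphere 0 1"
  then show "bs_density n z \<noteq> 0" using bs_density_pos[of z n] by simp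
qed

text \<open>For every continuous \<open>h\<close> the inequality \<open>log v \<le> h + v exp(-h) - 1\<close> bounds \<open>\<integral> g log v\<^sub>n\<close> by
  an expression linear in \<open>v\<^sub>n\<close>, to which weak convergence applies.  In the limit one may
  take for \<open>h\<close> any bounded measurable function \<open>u\<close>: here the logarithm of \<open>W\<close> truncated to
  \<open>[\<epsilon>, M]\<close>, changed to \<open>log M\<close> on the singular set, so that the singular part contributes
  \<open>O(1 / M)\<close> only.\<close>

theorem entropy_limsup_max:
  assumes g: "continuous_on (sphere 0 1) g" and g0: "\<And>z. cmod z = 1 \<Longrightarrow> 0 \<le> g z"
    and \<epsilon>: "0 < \<epsilon>" and e: "0 < e"
  shows "eventually (\<lambda>n. (\<integral>z. g z * ln (bs_density n z) \<partial>circ)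
    \<le> (\<integral>z. g z * ln (max (W z) \<epsilon>) \<partial>circ) + e) sequentially"
proof -
  obtain C where C: "0 < C" "\<And>z. cmod z = 1 \<Longrightarrow> \<bar>g z\<bar> \<le> C" using continuous_bounded_circle[OF g] by blast
  have gC: "g z \<le> C" if "cmod z = 1" for z using C(2)[OF that] by linarith
  \<comment> \<open>\<open>M\<close> and \<open>\<eta>\<close> make the errors \<open>2 * C / M\<close> and \<open>C * (1 + 1 / \<epsilon>) * \<eta>\<close> at most \<open>e / 4\<close> each\<close>
  define M where "M = 1 + \<epsilon> + 8 * C / e"
  have M: "1 \<le> M" "\<epsilon> \<le> M" "C / M \<le> e / 8"
  proof -
    have "0 < 8 * C / e" using C e by simp
    then show "1 \<le> M" "\<epsilon> \<le> M" using \<epsilon> by (auto simp: M_def)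
    have "0 < M" using \<open>1 \<le> M\<close> by simp
    moreover have "C \<le> e / 8 * M" using e \<epsilon> by (simp add: M_def field_simps)
    ultimately show "C / M \<le> e / 8" by (simp add: field_simps)
  qed
  define \<eta> where "\<eta> = e / (4 * C * (1 + 1 / \<epsilon>))"
  have \<eta>: "0 < \<eta>" using e C \<epsilon> by (simp add: \<eta>_def add_pos_pos)
  have "C * \<eta> * (1 + 1 / \<epsilon>) = e / 4"
  proof -
    have "C * (e / (4 * C * K)) * K = e / 4" if "0 < K" for K using that C(1) by (simp add: field_simps)
    moreover have "0 < 1 + 1 / \<epsilon>" using \<epsilon> by (simp add: add_pos_pos)
    ultimately show ?thesis unfolding \<eta>_def .
  qed
  then have \<eta>e: "C * \<eta> + C / \<epsilon> * \<eta> = e / 4" by (simp add: algebra_simps)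
  define cl where "cl z = min M (max (W z) \<epsilon>)" for z
  have cl: "\<epsilon> \<le> cl z" "cl z \<le> M" "0 < cl z" for z using M \<epsilon> by (auto simp: cl_def)
  define u where "u z = (if z \<in> sing_set then ln M else ln (cl z))" for z
  have Sm [measurable]: "sing_set \<in> sets circle_borel" by (rule sing_set(1))
  have clm: "cl \<in> borel_measurable circle_borel" unfolding cl_def by measurable
  have um: "u \<in> borel_measurable circle_borel" unfolding u_def using clm by measurable
  have u: "ln \<epsilon> \<le> u z" "u z \<le> ln M" for z using cl[of z] \<epsilon> M by (auto simp: u_def)
  have gm: "g \<in> borel_measurable circle_borel" by (rule continuous_circle_measurable[OF g]) simp
  note fm = prob_space.finite_measure[OF mu_prob] and fc = prob_space.finite_measure[OF prob_space_circ]
  obtain h where h: "continuous_on (sphere 0 1) h" "\<And>z. ln \<epsilon> \<le> h z" "\<And>z. h z \<le> ln M"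
    "(\<integral>z. \<bar>u z - h z\<bar> \<partial>circ) < \<eta>" "(\<integral>z. \<bar>u z - h z\<bar> \<partial>\<mu>) < \<eta>"
    using continuous_approx_bounded[OF fc fm sets_circ mu_sets um u \<eta>] by blast
  have ub: "\<bar>u z\<bar> \<le> \<bar>ln \<epsilon>\<bar> + \<bar>ln M\<bar>" for z using u[of z] by linarith
  have eu: "exp (- u z) \<le> 1 / \<epsilon>" for z
  proof -
    have "exp (- u z) \<le> exp (- ln \<epsilon>)" using u[of z] by simp
    then show ?thesis using \<epsilon> by (simp add: exp_minus inverse_eq_divide)
  qed
  have eh: "exp (- h z) \<le> 1 / \<epsilon>" for z
  proof -
    have "exp (- h z) \<le> exp (- ln \<epsilon>)" using h(2)[of z] by simp
    then show ?thesis using \<epsilon> by (simp add: exp_minus inverse_eq_divide)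
  qed
  have int_u: "integrable M' u" if "finite_measure M'" "sets M' = sets circle_borel" for M'
    using ub by (intro integrable_bounded_circle[OF that um]) auto
  have int_gu: "integrable circ (\<lambda>z. g z * u z)"
  proof (rule integrable_bounded_circle[OF fc sets_circ])
    show "\<bar>g z * u z\<bar> \<le> C * (\<bar>ln \<epsilon>\<bar> + \<bar>ln M\<bar>)" if "cmod z = 1" for z
      using C(2)[OF that] ub[of z] C(1) by (simp add: abs_mult mult_mono)
  qed (use gm um in measurable)
  have int_ge: "integrable \<mu> (\<lambda>z. g z * exp (- u z))"
  proof (rule integrable_bounded_circle[OF fm mu_sets])
    show "\<bar>g z * exp (- u z)\<bar> \<le> C * (1 / \<epsilon>)" if "cmod z = 1" for z
      using C(2)[OF that] eu[of z] C(1) unfolding abs_mult by (intro mult_mono) auto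
  qed (use gm um in measurable)
  have int_uh: "integrable M' (\<lambda>z. \<bar>u z - h z\<bar>)" if "finite_measure M'" "sets M' = sets circle_borel" for M'
    using int_u[OF that] integrable_continuous_circle[OF that h(1)] by auto

  have step1: "(\<integral>z. g z * h z \<partial>circ) \<le> (\<integral>z. g z * u z \<partial>circ) + C * \<eta>"
  proof -
    have "(\<integral>z. g z * h z \<partial>circ) \<le> (\<integral>z. g z * u z + C * \<bar>u z - h z\<bar> \<partial>circ)"
    proof (rule integral_mono)
      show "integrable circ (\<lambda>z. g z * h z)" by (intro circ_integrable continuous_intros g h)
      show "integrable circ (\<lambda>z. g z * u z + C * \<bar>u z - h z\<bar>)"
        using int_gu int_uh[OF fc sets_circ] by auto
      fix z assume "z \<in> space circ"
      then have z: "cmod z = 1" by simp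
      have "g z * (h z - u z) \<le> g z * \<bar>u z - h z\<bar>" using g0[OF z] by (intro mult_left_mono) auto
      also have "\<dots> \<le> C * \<bar>u z - h z\<bar>" using gC[OF z] by (intro mult_right_mono) auto
      finally show "g z * h z \<le> g z * u z + C * \<bar>u z - h z\<bar>" by (simp add: algebra_simps)
    qed
    also have "\<dots> = (\<integral>z. g z * u z \<partial>circ) + C * (\<integral>z. \<bar>u z - h z\<bar> \<partial>circ)"
      using int_gu int_uh[OF fc sets_circ] by simp
    also have "\<dots> \<le> (\<integral>z. g z * u z \<partial>circ) + C * \<eta>" using h(4) C(1) by simp
    finally show ?thesis .
  qed
  have step2: "(\<integral>z. g z * exp (- h z) \<partial>\<mu>) \<le> (\<integral>z. g z * exp (- u z) \<partial>\<mu>) + C / \<epsilon> * \<eta>"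
  proof -
    have "(\<integral>z. g z * exp (- h z) \<partial>\<mu>) \<le> (\<integral>z. g z * exp (- u z) + C / \<epsilon> * \<bar>u z - h z\<bar> \<partial>\<mu>)"
    proof (rule integral_mono)
      show "integrable \<mu> (\<lambda>z. g z * exp (- h z))" by (intro mu_integrable continuous_intros g h)
      show "integrable \<mu> (\<lambda>z. g z * exp (- u z) + C / \<epsilon> * \<bar>u z - h z\<bar>)"
        using int_ge int_uh[OF fm mu_sets] by auto
      fix z assume "z \<in> space \<mu>"
      then have z: "cmod z = 1" by (simp add: mu_space)
      have "exp (- u z) = exp (- h z) * exp (h z - u z)" by (simp flip: exp_add)
      moreover have "exp (- h z) * (1 + (h z - u z)) \<le> exp (- h z) * exp (h z - u z)"
        by (intro mult_left_mono exp_ge_add_one_self) auto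
      ultimately have "exp (- h z) - exp (- u z) \<le> exp (- h z) * (u z - h z)"
        by (simp add: algebra_simps)
      also have "\<dots> \<le> exp (- h z) * \<bar>u z - h z\<bar>" by (intro mult_left_mono) auto
      also have "\<dots> \<le> 1 / \<epsilon> * \<bar>u z - h z\<bar>" by (intro mult_right_mono eh) auto
      finally have "g z * (exp (- h z) - exp (- u z)) \<le> g z * (1 / \<epsilon> * \<bar>u z - h z\<bar>)"
        using g0[OF z] by (rule mult_left_mono)
      also have "\<dots> \<le> C * (1 / \<epsilon> * \<bar>u z - h z\<bar>)"
        using gC[OF z] \<epsilon> by (intro mult_right_mono) auto
      finally show "g z * exp (- h z) \<le> g z * exp (- u z) + C / \<epsilon> * \<bar>u z - h z\<bar>"
        by (simp add: algebra_simps)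
    qed
    also have "\<dots> = (\<integral>z. g z * exp (- u z) \<partial>\<mu>) + C / \<epsilon> * (\<integral>z. \<bar>u z - h z\<bar> \<partial>\<mu>)"
      using int_ge int_uh[OF fm mu_sets] by simp
    also have "\<dots> \<le> (\<integral>z. g z * exp (- u z) \<partial>\<mu>) + C / \<epsilon> * \<eta>"
      using h(5) C(1) \<epsilon> by (intro add_left_mono mult_left_mono) auto
    finally show ?thesis .
  qed
  have step3: "(\<integral>z. g z * u z \<partial>circ) \<le> (\<integral>z. g z * ln (max (W z) \<epsilon>) \<partial>circ)"
  proof (rule integral_mono_AE[OF int_gu integrable_mult_ln_max[OF g \<epsilon>]])
    have "AE z in circ. z \<in> space circ" by (rule AE_space)
    with sing_set(2) show "AE z in circ. g z * u z \<le> g z * ln (max (W z) \<epsilon>)"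
    proof eventually_elim
      case (elim z)
      have "ln (cl z) \<le> ln (max (W z) \<epsilon>)" using cl(3)[of z] by (simp add: cl_def)
      then show ?case using elim g0[of z] by (simp add: u_def mult_left_mono)
    qed
  qed
  have step4: "(\<integral>z. g z * exp (- u z) \<partial>\<mu>) \<le> (\<integral>z. g z \<partial>circ) + 2 * (C / M)"
  proof -
    have qm: "(\<lambda>z. g z / cl z) \<in> borel_measurable circle_borel" using gm clm by measurable
    have qb: "\<bar>g z / cl z\<bar> \<le> C * (1 / \<epsilon>)" if "cmod z = 1" for z
    proof -
      have "\<bar>g z / cl z\<bar> = \<bar>g z\<bar> * (1 / cl z)" using cl(3)[of z] by simp
      also have "\<dots> \<le> C * (1 / \<epsilon>)"
        using C(2)[OF that] C(1) cl[of z] \<epsilon> by (intro mult_mono) (auto simp: field_simps)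
      finally show ?thesis .
    qed
    have iq: "integrable \<mu> (\<lambda>z. indicator (- sing_set) z * (g z / cl z))"
    proof (rule integrable_bounded_circle[OF fm mu_sets])
      show "\<bar>indicator (- sing_set) z * (g z / cl z)\<bar> \<le> C * (1 / \<epsilon>)" if "cmod z = 1" for z
        using qb[OF that] C(1) \<epsilon> by (auto simp: indicator_def)
    qed (use qm in measurable)
    have iq': "integrable circ (\<lambda>z. W z * (g z / cl z))" using iq integral_off_sing_set(2)[OF qm] by simp
    have "(\<integral>z. g z * exp (- u z) \<partial>\<mu>) \<le> (\<integral>z. C / M + indicator (- sing_set) z * (g z / cl z) \<partial>\<mu>)"
    proof (rule integral_mono[OF int_ge])
      show "integrable \<mu> (\<lambda>z. C / M + indicator (- sing_set) z * (g z / cl z))"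
        by (rule Bochner_Integration.integrable_add[OF finite_measure.integrable_const[OF fm] iq])
      fix z assume "z \<in> space \<mu>"
      then have z: "cmod z = 1" by (simp add: mu_space)
      show "g z * exp (- u z) \<le> C / M + indicator (- sing_set) z * (g z / cl z)"
      proof (cases "z \<in> sing_set")
        case True
        then have "exp (- u z) = 1 / M" using M(1) by (simp add: u_def exp_minus inverse_eq_divide)
        moreover have "g z * (1 / M) \<le> C * (1 / M)"
          using gC[OF z] M(1) by (intro mult_right_mono) auto
        ultimately show ?thesis using True by simp
      next
        case False
        then have "exp (- u z) = 1 / cl z" using cl(3)[of z] by (simp add: u_def exp_minus inverse_eq_divide)
        moreover have "0 \<le> C / M" using M C(1) by simp
        ultimately show ?thesis using False by simp
      qed
    qed
    also have "\<dots> = C / M + (\<integral>z. indicator (- sing_set) z * (g z / cl z) \<partial>\<mu>)"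
      unfolding Bochner_Integration.integral_add[OF finite_measure.integrable_const[OF fm] iq]
      using prob_space.prob_space[OF mu_prob] by simp
    also have "(\<integral>z. indicator (- sing_set) z * (g z / cl z) \<partial>\<mu>) = (\<integral>z. W z * (g z / cl z) \<partial>circ)"
      by (rule integral_off_sing_set(1)[OF qm])
    also have "\<dots> \<le> (\<integral>z. g z + C / M * W z \<partial>circ)"
    proof (rule integral_mono[OF iq'])
      show "integrable circ (\<lambda>z. g z + C / M * W z)" using circ_integrable[OF g] W_integrable by auto
      fix z assume "z \<in> space circ"
      then have z: "cmod z = 1" by simp
      have CW: "0 \<le> C / M * W z" using M C(1) W_nonneg[of z] by simp
      show "W z * (g z / cl z) \<le> g z + C / M * W z"
      proof (cases "W z \<le> M")
        case True
        then have "W z \<le> cl z" by (simp add: cl_def)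
        then have "W z / cl z \<le> 1" using cl(3)[of z] by simp
        then have "g z * (W z / cl z) \<le> g z * 1" using g0[OF z] by (rule mult_left_mono)
        then show ?thesis using CW by (simp add: mult.commute)
      next
        case False
        then have "cl z = M" using M by (simp add: cl_def)
        moreover have "g z / M \<le> C / M" using gC[OF z] M by (simp add: divide_right_mono)
        then have "W z * (g z / M) \<le> W z * (C / M)" using W_nonneg by (rule mult_left_mono)
        ultimately show ?thesis using g0[OF z] by (simp add: mult.commute)
      qed
    qed
    also have "\<dots> = (\<integral>z. g z \<partial>circ) + C / M * (\<integral>z. W z \<partial>circ)"
      using circ_integrable[OF g] W_integrable by simp
    also have "\<dots> \<le> (\<integral>z. g z \<partial>circ) + C / M * 1"
      using integral_W_le_1 M C(1) by (intro add_left_mono mult_left_mono) auto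
    finally show ?thesis by simp
  qed

  have "(\<lambda>n. \<integral>z. (g z * exp (- h z)) * bs_density n z \<partial>circ) \<longlonglongrightarrow> (\<integral>z. g z * exp (- h z) \<partial>\<mu>)"
    by (intro bs_weak_convergence continuous_intros g h)
  then have "eventually (\<lambda>n. (\<integral>z. (g z * exp (- h z)) * bs_density n z \<partial>circ)
      < (\<integral>z. g z * exp (- h z) \<partial>\<mu>) + e / 4) sequentially"
    using e by (intro order_tendstoD(2)[where a = "_ + e / 4"]) auto
  then show ?thesis
  proof eventually_elim
    case (elim n)
    have "(\<integral>z. g z * ln (bs_density n z) \<partial>circ)
        \<le> (\<integral>z. g z * h z + (g z * exp (- h z)) * bs_density n z - g z \<partial>circ)"
    proof (rule integral_mono)
      show "integrable circ (\<lambda>z. g z * ln (bs_density n z))"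
        by (intro circ_integrable continuous_on_mult g continuous_ln_bs_density)
      show "integrable circ (\<lambda>z. g z * h z + (g z * exp (- h z)) * bs_density n z - g z)"
        by (intro circ_integrable continuous_intros g h)
      fix z assume "z \<in> space circ"
      then have z: "cmod z = 1" by simp
      let ?v = "bs_density n z"
      have v: "0 < ?v" by (rule bs_density_pos[OF z])
      have "ln (?v * exp (- h z)) \<le> ?v * exp (- h z) - 1" using v by (intro ln_le_minus_one) simp
      then have "ln ?v \<le> h z + exp (- h z) * ?v - 1" using v by (simp add: ln_mult mult.commute)
      then have "g z * ln ?v \<le> g z * (h z + exp (- h z) * ?v - 1)" using g0[OF z] by (rule mult_left_mono)
      then show "g z * ln ?v \<le> g z * h z + (g z * exp (- h z)) * ?v - g z" by (simp add: algebra_simps)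
    qed
    also have "\<dots> = (\<integral>z. g z * h z \<partial>circ) + (\<integral>z. (g z * exp (- h z)) * bs_density n z \<partial>circ) - (\<integral>z. g z \<partial>circ)"
    proof -
      have i: "integrable circ (\<lambda>z. g z * h z)" "integrable circ (\<lambda>z. (g z * exp (- h z)) * bs_density n z)"
        "integrable circ g"
        by (intro circ_integrable continuous_intros g h)+
      have "(\<integral>z. g z * h z + (g z * exp (- h z)) * bs_density n z - g z \<partial>circ)
        = (\<integral>z. g z * h z + (g z * exp (- h z)) * bs_density n z \<partial>circ) - (\<integral>z. g z \<partial>circ)"
        by (intro Bochner_Integration.integral_diff Bochner_Integration.integrable_add i)
      then show ?thesis by (simp only: Bochner_Integration.integral_add[OF i(1,2)])
    qed
    finally show ?case using elim step1 step2 step3 step4 \<eta>e M(3) e by linarith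
  qed
qed

end

lemma tendsto_inverse_Suc: "(\<lambda>i. 1 / real (Suc i)) \<longlonglongrightarrow> 0"
  using LIMSEQ_inverse_real_of_nat by (simp add: inverse_eq_divide)

text \<open>The entropy \<open>x - 1 - ln x\<close> dominates \<open>(sqrt x - 1)\<^sup>2\<close> for \<open>x > 0\<close>, and
  \<open>x - 1 = (sqrt x - 1) (sqrt x + 1)\<close>.\<close>

lemma sub_one_le_entropy:
  fixes x t :: real
  assumes x: "0 < x" and t: "0 < t"
  shows "x - 1 \<le> (x - 1 - ln x) / t + t * (x + 1)"
proof -
  define s where "s = sqrt x"
  have s: "0 < s" "x = s\<^sup>2" using x by (auto simp: s_def)
  have "ln x = 2 * ln s" using s by (simp add: ln_realpow)
  then have y: "(s - 1)\<^sup>2 \<le> x - 1 - ln x"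
    using ln_le_minus_one[OF s(1)] s(2) by (simp add: power2_eq_square algebra_simps)
  have "0 \<le> ((s - 1) - t * (s + 1))\<^sup>2" by simp
  then have "2 * t * (x - 1) \<le> (s - 1)\<^sup>2 + t\<^sup>2 * (s + 1)\<^sup>2"
    using s(2) by (simp add: power2_eq_square algebra_simps)
  also have "\<dots> \<le> 2 * (x - 1 - ln x) + t\<^sup>2 * (2 * (x + 1))"
  proof (intro add_mono mult_left_mono)
    have "u \<le> 2 * v" if "u \<le> v" "0 \<le> u" for u v :: real using that by linarith
    from this[OF y] show "(s - 1)\<^sup>2 \<le> 2 * (x - 1 - ln x)" by simp
    show "(s + 1)\<^sup>2 \<le> 2 * (x + 1)"
      using s(2) zero_le_power2[of "s - 1"] by (simp add: power2_eq_square algebra_simps)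
  qed simp
  finally have "t * (x - 1) \<le> (x - 1 - ln x) + t * (t * (x + 1))"
    by (simp add: power2_eq_square algebra_simps)
  then have "t * (x - 1) / t \<le> ((x - 1 - ln x) + t * (t * (x + 1))) / t"
    using t by (intro divide_right_mono) auto
  then show ?thesis using t by (simp add: add_divide_distrib)
qed

lemma nn_integral_angle_circ:
  assumes F: "F \<in> borel_measurable circle_borel"
  shows "(\<integral>\<^sup>+\<theta>. F (cis \<theta>) \<partial>density angle_lebesgue (\<lambda>_. ennreal (1 / (4 * pi)))) = ennreal (1 / 2) * (\<integral>\<^sup>+z. F z \<partial>circ)"
proof -
  have s: "sets angle_lebesgue = sets angle_measure" by (simp add: angle_measure_def)
  have Fc: "(\<lambda>\<theta>. F (cis \<theta>)) \<in> borel_measurable angle_lebesgue"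
    using measurable_compose[OF cis_measurable F] by (simp add: measurable_cong_sets[OF s refl])
  have c: "ennreal (1 / (4 * pi)) = ennreal (1 / 2) * ennreal (1 / (2 * pi))"
  proof -
    have "ennreal (1 / 2) * ennreal (1 / (2 * pi)) = ennreal (1 / 2 * (1 / (2 * pi)))"
      by (rule ennreal_mult[symmetric]) auto
    then show ?thesis by (simp only: times_divide_times_eq) simp
  qed
  have "(\<integral>\<^sup>+\<theta>. F (cis \<theta>) \<partial>density angle_lebesgue (\<lambda>_. ennreal (1 / (4 * pi))))
      = ennreal (1 / 2) * (ennreal (1 / (2 * pi)) * (\<integral>\<^sup>+\<theta>. F (cis \<theta>) \<partial>angle_lebesgue))"
    using Fc by (simp add: nn_integral_density nn_integral_cmult c mult.assoc)
  also have "ennreal (1 / (2 * pi)) * (\<integral>\<^sup>+\<theta>. F (cis \<theta>) \<partial>angle_lebesgue) = (\<integral>\<^sup>+\<theta>. F (cis \<theta>) \<partial>angle_measure)"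
    unfolding angle_measure_def using Fc by (simp add: nn_integral_density nn_integral_cmult)
  also have "\<dots> = (\<integral>\<^sup>+z. F z \<partial>circ)"
    unfolding circ_def using F by (intro nn_integral_distr[symmetric]) auto
  finally show ?thesis .
qed

lemma log_ext_measurable [measurable]: "log_ext \<in> borel_measurable borel"
  unfolding log_ext_def by measurable

context circle_ac
begin

lemma entropy_limsup:
  assumes g: "continuous_on (sphere 0 1) g" and g0: "\<And>z. cmod z = 1 \<Longrightarrow> 0 \<le> g z"
    and W: "AE z in circ. 0 < W z" and int: "integrable circ (\<lambda>z. g z * ln (W z))" and e: "0 < e"
  shows "eventually (\<lambda>n. (\<integral>z. g z * ln (bs_density n z) \<partial>circ)
    \<le> (\<integral>z. g z * ln (W z) \<partial>circ) + e) sequentially"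
proof -
  let ?\<epsilon> = "\<lambda>i. 1 / real (Suc i)"
  have gm: "g \<in> borel_measurable circle_borel" by (rule continuous_circle_measurable[OF g]) simp
  have "(\<lambda>i. \<integral>z. g z * ln (max (W z) (?\<epsilon> i)) \<partial>circ) \<longlonglongrightarrow> (\<integral>z. g z * ln (W z) \<partial>circ)"
  proof (rule integral_dominated_convergence[where w = "\<lambda>z. \<bar>g z * ln (W z)\<bar>"])
    show "(\<lambda>z. g z * ln (max (W z) (?\<epsilon> i))) \<in> borel_measurable circ" for i
      using gm unfolding circ_borel_measurable by measurable
    show "(\<lambda>z. g z * ln (W z)) \<in> borel_measurable circ" using int by simp
    show "integrable circ (\<lambda>z. \<bar>g z * ln (W z)\<bar>)" using int by simp
    show "AE z in circ. (\<lambda>i. g z * ln (max (W z) (?\<epsilon> i))) \<longlonglongrightarrow> g z * ln (W z)"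
      using W
    proof eventually_elim
      case (elim z)
      have "(\<lambda>i. max (W z) (?\<epsilon> i)) \<longlonglongrightarrow> max (W z) 0"
        by (intro tendsto_max tendsto_const tendsto_inverse_Suc)
      then have "(\<lambda>i. max (W z) (?\<epsilon> i)) \<longlonglongrightarrow> W z" using elim by (simp add: max_def)
      then show ?case using elim by (intro tendsto_intros) auto
    qed
    show "AE z in circ. norm (g z * ln (max (W z) (?\<epsilon> i))) \<le> \<bar>g z * ln (W z)\<bar>" for i
      using W
    proof eventually_elim
      case (elim z)
      have "\<bar>ln (max (W z) (?\<epsilon> i))\<bar> \<le> \<bar>ln (W z)\<bar>"
      proof (cases "?\<epsilon> i \<le> W z")
        case False
        then have "max (W z) (?\<epsilon> i) = ?\<epsilon> i" by simp
        moreover have "ln (W z) \<le> ln (?\<epsilon> i)" "ln (?\<epsilon> i) \<le> 0" using False elim by auto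
        ultimately show ?thesis by simp
      qed (simp add: max_def)
      then show ?case by (simp add: abs_mult mult_left_mono)
    qed
  qed
  then have "eventually (\<lambda>i. (\<integral>z. g z * ln (max (W z) (?\<epsilon> i)) \<partial>circ) < (\<integral>z. g z * ln (W z) \<partial>circ) + e / 2) sequentially"
    using e by (intro order_tendstoD(2)[where a = "_ + e / 2"]) auto
  then obtain i where i: "(\<integral>z. g z * ln (max (W z) (?\<epsilon> i)) \<partial>circ) < (\<integral>z. g z * ln (W z) \<partial>circ) + e / 2"
    by (auto simp: eventually_sequentially)
  have "eventually (\<lambda>n. (\<integral>z. g z * ln (bs_density n z) \<partial>circ)
    \<le> (\<integral>z. g z * ln (max (W z) (?\<epsilon> i)) \<partial>circ) + e / 2) sequentially"
    using e by (intro entropy_limsup_max g g0) auto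
  then show ?thesis by eventually_elim (use i in linarith)
qed

section \<open>Lower semicontinuity\<close>

lemma integral_W_div_density:
  "integrable circ (\<lambda>z. W z / bs_density n z)" "(\<integral>z. W z / bs_density n z \<partial>circ) \<le> 1"
proof -
  let ?K = "poly_norm2 \<mu> (szego_poly (verblunsky_nat \<mu>) n)"
  let ?f = "\<lambda>z. (cmod (poly (szego_poly (verblunsky_nat \<mu>) n) z))\<^sup>2 / ?K"
  have K: "0 < ?K" by (intro poly_norm2_pos szego_poly_nonzero)
  have f: "continuous_on (sphere 0 1) ?f" using K by (intro continuous_intros) auto
  have f0: "0 \<le> ?f z" for z using K by simp
  have eq: "W z / bs_density n z = W z * ?f z" for z by (simp add: bs_density_def)
  have "(\<integral>z. ?f z \<partial>\<mu>) = 1" using K by (simp add: poly_norm2_def)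
  then show "integrable circ (\<lambda>z. W z / bs_density n z)" "(\<integral>z. W z / bs_density n z \<partial>circ) \<le> 1"
    unfolding eq using integral_W_le[OF f f0] by simp_all
qed

text \<open>Put \<open>x\<^sub>n = W / v\<^sub>n\<close>, so that \<open>\<integral> x\<^sub>n \<le> 1\<close>.  For \<open>g = G / (G + \<delta>)\<close>, whose integral is close to \<open>1\<close>,
  upper semicontinuity shows that \<open>\<integral> g (x\<^sub>n - 1 - log x\<^sub>n)\<close> is small.  This non-negative integrand
  controls \<open>G (x\<^sub>n - 1)\<close>, an upper bound for \<open>G log x\<^sub>n\<close>, because \<open>G\<close> is at most a multiple
  of \<open>g\<close>.\<close>

theorem entropy_liminf:
  assumes G: "continuous_on (sphere 0 1) G" and G0: "\<And>z. cmod z = 1 \<Longrightarrow> 0 \<le> G z"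
    and Gpos: "AE z in circ. 0 < G z"
    and W: "AE z in circ. 0 < W z" and int: "integrable circ (\<lambda>z. G z * ln (W z))" and e: "0 < e"
  shows "eventually (\<lambda>n. (\<integral>z. G z * ln (W z) \<partial>circ) - e
    \<le> (\<integral>z. G z * ln (bs_density n z) \<partial>circ)) sequentially"
proof -
  obtain C where C: "0 < C" "\<And>z. cmod z = 1 \<Longrightarrow> \<bar>G z\<bar> \<le> C" using continuous_bounded_circle[OF G] by blast
  have Gm: "G \<in> borel_measurable circle_borel" by (rule continuous_circle_measurable[OF G]) simp
  \<comment> \<open>\<open>t\<close> and \<open>\<kappa>\<close> make \<open>2 * t * C'\<close> and \<open>2 * \<kappa> * C' / t\<close> sum up to less than \<open>e\<close>\<close>
  define C' where "C' = C + 1"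
  define t where "t = e / (8 * C')"
  have C': "0 < C'" and t: "0 < t" using C e by (auto simp: C'_def t_def)
  define g where "g \<delta> z = G z / (G z + \<delta>)" for \<delta> z
  let ?\<delta> = "\<lambda>i. 1 / real (Suc i)"
  have contg: "continuous_on (sphere 0 1) (g (?\<delta> i))" for i
  proof -
    have "\<forall>z\<in>sphere 0 1. G z + ?\<delta> i \<noteq> 0"
    proof
      fix z :: complex assume "z \<in> sphere 0 1"
      then have "0 < G z + ?\<delta> i" using G0[of z] by (intro add_nonneg_pos) auto
      then show "G z + ?\<delta> i \<noteq> 0" by simp
    qed
    then show ?thesis unfolding g_def by (intro continuous_intros G) auto
  qed
  have g01: "0 \<le> g (?\<delta> i) z" "g (?\<delta> i) z \<le> 1" if "cmod z = 1" for i z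
  proof -
    have "0 < G z + ?\<delta> i" using G0[OF that] by (intro add_nonneg_pos) auto
    then show "0 \<le> g (?\<delta> i) z" "g (?\<delta> i) z \<le> 1"
      using G0[OF that] unfolding g_def by (simp_all only: divide_le_eq_1_pos divide_nonneg_pos) simp
  qed
  have "(\<lambda>i. \<integral>z. g (?\<delta> i) z \<partial>circ) \<longlonglongrightarrow> (\<integral>z. 1 \<partial>circ)"
  proof (rule integral_dominated_convergence[where w = "\<lambda>_. 1"])
    show "AE z in circ. (\<lambda>i. g (?\<delta> i) z) \<longlonglongrightarrow> 1" using Gpos
    proof eventually_elim
      case (elim z)
      have "(\<lambda>i. G z / (G z + ?\<delta> i)) \<longlonglongrightarrow> G z / (G z + 0)"
        using elim by (intro tendsto_intros tendsto_inverse_Suc) auto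
      then show ?case using elim by (simp add: g_def)
    qed
    show "AE z in circ. norm (g (?\<delta> i) z) \<le> 1" for i
      using g01 by (intro AE_I2) auto
    show "g (?\<delta> i) \<in> borel_measurable circ" for i
      by (rule continuous_circle_measurable[OF contg]) simp
  qed auto
  then have "(\<lambda>i. \<integral>z. g (?\<delta> i) z \<partial>circ) \<longlonglongrightarrow> 1" using circ.prob_space by simp
  moreover define \<kappa> where "\<kappa> = t * e / (4 * C')"
  moreover have \<kappa>: "0 < \<kappa>" using t e C' by (simp add: \<kappa>_def)
  ultimately have "eventually (\<lambda>i. 1 - \<kappa> < (\<integral>z. g (?\<delta> i) z \<partial>circ)) sequentially"
    by (intro order_tendstoD(1)) auto
  then obtain i where i: "1 - \<kappa> < (\<integral>z. g (?\<delta> i) z \<partial>circ)" by (auto simp: eventually_sequentially)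
  let ?g = "g (?\<delta> i)"
  have gm: "?g \<in> borel_measurable circle_borel" by (rule continuous_circle_measurable[OF contg]) simp
  have ig: "integrable circ ?g" by (rule circ_integrable[OF contg])
  have intg: "integrable circ (\<lambda>z. ?g z * ln (W z))"
  proof (rule Bochner_Integration.integrable_bound)
    show "integrable circ (\<lambda>z. real (Suc i) * (G z * ln (W z)))" using int by simp
    show "(\<lambda>z. ?g z * ln (W z)) \<in> borel_measurable circ"
      using gm unfolding circ_borel_measurable by measurable
    show "AE z in circ. norm (?g z * ln (W z)) \<le> norm (real (Suc i) * (G z * ln (W z)))"
    proof (rule AE_I2)
      fix z assume "z \<in> space circ"
      then have z: "cmod z = 1" by simp
      have "?g z = real (Suc i) * G z / (real (Suc i) * G z + 1)"
        using G0[OF z] by (simp add: g_def field_simps)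
      also have "\<dots> \<le> real (Suc i) * G z / 1"
      proof (rule divide_left_mono)
        have "0 \<le> real (Suc i) * G z" using G0[OF z] by (intro mult_nonneg_nonneg) auto
        then show "1 \<le> real (Suc i) * G z + 1" "0 \<le> real (Suc i) * G z"
          "0 < (real (Suc i) * G z + 1) * 1" by auto
      qed
      finally have "?g z \<le> real (Suc i) * G z" by simp
      then have "\<bar>?g z\<bar> * \<bar>ln (W z)\<bar> \<le> (real (Suc i) * \<bar>G z\<bar>) * \<bar>ln (W z)\<bar>"
        using g01[OF z] G0[OF z] by (intro mult_right_mono) auto
      then show "norm (?g z * ln (W z)) \<le> norm (real (Suc i) * (G z * ln (W z)))"
        by (simp add: abs_mult mult.assoc)
    qed
  qed
  have "eventually (\<lambda>n. (\<integral>z. ?g z * ln (bs_density n z) \<partial>circ)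
    \<le> (\<integral>z. ?g z * ln (W z) \<partial>circ) + \<kappa>) sequentially"
    by (rule entropy_limsup[OF contg _ W intg \<kappa>]) (rule g01)
  then show ?thesis
  proof eventually_elim
    case (elim n)
    define x where "x z = W z / bs_density n z" for z
    have ix: "integrable circ x" "(\<integral>z. x z \<partial>circ) \<le> 1"
      using integral_W_div_density[of n] by (simp_all add: x_def[abs_def])
    have ivG: "integrable circ (\<lambda>z. G z * ln (bs_density n z))"
      and ivg: "integrable circ (\<lambda>z. ?g z * ln (bs_density n z))"
      by (intro circ_integrable continuous_on_mult G contg continuous_ln_bs_density)+
    have xpos: "AE z in circ. 0 < x z \<and> ln (x z) = ln (W z) - ln (bs_density n z) \<and> cmod z = 1"
      using W AE_space
    proof eventually_elim
      case (elim z)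
      then show ?case using bs_density_pos[of z n] by (simp add: x_def ln_div)
    qed
    have xm: "x \<in> borel_measurable circ" using ix(1) by simp
    have igx: "integrable circ (\<lambda>z. ?g z * x z)"
    proof (rule Bochner_Integration.integrable_bound[OF ix(1)])
      show "(\<lambda>z. ?g z * x z) \<in> borel_measurable circ"
        using gm xm by (simp add: circ_borel_measurable)
      show "AE z in circ. norm (?g z * x z) \<le> norm (x z)"
        using g01 by (intro AE_I2) (auto simp: abs_mult mult_left_le_one_le)
    qed
    let ?y = "\<lambda>z. ?g z * x z - ?g z - (?g z * ln (W z) - ?g z * ln (bs_density n z))"
    have iy: "integrable circ ?y"
      by (intro Bochner_Integration.integrable_diff igx ig intg ivg)
    have "(\<integral>z. ?y z \<partial>circ) = (\<integral>z. ?g z * x z \<partial>circ) - (\<integral>z. ?g z \<partial>circ)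
        - ((\<integral>z. ?g z * ln (W z) \<partial>circ) - (\<integral>z. ?g z * ln (bs_density n z) \<partial>circ))"
      unfolding Bochner_Integration.integral_diff[OF Bochner_Integration.integrable_diff[OF igx ig]
          Bochner_Integration.integrable_diff[OF intg ivg]]
        Bochner_Integration.integral_diff[OF igx ig] Bochner_Integration.integral_diff[OF intg ivg] ..
    also have "(\<integral>z. ?g z * x z \<partial>circ) \<le> (\<integral>z. x z \<partial>circ)"
    proof (rule integral_mono_AE[OF igx ix(1)])
      show "AE z in circ. ?g z * x z \<le> x z" using xpos
        by eventually_elim (use g01 in \<open>auto simp: mult_left_le_one_le\<close>)
    qed
    finally have Y: "(\<integral>z. ?y z \<partial>circ) \<le> 2 * \<kappa>" using ix(2) i elim by linarith
    have "(\<integral>z. G z * ln (W z) - G z * ln (bs_density n z) \<partial>circ)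
        \<le> (\<integral>z. C' / t * ?y z + t * C' * (x z + 1) \<partial>circ)"
    proof (rule integral_mono_AE)
      show "integrable circ (\<lambda>z. G z * ln (W z) - G z * ln (bs_density n z))"
        by (intro Bochner_Integration.integrable_diff int ivG)
      show "integrable circ (\<lambda>z. C' / t * ?y z + t * C' * (x z + 1))"
        using iy ix(1) by (intro Bochner_Integration.integrable_add Bochner_Integration.integrable_mult_right) auto
      show "AE z in circ. G z * ln (W z) - G z * ln (bs_density n z) \<le> C' / t * ?y z + t * C' * (x z + 1)"
        using xpos
      proof eventually_elim
        case (elim z)
        then have z: "cmod z = 1" and x: "0 < x z" and l: "ln (x z) = ln (W z) - ln (bs_density n z)" by auto
        let ?e = "x z - 1 - ln (x z)"
        have ye: "?y z = ?g z * ?e" unfolding l by (simp add: algebra_simps)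
        have e0: "0 \<le> ?e" using ln_le_minus_one[OF x] by simp
        have "0 < G z + ?\<delta> i" using G0[OF z] by (intro add_nonneg_pos) auto
        then have "G z = (G z + ?\<delta> i) * ?g z" by (simp add: g_def)
        also have "\<dots> \<le> C' * ?g z"
        proof -
          have "?\<delta> i \<le> 1" by simp
          then have "G z + ?\<delta> i \<le> C'" using C(2)[OF z] unfolding C'_def by linarith
          then show ?thesis using g01[OF z] by (intro mult_right_mono) auto
        qed
        finally have Gg: "G z \<le> C' * ?g z" .
        have "G z * ln (W z) - G z * ln (bs_density n z) = G z * ln (x z)"
          unfolding l by (simp add: right_diff_distrib)
        also have "\<dots> \<le> G z * (?e / t + t * (x z + 1))"
          using sub_one_le_entropy[OF x t] e0 G0[OF z] by (intro mult_left_mono) linarith+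
        also have "\<dots> = G z * (?e / t) + G z * (t * (x z + 1))" by (simp add: distrib_left)
        also have "\<dots> \<le> (C' * ?g z) * (?e / t) + C' * (t * (x z + 1))"
        proof (intro add_mono mult_right_mono Gg)
          show "G z \<le> C'" using C(2)[OF z] by (simp add: C'_def)
        qed (use e0 t x in auto)
        finally show ?case unfolding ye by (simp add: mult_ac)
      qed
    qed
    also have "\<dots> = C' / t * (\<integral>z. ?y z \<partial>circ) + t * C' * ((\<integral>z. x z \<partial>circ) + 1)"
    proof -
      have "(\<integral>z. C' / t * ?y z + t * C' * (x z + 1) \<partial>circ)
          = (\<integral>z. C' / t * ?y z \<partial>circ) + (\<integral>z. t * C' * (x z + 1) \<partial>circ)"
        using ix(1) by (intro Bochner_Integration.integral_add Bochner_Integration.integrable_mult_right iy) auto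
      also have "(\<integral>z. t * C' * (x z + 1) \<partial>circ) = t * C' * ((\<integral>z. x z \<partial>circ) + 1)"
        using ix(1) circ.prob_space by simp
      finally show ?thesis by (simp only: Bochner_Integration.integral_mult_right_zero)
    qed
    also have "\<dots> \<le> C' / t * (2 * \<kappa>) + t * C' * 2"
      using Y ix(2) C' t by (intro add_mono mult_left_mono) auto
    also have "\<dots> = 3 * e / 4"
      using C' t by (simp add: \<kappa>_def) (simp add: t_def)
    finally have "(\<integral>z. G z * ln (W z) \<partial>circ) - (\<integral>z. G z * ln (bs_density n z) \<partial>circ) \<le> 3 * e / 4"
      using int ivG by simp
    then show ?case using e by linarith
  qed
qed

corollary entropy_limit:
  assumes G: "continuous_on (sphere 0 1) G" and G0: "\<And>z. cmod z = 1 \<Longrightarrow> 0 \<le> G z"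
    and Gpos: "AE z in circ. 0 < G z"
    and W: "AE z in circ. 0 < W z" and int: "integrable circ (\<lambda>z. G z * ln (W z))"
  shows "(\<lambda>n. \<integral>z. G z * ln (bs_density n z) \<partial>circ) \<longlonglongrightarrow> (\<integral>z. G z * ln (W z) \<partial>circ)"
proof (rule LIMSEQ_I)
  fix e :: real assume "0 < e"
  then have e: "0 < e / 2" by simp
  have "eventually (\<lambda>n. (\<integral>z. G z * ln (bs_density n z) \<partial>circ) \<le> (\<integral>z. G z * ln (W z) \<partial>circ) + e / 2) sequentially"
    by (rule entropy_limsup[OF G _ W int e]) (rule G0)
  moreover have "eventually (\<lambda>n. (\<integral>z. G z * ln (W z) \<partial>circ) - e / 2 \<le> (\<integral>z. G z * ln (bs_density n z) \<partial>circ)) sequentially"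
    by (rule entropy_liminf[OF G _ Gpos W int e]) (rule G0)
  ultimately have "eventually (\<lambda>n. norm ((\<integral>z. G z * ln (bs_density n z) \<partial>circ) - (\<integral>z. G z * ln (W z) \<partial>circ)) < e) sequentially"
    by eventually_elim (use \<open>0 < e\<close> in \<open>simp add: abs_less_iff\<close>)
  then show "\<exists>no. \<forall>n\<ge>no. norm ((\<integral>z. G z * ln (bs_density n z) \<partial>circ) - (\<integral>z. G z * ln (W z) \<partial>circ)) < e"
    by (simp add: eventually_sequentially)
qed

section \<open>The functional as an integral over the circle\<close>

text \<open>The integrals of the positive and the negative part of \<open>G log W\<close>, where \<open>log 0 = -\<infinity>\<close>.\<close>

definition entropy_pos :: "(complex \<Rightarrow> real) \<Rightarrow> ennreal" where
  "entropy_pos G = (\<integral>\<^sup>+z. e2ennreal (ereal (G z) * log_ext (W z)) \<partial>circ)"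

definition entropy_neg :: "(complex \<Rightarrow> real) \<Rightarrow> ennreal" where
  "entropy_neg G = (\<integral>\<^sup>+z. e2ennreal (- (ereal (G z) * log_ext (W z))) \<partial>circ)"

lemma Z_functional_circ:
  assumes Q: "continuous_on (sphere 0 1) Q"
  defines "G \<equiv> \<lambda>z. (cmod (Q z))\<^sup>2"
  shows "Z_functional Q w = enn2ereal (ennreal (1 / 2) * entropy_pos G) - enn2ereal (ennreal (1 / 2) * entropy_neg G)"
proof -
  have "continuous_on (sphere 0 1) G" unfolding G_def by (intro continuous_intros Q)
  then have Gm: "G \<in> borel_measurable circle_borel" by (rule continuous_circle_measurable) simp
  have sp: "space (density angle_lebesgue (\<lambda>_. ennreal (1 / (4 * pi)))) = {0..<2 * pi}"
    by (simp add: space_restrict_space)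
  have m1: "(\<lambda>z. e2ennreal (ereal (G z) * log_ext (W z))) \<in> borel_measurable circle_borel"
    and m2: "(\<lambda>z. e2ennreal (- (ereal (G z) * log_ext (W z)))) \<in> borel_measurable circle_borel"
    using Gm by measurable
  have "(\<integral>\<^sup>+\<theta>. e2ennreal (ereal ((cmod (Q (cis \<theta>)))\<^sup>2) * log_ext (w \<theta>)) \<partial>density angle_lebesgue (\<lambda>_. ennreal (1 / (4 * pi))))
      = (\<integral>\<^sup>+\<theta>. e2ennreal (ereal (G (cis \<theta>)) * log_ext (W (cis \<theta>))) \<partial>density angle_lebesgue (\<lambda>_. ennreal (1 / (4 * pi))))"
    by (rule nn_integral_cong) (simp only: sp W_cis G_def)
  moreover have "(\<integral>\<^sup>+\<theta>. e2ennreal (- (ereal ((cmod (Q (cis \<theta>)))\<^sup>2) * log_ext (w \<theta>))) \<partial>density angle_lebesgue (\<lambda>_. ennreal (1 / (4 * pi))))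
      = (\<integral>\<^sup>+\<theta>. e2ennreal (- (ereal (G (cis \<theta>)) * log_ext (W (cis \<theta>)))) \<partial>density angle_lebesgue (\<lambda>_. ennreal (1 / (4 * pi))))"
    by (rule nn_integral_cong) (simp only: sp W_cis G_def)
  ultimately show ?thesis
    unfolding Z_functional_def ereal_integral_def entropy_pos_def entropy_neg_def
    by (simp only: nn_integral_angle_circ[OF m1] nn_integral_angle_circ[OF m2])
qed

lemma entropy_pos_finite:
  assumes G: "continuous_on (sphere 0 1) G" and G0: "\<And>z. cmod z = 1 \<Longrightarrow> 0 \<le> G z"
  shows "entropy_pos G < \<infinity>"
proof -
  obtain C where C: "0 < C" "\<And>z. cmod z = 1 \<Longrightarrow> \<bar>G z\<bar> \<le> C" using continuous_bounded_circle[OF G] by blast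
  have "entropy_pos G \<le> (\<integral>\<^sup>+z. ennreal (C * W z) \<partial>circ)"
    unfolding entropy_pos_def
  proof (rule nn_integral_mono)
    fix z assume "z \<in> space circ"
    then have z: "cmod z = 1" by simp
    show "e2ennreal (ereal (G z) * log_ext (W z)) \<le> ennreal (C * W z)"
    proof (cases "W z = 0")
      case True
      then have "ereal (G z) * log_ext (W z) \<le> 0" using G0[OF z] by (auto simp: log_ext_def)
      then show ?thesis by (simp add: e2ennreal_neg)
    next
      case False
      then have W: "0 < W z" using W_nonneg[of z] by simp
      have "G z * ln (W z) \<le> G z * W z"
        using ln_le_minus_one[OF W] G0[OF z] by (intro mult_left_mono) auto
      also have "\<dots> \<le> C * W z" using C(2)[OF z] W by (intro mult_right_mono) auto
      finally have "ennreal (G z * ln (W z)) \<le> ennreal (C * W z)" by (rule ennreal_leI)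
      then show ?thesis using False by (simp add: log_ext_def)
    qed
  qed
  also have "\<dots> = ennreal (\<integral>z. C * W z \<partial>circ)"
    using W_integrable W_nonneg C(1) by (intro nn_integral_eq_integral) auto
  also have "\<dots> < \<infinity>" by simp
  finally show ?thesis .
qed

lemma entropy_finite_case:
  assumes G: "continuous_on (sphere 0 1) G" and G0: "\<And>z. cmod z = 1 \<Longrightarrow> 0 \<le> G z"
    and Gpos: "AE z in circ. 0 < G z" and fin: "entropy_neg G < \<infinity>"
  shows "AE z in circ. 0 < W z" "integrable circ (\<lambda>z. G z * ln (W z))"
    "enn2ereal (ennreal (1 / 2) * entropy_pos G) - enn2ereal (ennreal (1 / 2) * entropy_neg G)
      = ereal (1 / 2 * (\<integral>z. G z * ln (W z) \<partial>circ))"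
proof -
  have Gm: "G \<in> borel_measurable circle_borel" by (rule continuous_circle_measurable[OF G]) simp
  have m2: "(\<lambda>z. e2ennreal (- (ereal (G z) * log_ext (W z)))) \<in> borel_measurable circ"
    unfolding circ_borel_measurable using Gm by measurable
  have "AE z in circ. e2ennreal (- (ereal (G z) * log_ext (W z))) \<noteq> \<infinity>"
    using fin by (intro nn_integral_noteq_infinite m2) (simp add: entropy_neg_def)
  then show Wpos: "AE z in circ. 0 < W z"
    using Gpos
  proof eventually_elim
    case (elim z)
    have "W z \<noteq> 0"
    proof
      assume "W z = 0"
      then have inf: "ereal (G z) * log_ext (W z) = -\<infinity>" using elim(2) by (simp add: log_ext_def)
      have "e2ennreal (- (ereal (G z) * log_ext (W z))) = \<infinity>" unfolding inf by simp
      then show False using elim(1) by blast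
    qed
    then show ?case using W_nonneg[of z] by simp
  qed
  have pos: "entropy_pos G = (\<integral>\<^sup>+z. ennreal (G z * ln (W z)) \<partial>circ)"
    unfolding entropy_pos_def
    by (rule nn_integral_cong_AE) (use Wpos in eventually_elim, simp add: log_ext_def)
  have neg: "entropy_neg G = (\<integral>\<^sup>+z. ennreal (- (G z * ln (W z))) \<partial>circ)"
    unfolding entropy_neg_def
    by (rule nn_integral_cong_AE) (use Wpos in eventually_elim, simp add: log_ext_def)
  have fm: "(\<lambda>z. G z * ln (W z)) \<in> borel_measurable circ"
    unfolding circ_borel_measurable using Gm by measurable
  show int: "integrable circ (\<lambda>z. G z * ln (W z))"
    unfolding real_integrable_def using fm entropy_pos_finite[OF G G0] fin pos neg by auto
  obtain a where a: "entropy_pos G = ennreal a" "0 \<le> a"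
    using entropy_pos_finite[OF G G0] by (cases "entropy_pos G") auto
  obtain b where b: "entropy_neg G = ennreal b" "0 \<le> b"
    using fin by (cases "entropy_neg G") auto
  have "(\<integral>z. G z * ln (W z) \<partial>circ) = a - b"
    using real_lebesgue_integral_def[OF int] unfolding pos[symmetric] neg[symmetric] a(1) b(1)
    using a(2) b(2) by simp
  moreover have "ennreal (1 / 2) * ennreal a = ennreal (1 / 2 * a)" "ennreal (1 / 2) * ennreal b = ennreal (1 / 2 * b)"
    using a(2) b(2) by (intro ennreal_mult[symmetric]; simp)+
  ultimately show "enn2ereal (ennreal (1 / 2) * entropy_pos G) - enn2ereal (ennreal (1 / 2) * entropy_neg G)
      = ereal (1 / 2 * (\<integral>z. G z * ln (W z) \<partial>circ))"
    unfolding a(1) b(1) using a(2) b(2) by (simp add: enn2ereal_ennreal right_diff_distrib)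
qed

text \<open>By monotone convergence, the upper bounds of \<open>entropy_limsup_max\<close> tend to \<open>-\<infinity>\<close> as
  \<open>\<epsilon> \<rightarrow> 0\<close> if the negative part of \<open>G log W\<close> has infinite integral.\<close>

lemma entropy_infinite_case:
  assumes G: "continuous_on (sphere 0 1) G" and G0: "\<And>z. cmod z = 1 \<Longrightarrow> 0 \<le> G z"
    and inf: "entropy_neg G = \<infinity>"
  shows "\<exists>\<epsilon>>0. (\<integral>z. G z * ln (max (W z) \<epsilon>) \<partial>circ) < B"
proof (rule ccontr)
  assume "\<not> ?thesis"
  then have ge: "B \<le> (\<integral>z. G z * ln (max (W z) \<epsilon>) \<partial>circ)" if "0 < \<epsilon>" for \<epsilon> using that by force
  obtain C where C: "0 < C" "\<And>z. cmod z = 1 \<Longrightarrow> \<bar>G z\<bar> \<le> C" using continuous_bounded_circle[OF G] by blast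
  have Gm: "G \<in> borel_measurable circle_borel" by (rule continuous_circle_measurable[OF G]) simp
  let ?\<epsilon> = "\<lambda>i. 1 / real (Suc i)"
  define f where "f i z = G z * max 0 (- ln (max (W z) (?\<epsilon> i)))" for i z
  have fm: "f i \<in> borel_measurable circ" for i
    unfolding circ_borel_measurable f_def using Gm by measurable
  have f0: "0 \<le> f i z" if "cmod z = 1" for i z using G0[OF that] by (simp add: f_def)
  have upper: "f i z \<le> C * W z - G z * ln (max (W z) (?\<epsilon> i))" if z: "cmod z = 1" for i z
  proof -
    let ?l = "ln (max (W z) (?\<epsilon> i))"
    have "max 0 ?l \<le> W z"
    proof (cases "?\<epsilon> i \<le> W z")
      case True
      then have "0 < W z" by (meson divide_pos_pos less_le_trans of_nat_0_less_iff zero_less_Suc zero_less_one)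
      then show ?thesis using True ln_le_minus_one[of "W z"] by (simp add: max_def)
    next
      case False
      then have "?l \<le> 0" by (simp add: max_def)
      then show ?thesis using W_nonneg[of z] by simp
    qed
    then have "G z * max 0 ?l \<le> C * W z"
      using C(2)[OF z] G0[OF z] by (intro mult_mono) auto
    moreover have "f i z = G z * max 0 ?l - G z * ?l"
      by (simp add: f_def right_diff_distrib[symmetric] max_def)
    ultimately show ?thesis by linarith
  qed
  have fint: "(\<integral>\<^sup>+z. ennreal (f i z) \<partial>circ) \<le> ennreal (C - B)" for i
  proof -
    have int1: "integrable circ (\<lambda>z. C * W z)" using W_integrable by simp
    have int2: "integrable circ (\<lambda>z. G z * ln (max (W z) (?\<epsilon> i)))"
      by (intro integrable_mult_ln_max G) simp
    have "(\<integral>\<^sup>+z. ennreal (f i z) \<partial>circ) \<le> (\<integral>\<^sup>+z. ennreal (C * W z - G z * ln (max (W z) (?\<epsilon> i))) \<partial>circ)"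
      using upper by (intro nn_integral_mono ennreal_leI) auto
    also have "\<dots> = ennreal (\<integral>z. C * W z - G z * ln (max (W z) (?\<epsilon> i)) \<partial>circ)"
    proof (intro nn_integral_eq_integral Bochner_Integration.integrable_diff int1 int2 AE_I2)
      fix z assume "z \<in> space circ"
      then have z: "cmod z = 1" by simp
      show "0 \<le> C * W z - G z * ln (max (W z) (?\<epsilon> i))" using order_trans[OF f0[OF z] upper[OF z]] .
    qed
    also have "\<dots> \<le> ennreal (C - B)"
    proof (rule ennreal_leI)
      have "(\<integral>z. C * W z - G z * ln (max (W z) (?\<epsilon> i)) \<partial>circ)
          = C * (\<integral>z. W z \<partial>circ) - (\<integral>z. G z * ln (max (W z) (?\<epsilon> i)) \<partial>circ)"
        using int1 int2 by simp
      also have "C * (\<integral>z. W z \<partial>circ) \<le> C * 1" using integral_W_le_1 C(1) by (intro mult_left_mono) auto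
      finally show "(\<integral>z. C * W z - G z * ln (max (W z) (?\<epsilon> i)) \<partial>circ) \<le> C - B"
        using ge[of "?\<epsilon> i"] by simp
    qed
    finally show ?thesis .
  qed
  have mono: "f i z \<le> f j z" if z: "cmod z = 1" and ij: "i \<le> j" for i j z
  proof -
    have "?\<epsilon> j \<le> ?\<epsilon> i" using ij by (simp add: frac_le)
    then have "ln (max (W z) (?\<epsilon> j)) \<le> ln (max (W z) (?\<epsilon> i))"
      by (subst ln_le_cancel_iff) (auto simp: less_max_iff_disj)
    then show ?thesis using G0[OF z] unfolding f_def by (intro mult_left_mono) auto
  qed
  have pt: "e2ennreal (- (ereal (G z) * log_ext (W z))) \<le> (SUP i. ennreal (f i z))" if z: "cmod z = 1" for z
  proof (cases "W z = 0")
    case False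
    then have W: "0 < W z" using W_nonneg[of z] by simp
    then obtain i where i: "?\<epsilon> i < W z" using nat_approx_posE by metis
    then have "- (G z * ln (W z)) \<le> f i z"
      using G0[OF z] by (auto simp: f_def max_def mult_nonneg_nonneg)
    then have "e2ennreal (- (ereal (G z) * log_ext (W z))) \<le> ennreal (f i z)"
      using False by (simp add: log_ext_def ennreal_leI)
    then show ?thesis by (rule SUP_upper2[OF UNIV_I])
  next
    case W0: True
    show ?thesis
    proof (cases "G z = 0")
      case True
      then show ?thesis by (simp flip: zero_ereal_def)
    next
      case False
      then have Gz: "0 < G z" using G0[OF z] by simp
      have "(SUP i. ennreal (f i z)) = top"
      proof (rule ennreal_SUP_eq_top)
        fix n :: nat
        obtain i :: nat where i: "exp (real n / G z) \<le> real i" using real_arch_simple by blast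
        then have "exp (real n / G z) \<le> real (Suc i)" by simp
        then have "real n / G z \<le> ln (real (Suc i))" by (subst ln_ge_iff) auto
        moreover have "f i z = G z * ln (real (Suc i))"
          by (simp add: f_def W0 ln_div)
        ultimately have "real n \<le> f i z" using Gz by (simp add: field_simps)
        then have "of_nat n \<le> ennreal (f i z)" by (simp add: ennreal_of_nat_eq_real_of_nat ennreal_leI)
        then show "\<exists>i\<in>UNIV. of_nat n \<le> ennreal (f i z)" by blast
      qed
      then show ?thesis by (simp only: top_greatest)
    qed
  qed
  have "entropy_neg G \<le> (\<integral>\<^sup>+z. (SUP i. ennreal (f i z)) \<partial>circ)"
    unfolding entropy_neg_def using pt by (intro nn_integral_mono) auto
  also have "\<dots> = (SUP i. \<integral>\<^sup>+z. ennreal (f i z) \<partial>circ)"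
    by (rule nn_integral_monotone_convergence_SUP_AE)
      (use fm mono in \<open>auto intro!: AE_I2 ennreal_leI\<close>)
  also have "\<dots> \<le> ennreal (C - B)" using fint by (intro SUP_least)
  finally have "entropy_neg G < \<infinity>" by (rule le_less_trans) simp
  then show False using inf by simp
qed

theorem half_entropy_tendsto:
  assumes Q: "continuous_on (sphere 0 1) Q"
    and zero: "(\<forall>z. cmod z = 1 \<longrightarrow> Q z = 0) \<or> (AE z in circ. Q z \<noteq> 0)"
  shows "(\<lambda>n. ereal (1 / 2 * (\<integral>z. (cmod (Q z))\<^sup>2 * ln (bs_density n z) \<partial>circ))) \<longlonglongrightarrow> Z_functional Q w"
proof -
  define G where "G z = (cmod (Q z))\<^sup>2" for z
  have G: "continuous_on (sphere 0 1) G" unfolding G_def by (intro continuous_intros Q)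
  have G0: "0 \<le> G z" for z by (simp add: G_def)
  have Z: "Z_functional Q w = enn2ereal (ennreal (1 / 2) * entropy_pos G) - enn2ereal (ennreal (1 / 2) * entropy_neg G)"
    using Z_functional_circ[OF Q] by (simp add: G_def[abs_def])
  show ?thesis
    using zero
  proof
    assume Q0: "\<forall>z. cmod z = 1 \<longrightarrow> Q z = 0"
    have "entropy_pos G = (\<integral>\<^sup>+z. 0 \<partial>circ)" unfolding entropy_pos_def
      by (rule nn_integral_cong) (simp add: G_def Q0 flip: zero_ereal_def)
    moreover have "entropy_neg G = (\<integral>\<^sup>+z. 0 \<partial>circ)" unfolding entropy_neg_def
      by (rule nn_integral_cong) (simp add: G_def Q0 flip: zero_ereal_def)
    ultimately have "Z_functional Q w = 0" unfolding Z by (simp add: zero_ennreal.rep_eq)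
    moreover have "(\<integral>z. (cmod (Q z))\<^sup>2 * ln (bs_density n z) \<partial>circ) = (\<integral>z. 0 \<partial>circ)" for n
      by (rule circ_cong) (simp add: Q0)
    ultimately show ?thesis by (simp add: zero_ereal_def)
  next
    assume "AE z in circ. Q z \<noteq> 0"
    then have Gpos: "AE z in circ. 0 < G z" by (simp add: G_def)
    show ?thesis
    proof (cases "entropy_neg G = \<infinity>")
      case False
      then have fin: "entropy_neg G < \<infinity>" by (simp add: less_top)
      have "(\<lambda>n. 1 / 2 * (\<integral>z. G z * ln (bs_density n z) \<partial>circ)) \<longlonglongrightarrow> 1 / 2 * (\<integral>z. G z * ln (W z) \<partial>circ)"
        by (intro tendsto_mult tendsto_const entropy_limit G G0 Gpos entropy_finite_case[OF G G0 Gpos fin])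
      then show ?thesis
        unfolding Z entropy_finite_case(3)[OF G G0 Gpos fin] by (simp add: G_def)
    next
      case True
      have half: "ennreal (1 / 2) * \<infinity> = \<infinity>" by (simp add: ennreal_mult_top)
      obtain a where a: "entropy_pos G = ennreal a" "0 \<le> a"
        using entropy_pos_finite[OF G G0] by (cases "entropy_pos G") auto
      have "Z_functional Q w = -\<infinity>"
      proof -
        have "ennreal (1 / 2) * ennreal a = ennreal (1 / 2 * a)"
          using a(2) by (intro ennreal_mult[symmetric]) auto
        moreover have "enn2ereal (ennreal (1 / 2 * a)) = ereal (1 / 2 * a)"
          using a(2) by (intro enn2ereal_ennreal) auto
        ultimately show ?thesis unfolding Z True half a(1) by simp
      qed
      moreover have "(\<lambda>n. ereal (1 / 2 * (\<integral>z. G z * ln (bs_density n z) \<partial>circ))) \<longlonglongrightarrow> -\<infinity>"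
        unfolding tendsto_MInfty
      proof
        fix r :: real
        obtain \<epsilon> where \<epsilon>: "0 < \<epsilon>" "(\<integral>z. G z * ln (max (W z) \<epsilon>) \<partial>circ) < 2 * r - 1"
          using entropy_infinite_case[OF G G0 True] by blast
        have "eventually (\<lambda>n. (\<integral>z. G z * ln (bs_density n z) \<partial>circ)
          \<le> (\<integral>z. G z * ln (max (W z) \<epsilon>) \<partial>circ) + 1) sequentially"
          by (intro entropy_limsup_max G G0 \<epsilon>) simp
        then show "eventually (\<lambda>n. ereal (1 / 2 * (\<integral>z. G z * ln (bs_density n z) \<partial>circ)) < ereal r) sequentially"
          by eventually_elim (use \<epsilon>(2) in simp)
      qed
      ultimately show ?thesis by (simp add: G_def)
    qed
  qed
qed

end

section \<open>The partial sums as entropy integrals\<close>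

lemma AE_circ_not_in_finite:
  assumes "finite F" shows "AE z in circ. z \<notin> F"
proof -
  have one: "AE z in circ. z \<noteq> z0" for z0
  proof -
    have "AE \<theta> in lborel. \<theta> \<noteq> Arg2pi z0" by (rule AE_lborel_singleton)
    then have "AE \<theta> in angle_lebesgue. \<theta> \<noteq> Arg2pi z0"
      by (subst AE_restrict_space_iff) (auto elim: eventually_mono)
    then have "AE \<theta> in angle_measure. \<theta> \<noteq> Arg2pi z0"
      unfolding angle_measure_def by (subst AE_density) (auto elim: eventually_mono)
    then have "AE \<theta> in angle_measure. cis \<theta> \<noteq> z0"
      using AE_space
    proof eventually_elim
      case (elim \<theta>)
      then show ?case using Arg2pi_unique[of 1 \<theta> z0] by (auto simp: cis_conv_exp)
    qed
    moreover have "{z \<in> space circle_borel. z \<noteq> z0} \<in> sets circle_borel"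
    proof -
      have "{z \<in> space circle_borel. z \<noteq> z0} = sphere 0 1 \<inter> - {z0}"
        by (auto simp: space_restrict_space)
      then show ?thesis unfolding sets_restrict_space by (intro image_eqI[of _ _ "- {z0}"]) auto
    qed
    ultimately show ?thesis unfolding circ_def by (subst AE_distr_iff) auto
  qed
  have "AE z in circ. \<forall>s\<in>F. z \<noteq> s" using assms one by (intro AE_finite_allI)
  then show ?thesis by eventually_elim auto
qed

text \<open>The function \<open>z powi m\<close> on the circle, in a form that is continuous everywhere.\<close>

definition circle_char :: "int \<Rightarrow> complex \<Rightarrow> complex" where
  "circle_char m z = (if 0 \<le> m then z ^ nat m else cnj z ^ nat (- m))"

lemma continuous_circle_char [continuous_intros]: "continuous_on S (circle_char m)"
  by (cases "0 \<le> m") (auto simp: circle_char_def[abs_def] intro!: continuous_intros)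

lemma circle_char_eq_powi:
  assumes "cmod z = 1" shows "z powi m = circle_char m z"
proof -
  have "inverse z = cnj z"
    using cnj_mult_self_circle[OF assms] by (intro inverse_unique) (simp add: mult.commute)
  then show ?thesis by (simp add: power_int_def circle_char_def)
qed

lemma integral_circle_char:
  "(\<integral>z. circle_char m z * z ^ j \<partial>circ) = (if m = - int j then 1 else 0)"
  "(\<integral>z. circle_char m z * cnj z ^ j \<partial>circ) = (if m = int j then 1 else 0)"
proof -
  show "(\<integral>z. circle_char m z * z ^ j \<partial>circ) = (if m = - int j then 1 else 0)"
  proof (cases "0 \<le> m")
    case True
    then have "(\<integral>z. circle_char m z * z ^ j \<partial>circ) = (\<integral>z. cnj z ^ 0 * z ^ (nat m + j) \<partial>circ)"
      by (simp add: circle_char_def power_add)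
    then show ?thesis using True by (auto simp only: integral_circ_monomial split: if_splits)
  next
    case False
    then have "(\<integral>z. circle_char m z * z ^ j \<partial>circ) = (\<integral>z. cnj z ^ nat (- m) * z ^ j \<partial>circ)"
      by (simp add: circle_char_def)
    then show ?thesis using False by (auto simp only: integral_circ_monomial split: if_splits)
  qed
  show "(\<integral>z. circle_char m z * cnj z ^ j \<partial>circ) = (if m = int j then 1 else 0)"
  proof (cases "0 \<le> m")
    case True
    then have "(\<integral>z. circle_char m z * cnj z ^ j \<partial>circ) = (\<integral>z. cnj z ^ j * z ^ nat m \<partial>circ)"
      by (simp add: circle_char_def mult.commute)
    then show ?thesis using True by (auto simp only: integral_circ_monomial split: if_splits)
  next
    case False
    then have "(\<integral>z. circle_char m z * cnj z ^ j \<partial>circ) = (\<integral>z. cnj z ^ (nat (- m) + j) * z ^ 0 \<partial>circ)"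
      by (simp add: circle_char_def power_add)
    then show ?thesis using False by (auto simp only: integral_circ_monomial split: if_splits)
  qed
qed

context nontrivial_circle_measure
begin

context
  fixes N :: nat and Q :: "complex \<Rightarrow> complex" and p :: "int \<Rightarrow> complex"
  assumes Q: "continuous_on (sphere 0 1) Q"
    and p: "\<And>z. cmod z = 1 \<Longrightarrow>
      complex_of_real ((cmod (Q z))\<^sup>2) = (\<Sum>m\<in>{- int N..int N}. p m * z powi m)"
begin

lemma integral_norm2_mult:
  fixes f :: "complex \<Rightarrow> complex"
  assumes f: "continuous_on (sphere 0 1) f"
  shows "(\<integral>z. complex_of_real ((cmod (Q z))\<^sup>2) * f z \<partial>circ)
    = (\<Sum>m\<in>{- int N..int N}. p m * (\<integral>z. circle_char m z * f z \<partial>circ))"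
proof -
  have "(\<integral>z. complex_of_real ((cmod (Q z))\<^sup>2) * f z \<partial>circ)
      = (\<integral>z. (\<Sum>m\<in>{- int N..int N}. p m * (circle_char m z * f z)) \<partial>circ)"
    by (rule circ_cong) (simp only: p circle_char_eq_powi sum_distrib_right mult.assoc)
  also have "\<dots> = (\<Sum>m\<in>{- int N..int N}. p m * (\<integral>z. circle_char m z * f z \<partial>circ))"
    by (subst Bochner_Integration.integral_sum)
      (auto intro!: circ_integrable continuous_intros f)
  finally show ?thesis .
qed

lemma fourier_coefficients:
  assumes "j \<le> N"
  shows "(\<integral>z. complex_of_real ((cmod (Q z))\<^sup>2) * z ^ j \<partial>circ) = p (- int j)"
    and "(\<integral>z. complex_of_real ((cmod (Q z))\<^sup>2) * cnj z ^ j \<partial>circ) = p (int j)"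
proof -
  have c: "continuous_on (sphere 0 1) (\<lambda>z :: complex. z ^ j)" "continuous_on (sphere 0 1) (\<lambda>z. cnj z ^ j)"
    by (intro continuous_intros)+
  show "(\<integral>z. complex_of_real ((cmod (Q z))\<^sup>2) * z ^ j \<partial>circ) = p (- int j)"
    unfolding integral_norm2_mult[OF c(1)] integral_circle_char using assms
    by (simp add: if_distrib[of "\<lambda>x. _ * x"] sum.delta cong: if_cong)
  show "(\<integral>z. complex_of_real ((cmod (Q z))\<^sup>2) * cnj z ^ j \<partial>circ) = p (int j)"
    unfolding integral_norm2_mult[OF c(2)] integral_circle_char using assms
    by (simp add: if_distrib[of "\<lambda>x. _ * x"] sum.delta cong: if_cong)
qed

lemma cnj_fourier_coefficient:
  assumes "j \<le> N" shows "p (- int j) = cnj (p (int j))"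
proof -
  have "cnj (p (int j)) = (\<integral>z. cnj (complex_of_real ((cmod (Q z))\<^sup>2) * cnj z ^ j) \<partial>circ)"
    unfolding fourier_coefficients(2)[OF assms, symmetric] by (rule Bochner_Integration.integral_cnj[symmetric])
  also have "\<dots> = p (- int j)" using fourier_coefficients(1)[OF assms] by simp
  finally show ?thesis ..
qed

lemma integral_norm2: "(\<integral>z. (cmod (Q z))\<^sup>2 \<partial>circ) = Re (p 0)"
proof -
  have "complex_of_real (\<integral>z. (cmod (Q z))\<^sup>2 \<partial>circ) = p 0"
    using fourier_coefficients(1)[of 0] by (simp flip: of_real_power)
  then show ?thesis by (metis Re_complex_of_real)
qed

lemma integral_norm2_holomorphic:
  assumes L: "L holomorphic_on ball 0 R" "1 < R" "L 0 = 0"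
  shows "(\<integral>z. complex_of_real ((cmod (Q z))\<^sup>2) * L z \<partial>circ)
    = (\<Sum>j=1..N. cnj (p (int j)) * ((deriv ^^ j) L 0 / fact j))"
proof -
  have cont: "continuous_on (sphere 0 1) L"
    by (rule continuous_on_subset[OF holomorphic_on_imp_continuous_on[OF L(1)]]) (use L(2) in auto)
  have I: "(\<integral>z. circle_char m z * L z \<partial>circ)
      = (if m < 0 then (deriv ^^ nat (- m)) L 0 / fact (nat (- m)) else 0)" for m
    using integral_circ_holomorphic[OF L(1,2)] L(3) by (simp add: circle_char_def)
  have "(\<integral>z. complex_of_real ((cmod (Q z))\<^sup>2) * L z \<partial>circ)
      = (\<Sum>m\<in>{- int N..int N}. p m * (if m < 0 then (deriv ^^ nat (- m)) L 0 / fact (nat (- m)) else 0))"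
    unfolding integral_norm2_mult[OF cont] I ..
  also have "\<dots> = (\<Sum>m\<in>{- int N..-1}. p m * ((deriv ^^ nat (- m)) L 0 / fact (nat (- m))))"
    by (rule sum.mono_neutral_cong_right) auto
  also have "\<dots> = (\<Sum>j=1..N. p (- int j) * ((deriv ^^ j) L 0 / fact j))"
    by (rule sum.reindex_bij_witness[of _ "\<lambda>j. - int j" "\<lambda>m. nat (- m)"]) auto
  also have "\<dots> = (\<Sum>j=1..N. cnj (p (int j)) * ((deriv ^^ j) L 0 / fact j))"
    by (intro sum.cong refl) (simp add: cnj_fourier_coefficient)
  finally show ?thesis .
qed

text \<open>On the circle \<open>log v\<^sub>n = 2 \<Sum>\<^sub>k\<^sub><\<^sub>n log \<rho>\<^sub>k - 2 Re log \<Phi>\<^sub>n\<^sup>*\<close>, and the integral against \<open>|Q|\<^sup>2\<close> sees the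
  first \<open>N\<close> Taylor coefficients of \<open>log \<Phi>\<^sub>n\<^sup>*\<close>.\<close>

theorem half_entropy_eq_partial_sum:
  "1 / 2 * (\<integral>z. (cmod (Q z))\<^sup>2 * ln (bs_density n z) \<partial>circ)
    = (\<Sum>k<n. Re (p 0 * complex_of_real (ln (rho \<mu> (int k))) +
        (\<Sum>m = 1..N. cnj (p (int m)) *
          (\<Sum>P\<in>M0_set m. complex_of_real (N_coeff P) *
             beta (verblunsky \<mu>) (shift_collection P (int k))))))"
proof -
  let ?a = "verblunsky_nat \<mu>"
  let ?G = "\<lambda>z. (cmod (Q z))\<^sup>2"
  let ?K = "poly_norm2 \<mu> (szego_poly ?a n)"
  let ?s = "\<lambda>m k. \<Sum>P\<in>M0_set m. complex_of_real (N_coeff P) * beta (verblunsky \<mu>) (shift_collection P (int k))"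
  have nz: "poly (szego_rev ?a n) z \<noteq> 0" if "cmod z \<le> 1" for z
    using szego_rev_nonzero(1) cmod_verblunsky_less_1 that by blast
  obtain L R where L: "1 < R" "L holomorphic_on ball 0 R"
    "\<And>z. cmod z < R \<Longrightarrow> exp (L z) = poly (szego_rev ?a n) z" "L 0 = 0"
    "L has_fps_expansion fps_compose (fps_ln 1) (fps_of_poly (szego_rev ?a n) - 1)"
    using poly_holomorphic_log[OF nz szego_rev_0] by metis
  have coeff: "(deriv ^^ m) L 0 / fact m = - (\<Sum>k<n. ?s m k)" if m: "0 < m" for m
  proof -
    have v: "verblunsky \<mu> (int k) = ?a k" "verblunsky \<mu> (-1) = -1" for k
      by (simp_all add: verblunsky_def)
    have "(deriv ^^ m) L 0 / fact m
        = fps_nth (fps_compose (fps_ln 1) (fps_of_poly (szego_rev ?a n) - 1)) m"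
      by (rule fps_nth_fps_expansion[OF L(5), symmetric])
    also have "\<dots> = - (\<Sum>P | P \<in> M_set m \<and> window n P. complex_of_real (N_coeff P) * beta (verblunsky \<mu>) P)"
      by (rule nth_log_szego_rev[OF v m])
    also have "\<dots> = - (\<Sum>k<n. ?s m k)"
      by (subst sum_window_eq_sum_translates) (auto simp: verblunsky_def)
    finally show ?thesis .
  qed
  have K: "0 < ?K" by (intro poly_norm2_pos szego_poly_nonzero)
  have lnK: "1 / 2 * ln ?K = (\<Sum>k<n. ln (rho \<mu> (int k)))"
  proof -
    have pos: "0 < 1 - (cmod (?a k))\<^sup>2" for k
      using cmod_verblunsky_less_1[of k] by (simp add: abs_square_less_1)
    have "ln ?K = (\<Sum>k<n. ln (1 - (cmod (?a k))\<^sup>2))"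
      unfolding poly_norm2_szego
    proof (rule ln_prod)
      show "1 - (cmod (?a k))\<^sup>2 \<noteq> 0" for k using pos[of k] by linarith
    qed simp
    also have "\<dots> = (\<Sum>k<n. 2 * ln (rho \<mu> (int k)))"
    proof (intro sum.cong refl)
      fix k
      have "rho \<mu> (int k) = sqrt (1 - (cmod (?a k))\<^sup>2)" by (simp add: rho_def verblunsky_def)
      then show "ln (1 - (cmod (?a k))\<^sup>2) = 2 * ln (rho \<mu> (int k))"
        by (simp add: ln_sqrt[OF less_imp_le[OF pos]])
    qed
    finally show ?thesis by (simp add: sum_distrib_left[symmetric])
  qed
  have contL: "continuous_on (sphere 0 1) L"
    by (rule continuous_on_subset[OF holomorphic_on_imp_continuous_on[OF L(2)]]) (use L(1) in auto)
  have iG: "integrable circ ?G" by (intro circ_integrable continuous_intros Q)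
  have iGL: "integrable circ (\<lambda>z. complex_of_real (?G z) * L z)"
    by (intro circ_integrable continuous_intros Q contL)
  have "(\<integral>z. ?G z * ln (bs_density n z) \<partial>circ)
      = (\<integral>z. ln ?K * ?G z - 2 * Re (complex_of_real (?G z) * L z) \<partial>circ)"
  proof (rule circ_cong)
    fix z :: complex assume z: "cmod z = 1"
    have "cmod (poly (szego_poly ?a n) z) = cmod (exp (L z))"
      using L(1) L(3)[of z] z cmod_szego_rev_circle[OF z] by simp
    then have "bs_density n z = ?K / (exp (Re (L z)))\<^sup>2"
      by (simp add: bs_density_def norm_exp_eq_Re)
    then have "ln (bs_density n z) = ln ?K - 2 * Re (L z)"
      using K by (simp add: ln_div ln_realpow)
    moreover have "Re (complex_of_real r * y) = r * Re y" for r y by simp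
    ultimately show "?G z * ln (bs_density n z) = ln ?K * ?G z - 2 * Re (complex_of_real (?G z) * L z)"
      by (simp only:) (simp add: algebra_simps)
  qed
  also have "\<dots> = ln ?K * (\<integral>z. ?G z \<partial>circ) - 2 * Re (\<integral>z. complex_of_real (?G z) * L z \<partial>circ)"
  proof -
    have "(\<integral>z. ln ?K * ?G z - 2 * Re (complex_of_real (?G z) * L z) \<partial>circ)
        = (\<integral>z. ln ?K * ?G z \<partial>circ) - (\<integral>z. 2 * Re (complex_of_real (?G z) * L z) \<partial>circ)"
      by (intro Bochner_Integration.integral_diff integrable_mult_right iG
        integrable_bounded_linear[OF bounded_linear_Re iGL])
    also have "(\<integral>z. 2 * Re (complex_of_real (?G z) * L z) \<partial>circ)
        = 2 * Re (\<integral>z. complex_of_real (?G z) * L z \<partial>circ)"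
      by (simp only: Bochner_Integration.integral_mult_right_zero integral_bounded_linear[OF bounded_linear_Re iGL])
    finally show ?thesis by (simp only: Bochner_Integration.integral_mult_right_zero)
  qed
  also have "\<dots> = ln ?K * Re (p 0) + 2 * Re (\<Sum>m=1..N. cnj (p (int m)) * (\<Sum>k<n. ?s m k))"
    unfolding integral_norm2 integral_norm2_holomorphic[OF L(2,1,4)]
    by (simp add: coeff sum_negf)
  finally have "1 / 2 * (\<integral>z. ?G z * ln (bs_density n z) \<partial>circ)
      = 1 / 2 * ln ?K * Re (p 0) + Re (\<Sum>m=1..N. cnj (p (int m)) * (\<Sum>k<n. ?s m k))" by simp
  also have "(\<Sum>m=1..N. cnj (p (int m)) * (\<Sum>k<n. ?s m k)) = (\<Sum>k<n. \<Sum>m=1..N. cnj (p (int m)) * ?s m k)"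
    unfolding sum_distrib_left[of _ _ "{..<n}"] by (rule sum.swap)
  also have "1 / 2 * ln ?K * Re (p 0) = (\<Sum>k<n. Re (p 0 * complex_of_real (ln (rho \<mu> (int k)))))"
    unfolding lnK by (simp add: sum_distrib_left mult.commute)
  finally show ?thesis by (simp only: Re_sum plus_complex.sel sum.distrib)
qed

end

end

section \<open>The sum rule\<close>

theorem theorem3p3:
  fixes \<mu> :: "complex measure" and w :: "real \<Rightarrow> real"
    and N :: nat and q :: "nat \<Rightarrow> complex" and Q :: "complex \<Rightarrow> complex"
    and p :: "int \<Rightarrow> complex"
  assumes "nontrivial_circle_prob \<mu>"
    and "ac_density \<mu> w"
    and "\<And>z. Q z = (\<Sum>m\<le>N. q m * z ^ m)"
    and "\<And>z. cmod z = 1 \<Longrightarrow>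
           complex_of_real ((cmod (Q z))\<^sup>2) = (\<Sum>m\<in>{- int N..int N}. p m * z powi m)"
  shows "(\<lambda>n. ereal (\<Sum>k<n.
            Re (p 0 * complex_of_real (ln (rho \<mu> (int k))) +
                (\<Sum>m = 1..N. cnj (p (int m)) *
                  (\<Sum>P\<in>M0_set m. complex_of_real (N_coeff P) *
                     beta (verblunsky \<mu>) (shift_collection P (int k)))))))
         \<longlonglongrightarrow> Z_functional Q w"
proof -
  interpret circle_ac \<mu> w by unfold_locales (fact assms)+
  define r where "r = (\<Sum>m\<le>N. monom (q m) m)"
  have Qr: "Q z = poly r z" for z
    unfolding r_def assms(3) by (simp add: poly_sum poly_monom)
  have cont: "continuous_on (sphere 0 1) Q"
    unfolding Qr[abs_def] by (intro continuous_intros)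
  have zero: "(\<forall>z. cmod z = 1 \<longrightarrow> Q z = 0) \<or> (AE z in circ. Q z \<noteq> 0)"
  proof (cases "r = 0")
    case False
    then have "AE z in circ. z \<notin> {z. poly r z = 0}"
      by (intro AE_circ_not_in_finite poly_roots_finite)
    then show ?thesis by (simp add: Qr)
  qed (simp add: Qr)
  have "1 / 2 * (\<integral>z. (cmod (Q z))\<^sup>2 * ln (bs_density n z) \<partial>circ)
    = (\<Sum>k<n. Re (p 0 * complex_of_real (ln (rho \<mu> (int k))) +
        (\<Sum>m = 1..N. cnj (p (int m)) *
          (\<Sum>P\<in>M0_set m. complex_of_real (N_coeff P) *
             beta (verblunsky \<mu>) (shift_collection P (int k))))))" for n
    by (rule half_entropy_eq_partial_sum[OF cont]) (rule assms(4))
  with half_entropy_tendsto[OF cont zero] show ?thesis by simp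
qed

end
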